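(* Let $r\ge 0$ be an integer. The mod-2 homology functor $F:=H_1(-;\mathbb F_2):\mathcal M(r,\mathbb F_2)\to \mathcal G\ell(r,\mathbb F_2)$ induces a homotopy equivalence on classifying spaces $$F_*: B\mathcal M(r,\mathbb F_2)\simeq B\mathcal G\ell(r,\mathbb F_2)\simeq BGL(r,\mathbb F_2).$$
   Context: Matroids have finite ground sets (loops and parallel elements are allowed). A morphism of matroids $(E_1,M_1)\to(E_2,M_2)$ is an injective map $f:E_1\to E_2$ such that a subset of $E_1$ is independent if and only if its image in $E_2$ is independent. A representation of a matroid on $E$ over a field $K$ is a map $\rho:E\to V$ to a $K$-vector space such that a subset of $E$ is independent iff $\rho$ maps it injectively onto a linearly independent set, and such that $\rho(E)$ spans $V$. A matroid is binary if it has a representation over $\mathbb F_2$. $\mathcal M(r,\mathbb F_2)$ is the category whose objects are the binary matroids of rank $r$ and whose morphisms are the injective maps $f:E_1\to E_2$ of ground sets such that a subset of $E_1$ is independent if and only if its image in $E_2$ is independent. For a matroid $M$ on $E$, $H_1(M)$ is the abelian group generated by the elements of $E$ modulo the relations $\sum_{e\in C}e=0$ for all circuits $C$ of $M$, and $H_1(M;\mathbb F_2):=H_1(M)\otimes\mathbb F_2$. For binary $M$ of rank $r$, $H_1(M;\mathbb F_2)\cong\mathbb F_2^r$, and a morphism between binary matroids of rank $r$ induces an isomorphism on $H_1(-;\mathbb F_2)$. $\mathcal G\ell(r,\mathbb F_2)$ is the category whose objects are the $\mathbb F_2$-vector spaces isomorphic to $\mathbb F_2^r$ and whose morphisms are the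 linear isomorphisms. $B\mathcal C$ denotes the classifying space (geometric realization of the nerve) of a category $\mathcal C$; all categories here are taken to be small (replaced by equivalent small categories). *)

theory Defs
  imports
    "HOL-Homology.Homology"
    "HOL-Algebra.Free_Abelian_Groups"
    "HOL-Algebra.Generated_Groups"
    "HOL-Library.Z2"
    "Jordan_Normal_Form.VS_Connect"
begin

section \<open>Small categories and functors\<close>

record ('o, 'm) cat =
  Ob :: "'o set"
  Mor :: "'m set"
  Dom :: "'m \<Rightarrow> 'o"
  Cod :: "'m \<Rightarrow> 'o"
  Id :: "'o \<Rightarrow> 'm"
  Comp :: "'m \<Rightarrow> 'm \<Rightarrow> 'm"  \<comment> \<open>\<open>Comp C g f\<close> is \<open>g\<close> after \<open>f\<close>\<close>

locale small_category =
  fixes C :: "('o, 'm) cat"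
  assumes Dom_Ob: "f \<in> Mor C \<Longrightarrow> Dom C f \<in> Ob C"
    and Cod_Ob: "f \<in> Mor C \<Longrightarrow> Cod C f \<in> Ob C"
    and Id_Mor: "x \<in> Ob C \<Longrightarrow> Id C x \<in> Mor C"
    and Dom_Id: "x \<in> Ob C \<Longrightarrow> Dom C (Id C x) = x"
    and Cod_Id: "x \<in> Ob C \<Longrightarrow> Cod C (Id C x) = x"
    and Comp_Mor: "\<lbrakk>f \<in> Mor C; g \<in> Mor C; Cod C f = Dom C g\<rbrakk> \<Longrightarrow> Comp C g f \<in> Mor C"
    and Dom_Comp: "\<lbrakk>f \<in> Mor C; g \<in> Mor C; Cod C f = Dom C g\<rbrakk> \<Longrightarrow> Dom C (Comp C g f) = Dom C f"
    and Cod_Comp: "\<lbrakk>f \<in> Mor C; g \<in> Mor C; Cod C f = Dom C g\<rbrakk> \<Longrightarrow> Cod C (Comp C g f) = Cod C g"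
    and Comp_Id_right: "f \<in> Mor C \<Longrightarrow> Comp C f (Id C (Dom C f)) = f"
    and Comp_Id_left: "f \<in> Mor C \<Longrightarrow> Comp C (Id C (Cod C f)) f = f"
    and Comp_assoc: "\<lbrakk>f \<in> Mor C; g \<in> Mor C; h \<in> Mor C; Cod C f = Dom C g; Cod C g = Dom C h\<rbrakk>
      \<Longrightarrow> Comp C h (Comp C g f) = Comp C (Comp C h g) f"

locale cat_functor =
  C: small_category C + D: small_category D
  for C :: "('o, 'm) cat" and D :: "('p, 'n) cat" +
  fixes Fo :: "'o \<Rightarrow> 'p" and Fm :: "'m \<Rightarrow> 'n"
  assumes Fo_Ob: "x \<in> Ob C \<Longrightarrow> Fo x \<in> Ob D"
    and Fm_Mor: "f \<in> Mor C \<Longrightarrow> Fm f \<in> Mor D"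
    and Dom_Fm: "f \<in> Mor C \<Longrightarrow> Dom D (Fm f) = Fo (Dom C f)"
    and Cod_Fm: "f \<in> Mor C \<Longrightarrow> Cod D (Fm f) = Fo (Cod C f)"
    and Fm_Id: "x \<in> Ob C \<Longrightarrow> Fm (Id C x) = Id D (Fo x)"
    and Fm_Comp: "\<lbrakk>f \<in> Mor C; g \<in> Mor C; Cod C f = Dom C g\<rbrakk>
      \<Longrightarrow> Fm (Comp C g f) = Comp D (Fm g) (Fm f)"

text \<open>Categories of sets with structure. A morphism carries its source and target, and its
  underlying function is extensional, so that functions agreeing on the underlying set of the
  source give the same morphism.\<close>

definition concrete_cat ::
  "'o set \<Rightarrow> ('o \<Rightarrow> 'a set) \<Rightarrow> ('o \<Rightarrow> 'o \<Rightarrow> ('a \<Rightarrow> 'a) \<Rightarrow> bool) \<Rightarrow> ('o, 'o \<times> ('a \<Rightarrow> 'a) \<times> 'o) cat"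
where
  "concrete_cat obs und hom_pred = \<lparr>
     Ob = obs,
     Mor = {(x, f, y). x \<in> obs \<and> y \<in> obs \<and> f \<in> extensional (und x) \<and> hom_pred x y f},
     Dom = (\<lambda>(x, f, y). x),
     Cod = (\<lambda>(x, f, y). y),
     Id = (\<lambda>x. (x, restrict id (und x), x)),
     Comp = (\<lambda>(y', g, z) (x, f, y). (x, compose (und x) g f, z))\<rparr>"

definition group_cat :: "('g, 'b) monoid_scheme \<Rightarrow> (unit, 'g) cat" where
  "group_cat G = \<lparr>
     Ob = {()},
     Mor = carrier G,
     Dom = (\<lambda>_. ()),
     Cod = (\<lambda>_. ()),
     Id = (\<lambda>_. \<one>\<^bsub>G\<^esub>),
     Comp = (\<lambda>g f. g \<otimes>\<^bsub>G\<^esub> f)\<rparr>"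

text \<open>The poset \<open>0 < 1 < \<dots> < n\<close> as a category; \<open>(i, j)\<close> is the unique morphism from \<open>i\<close> to \<open>j\<close>.\<close>

definition ord_cat :: "nat \<Rightarrow> (nat, nat \<times> nat) cat" where
  "ord_cat n = \<lparr>
     Ob = {..n},
     Mor = {(i, j). i \<le> j \<and> j \<le> n},
     Dom = fst,
     Cod = snd,
     Id = (\<lambda>i. (i, i)),
     Comp = (\<lambda>(j', k) (i, j). (i, k))\<rparr>"


section \<open>Classifying spaces\<close>

text \<open>Representatives of the order-preserving maps from \<open>{0..m}\<close> to \<open>{0..n}\<close>;
  their values outside \<open>{0..m}\<close> are never used.\<close>

definition ord_maps :: "nat \<Rightarrow> nat \<Rightarrow> (nat \<Rightarrow> nat) set" where
  "ord_maps m n = {\<theta>. mono_on {..m} \<theta> \<and> \<theta> ` {..m} \<subseteq> {..n}}"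

text \<open>Raw data of a simplicial set: \<open>act X m n \<theta>\<close> is the map from \<open>n\<close>-simplices to
  \<open>m\<close>-simplices induced by \<open>\<theta> \<in> ord_maps m n\<close>.\<close>

record 's sset =
  simps :: "nat \<Rightarrow> 's set"
  act :: "nat \<Rightarrow> nat \<Rightarrow> (nat \<Rightarrow> nat) \<Rightarrow> 's \<Rightarrow> 's"

text \<open>An \<open>n\<close>-simplex of the nerve is a functor from \<open>ord_cat n\<close>. It is recorded by its
  (extensional) action on morphisms, which determines its action on objects.\<close>

definition nerve :: "('o, 'm) cat \<Rightarrow> (nat \<times> nat \<Rightarrow> 'm) sset" where
  "nerve C = \<lparr>
     simps = (\<lambda>n. {\<sigma> \<in> extensional (Mor (ord_cat n)). \<exists>x. cat_functor (ord_cat n) C x \<sigma>}),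
     act = (\<lambda>m n \<theta> \<sigma>. restrict (\<lambda>(i, j). \<sigma> (\<theta> i, \<theta> j)) (Mor (ord_cat m)))\<rparr>"

definition nerve_map :: "('m \<Rightarrow> 'n) \<Rightarrow> nat \<Rightarrow> (nat \<times> nat \<Rightarrow> 'm) \<Rightarrow> (nat \<times> nat \<Rightarrow> 'n)" where
  "nerve_map Fm n \<sigma> = restrict (Fm \<circ> \<sigma>) (Mor (ord_cat n))"

definition quotient_topology :: "'a topology \<Rightarrow> ('a \<times> 'a) set \<Rightarrow> 'a set topology" where
  "quotient_topology T R =
     topology (\<lambda>U. U \<subseteq> topspace T // R \<and> openin T {p \<in> topspace T. R `` {p} \<in> U})"

lemma openin_quotient_topology:
  "openin (quotient_topology T R) U \<longleftrightarrow>
     U \<subseteq> topspace T // R \<and> openin T {p \<in> topspace T. R `` {p} \<in> U}"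
proof -
  have "istopology (\<lambda>U. U \<subseteq> topspace T // R \<and> openin T {p \<in> topspace T. R `` {p} \<in> U})"
  proof (unfold istopology_def, intro conjI allI impI)
    fix S U
    assume S: "S \<subseteq> topspace T // R \<and> openin T {p \<in> topspace T. R `` {p} \<in> S}"
      and U: "U \<subseteq> topspace T // R \<and> openin T {p \<in> topspace T. R `` {p} \<in> U}"
    then have "openin T ({p \<in> topspace T. R `` {p} \<in> S} \<inter> {p \<in> topspace T. R `` {p} \<in> U})"
      by (intro openin_Int) auto
    moreover have "{p \<in> topspace T. R `` {p} \<in> S} \<inter> {p \<in> topspace T. R `` {p} \<in> U}
        = {p \<in> topspace T. R `` {p} \<in> S \<inter> U}"
      by auto
    ultimately show "openin T {p \<in> topspace T. R `` {p} \<in> S \<inter> U}"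
      by simp
    show "S \<inter> U \<subseteq> topspace T // R"
      using S by auto
  next
    fix K
    assume K: "\<forall>U\<in>K. U \<subseteq> topspace T // R \<and> openin T {p \<in> topspace T. R `` {p} \<in> U}"
    then have "openin T (\<Union>U\<in>K. {p \<in> topspace T. R `` {p} \<in> U})"
      by (intro openin_Union) auto
    moreover have "(\<Union>U\<in>K. {p \<in> topspace T. R `` {p} \<in> U}) = {p \<in> topspace T. R `` {p} \<in> \<Union>K}"
      by auto
    ultimately show "openin T {p \<in> topspace T. R `` {p} \<in> \<Union>K}"
      by simp
    show "\<Union>K \<subseteq> topspace T // R"
      using K by auto
  qed
  then show ?thesis
    by (simp add: quotient_topology_def)
qed

lemma topspace_quotient_topology: "topspace (quotient_topology T R) = topspace T // R"
proof
  show "topspace (quotient_topology T R) \<subseteq> topspace T // R"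
    using openin_topspace openin_quotient_topology by blast
  have "{p \<in> topspace T. R `` {p} \<in> topspace T // R} = topspace T"
    by (auto intro: quotientI)
  then have "openin (quotient_topology T R) (topspace T // R)"
    by (simp add: openin_quotient_topology)
  then show "topspace T // R \<subseteq> topspace (quotient_topology T R)"
    by (rule openin_subset)
qed

text \<open>The affine map of standard simplices induced by \<open>\<theta>\<close>.\<close>

definition simplex_push :: "nat \<Rightarrow> (nat \<Rightarrow> nat) \<Rightarrow> (nat \<Rightarrow> real) \<Rightarrow> (nat \<Rightarrow> real)" where
  "simplex_push m \<theta> t = (\<lambda>j. \<Sum>i | i \<le> m \<and> \<theta> i = j. t i)"

definition pre_realization :: "'s sset \<Rightarrow> (nat \<times> 's \<times> (nat \<Rightarrow> real)) topology" where
  "pre_realization X =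
     sum_topology
       (\<lambda>n. prod_topology (discrete_topology (simps X n))
              (subtopology (powertop_real UNIV) (standard_simplex n)))
       UNIV"

definition gluing :: "'s sset \<Rightarrow>
    ((nat \<times> 's \<times> (nat \<Rightarrow> real)) \<times> (nat \<times> 's \<times> (nat \<Rightarrow> real))) set" where
  "gluing X = {((m, act X m n \<theta> \<sigma>, t), (n, \<sigma>, simplex_push m \<theta> t)) | m n \<theta> \<sigma> t.
     \<theta> \<in> ord_maps m n \<and> \<sigma> \<in> simps X n \<and> t \<in> standard_simplex m}"

text \<open>The equivalence relation generated by the gluing (it is the identity off the
  space that is being glued).\<close>

definition realization_rel :: "'s sset \<Rightarrow>
    ((nat \<times> 's \<times> (nat \<Rightarrow> real)) \<times> (nat \<times> 's \<times> (nat \<Rightarrow> real))) set" where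
  "realization_rel X = (gluing X \<union> (gluing X)\<inverse>)\<^sup>*"

definition realization :: "'s sset \<Rightarrow> (nat \<times> 's \<times> (nat \<Rightarrow> real)) set topology" where
  "realization X = quotient_topology (pre_realization X) (realization_rel X)"

text \<open>The map of realizations induced by a simplicial map \<open>\<phi>\<close> into \<open>Y\<close>: the class of
  \<open>(n, \<sigma>, t)\<close> goes to the class of \<open>(n, \<phi> n \<sigma>, t)\<close>.\<close>

definition realization_map :: "'u sset \<Rightarrow> (nat \<Rightarrow> 's \<Rightarrow> 'u) \<Rightarrow>
    (nat \<times> 's \<times> (nat \<Rightarrow> real)) set \<Rightarrow> (nat \<times> 'u \<times> (nat \<Rightarrow> real)) set" where
  "realization_map Y \<phi> c = realization_rel Y `` ((\<lambda>(n, \<sigma>, t). (n, \<phi> n \<sigma>, t)) ` c)"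

definition classifying_space ::
  "('o, 'm) cat \<Rightarrow> (nat \<times> (nat \<times> nat \<Rightarrow> 'm) \<times> (nat \<Rightarrow> real)) set topology" where
  "classifying_space C = realization (nerve C)"

definition classifying_map :: "('p, 'n) cat \<Rightarrow> ('m \<Rightarrow> 'n) \<Rightarrow>
    (nat \<times> (nat \<times> nat \<Rightarrow> 'm) \<times> (nat \<Rightarrow> real)) set \<Rightarrow>
    (nat \<times> (nat \<times> nat \<Rightarrow> 'n) \<times> (nat \<Rightarrow> real)) set" where
  "classifying_map D Fm = realization_map (nerve D) (nerve_map Fm)"

definition homotopy_equivalence_map :: "'a topology \<Rightarrow> 'b topology \<Rightarrow> ('a \<Rightarrow> 'b) \<Rightarrow> bool" where
  "homotopy_equivalence_map X Y f \<longleftrightarrow>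
     continuous_map X Y f \<and>
     (\<exists>g. continuous_map Y X g \<and>
          homotopic_with (\<lambda>_. True) X X (g \<circ> f) id \<and>
          homotopic_with (\<lambda>_. True) Y Y (f \<circ> g) id)"


section \<open>Matroids\<close>

record 'a matroid =
  ground :: "'a set"
  indep :: "'a set set"

definition is_matroid :: "'a matroid \<Rightarrow> bool" where
  "is_matroid M \<longleftrightarrow>
     finite (ground M) \<and>
     indep M \<subseteq> Pow (ground M) \<and>
     {} \<in> indep M \<and>
     (\<forall>S\<in>indep M. \<forall>T\<subseteq>S. T \<in> indep M) \<and>
     (\<forall>S\<in>indep M. \<forall>T\<in>indep M. card S < card T \<longrightarrow> (\<exists>e\<in>T - S. insert e S \<in> indep M))"

definition matroid_rank :: "'a matroid \<Rightarrow> nat" where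
  "matroid_rank M = Max (card ` indep M)"

definition circuit :: "'a matroid \<Rightarrow> 'a set \<Rightarrow> bool" where
  "circuit M C \<longleftrightarrow> C \<subseteq> ground M \<and> C \<notin> indep M \<and> (\<forall>S. S \<subset> C \<longrightarrow> S \<in> indep M)"

definition matroid_hom :: "'a matroid \<Rightarrow> 'b matroid \<Rightarrow> ('a \<Rightarrow> 'b) \<Rightarrow> bool" where
  "matroid_hom M N f \<longleftrightarrow>
     f \<in> ground M \<rightarrow> ground N \<and> inj_on f (ground M) \<and>
     (\<forall>S\<subseteq>ground M. S \<in> indep M \<longleftrightarrow> f ` S \<in> indep N)"

definition representation ::
  "('k, 'c) ring_scheme \<Rightarrow> ('k, 'v, 'd) module_scheme \<Rightarrow> 'a matroid \<Rightarrow> ('a \<Rightarrow> 'v) \<Rightarrow> bool" where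
  "representation K V M \<rho> \<longleftrightarrow>
     vectorspace K V \<and> \<rho> \<in> ground M \<rightarrow> carrier V \<and>
     (\<forall>S\<subseteq>ground M. S \<in> indep M \<longleftrightarrow>
        inj_on \<rho> S \<and> \<not> LinearCombinations.module.lin_dep K V (\<rho> ` S)) \<and>
     LinearCombinations.module.span K V (\<rho> ` ground M) = carrier V"

abbreviation F2 :: "bit ring" where
  "F2 \<equiv> class_ring"

text \<open>A representing space is spanned by the finitely many vectors of the ground set, so it is
  isomorphic to some \<open>F2\<^sup>n\<close>. The type \<^typ>\<open>bit Matrix.vec\<close> contains the carriers of all these, hence
  it suffices to let the representing space range over vector spaces carried by this type.\<close>

definition binary :: "'a matroid \<Rightarrow> bool" where
  "binary M \<longleftrightarrow> (\<exists>(V :: (bit, bit Matrix.vec) module) \<rho>. representation F2 V M \<rho>)"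

text \<open>A small model of the category of binary matroids of rank \<open>r\<close>: the ground sets are the finite
  subsets of \<^typ>\<open>'a\<close>. For infinite \<^typ>\<open>'a\<close> every finite matroid is isomorphic to one of these.\<close>

definition binary_matroid_cat ::
  "nat \<Rightarrow> ('a matroid, 'a matroid \<times> ('a \<Rightarrow> 'a) \<times> 'a matroid) cat" where
  "binary_matroid_cat r =
     concrete_cat {M. is_matroid M \<and> binary M \<and> matroid_rank M = r} ground matroid_hom"


section \<open>Matroid homology\<close>

definition circuit_subgroup :: "'a matroid \<Rightarrow> ('a \<Rightarrow>\<^sub>0 int) set" where
  "circuit_subgroup M =
     generate (free_Abelian_group (ground M)) {\<Sum>e\<in>C. frag_of e | C. circuit M C}"

definition H1 :: "'a matroid \<Rightarrow> ('a \<Rightarrow>\<^sub>0 int) set monoid" where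
  "H1 M = free_Abelian_group (ground M) Mod circuit_subgroup M"

text \<open>Here and in \<open>tensor_map\<close> below, elements of quotient groups are cosets, and multiplying the
  image of a coset by the subgroup being divided out yields the coset containing that image.\<close>

definition H1_map :: "'a matroid \<Rightarrow> ('a \<Rightarrow> 'a) \<Rightarrow> ('a \<Rightarrow>\<^sub>0 int) set \<Rightarrow> ('a \<Rightarrow>\<^sub>0 int) set" where
  "H1_map N f X =
     circuit_subgroup N <#>\<^bsub>free_Abelian_group (ground N)\<^esub> frag_extend (frag_of \<circ> f) ` X"

text \<open>The tensor product over the integers of two abelian groups, written multiplicatively.\<close>

definition tensor_subgroup ::
  "('a, 'c) monoid_scheme \<Rightarrow> ('b, 'd) monoid_scheme \<Rightarrow> (('a \<times> 'b) \<Rightarrow>\<^sub>0 int) set" where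
  "tensor_subgroup A B =
     generate (free_Abelian_group (carrier A \<times> carrier B))
       ({frag_of (a \<otimes>\<^bsub>A\<^esub> a', b) - frag_of (a, b) - frag_of (a', b) | a a' b.
           a \<in> carrier A \<and> a' \<in> carrier A \<and> b \<in> carrier B} \<union>
        {frag_of (a, b \<otimes>\<^bsub>B\<^esub> b') - frag_of (a, b) - frag_of (a, b') | a b b'.
           a \<in> carrier A \<and> b \<in> carrier B \<and> b' \<in> carrier B})"

definition tensor_group ::
  "('a, 'c) monoid_scheme \<Rightarrow> ('b, 'd) monoid_scheme \<Rightarrow> (('a \<times> 'b) \<Rightarrow>\<^sub>0 int) set monoid" where
  "tensor_group A B = free_Abelian_group (carrier A \<times> carrier B) Mod tensor_subgroup A B"

text \<open>The homomorphism induced by \<open>f\<close> and \<open>g\<close> with target the tensor product of \<open>A'\<close> and \<open>B'\<close>.\<close>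

definition tensor_map ::
  "('a, 'c) monoid_scheme \<Rightarrow> ('b, 'd) monoid_scheme \<Rightarrow> ('e \<Rightarrow> 'a) \<Rightarrow> ('f \<Rightarrow> 'b) \<Rightarrow>
   (('e \<times> 'f) \<Rightarrow>\<^sub>0 int) set \<Rightarrow> (('a \<times> 'b) \<Rightarrow>\<^sub>0 int) set" where
  "tensor_map A' B' f g X =
     tensor_subgroup A' B' <#>\<^bsub>free_Abelian_group (carrier A' \<times> carrier B')\<^esub>
       frag_extend (\<lambda>(a, b). frag_of (f a, g b)) ` X"

type_synonym 'a H1_F2_elem = "((('a \<Rightarrow>\<^sub>0 int) set \<times> bit) \<Rightarrow>\<^sub>0 int) set"

text \<open>\<open>H1(M)\<close> tensored with \<open>F2\<close>; scalars act on the second factor. As for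
  \<open>module_vec\<close>, the ring multiplication in the underlying record plays no role.\<close>

definition H1_F2 :: "'a matroid \<Rightarrow> (bit, 'a H1_F2_elem) module" where
  "H1_F2 M = \<lparr>
     carrier = carrier (tensor_group (H1 M) (add_monoid F2)),
     mult = undefined,
     one = undefined,
     zero = \<one>\<^bsub>tensor_group (H1 M) (add_monoid F2)\<^esub>,
     add = (\<lambda>X Y. X \<otimes>\<^bsub>tensor_group (H1 M) (add_monoid F2)\<^esub> Y),
     smult = (\<lambda>c. tensor_map (H1 M) (add_monoid F2) id (\<lambda>b. c * b))\<rparr>"

definition H1_F2_map :: "'a matroid \<Rightarrow> ('a \<Rightarrow> 'a) \<Rightarrow> 'a H1_F2_elem \<Rightarrow> 'a H1_F2_elem" where
  "H1_F2_map N f = tensor_map (H1 N) (add_monoid F2) (H1_map N f) id"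

text \<open>The action of the functor on morphisms; on objects it is \<^const>\<open>H1_F2\<close>.\<close>

definition H1_F2_mor ::
  "'a matroid \<times> ('a \<Rightarrow> 'a) \<times> 'a matroid \<Rightarrow>
   (bit, 'a H1_F2_elem) module \<times> ('a H1_F2_elem \<Rightarrow> 'a H1_F2_elem) \<times> (bit, 'a H1_F2_elem) module"
where
  "H1_F2_mor = (\<lambda>(M, f, N). (H1_F2 M, restrict (H1_F2_map N f) (carrier (H1_F2 M)), H1_F2 N))"


section \<open>General linear groupoid and group\<close>

definition linear_iso ::
  "(bit, 'v) module \<Rightarrow> (bit, 'w) module \<Rightarrow> ('v \<Rightarrow> 'w) \<Rightarrow> bool" where
  "linear_iso V W f \<longleftrightarrow> linear_map F2 V W f \<and> bij_betw f (carrier V) (carrier W)"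

text \<open>A small model of the groupoid of vector spaces isomorphic to \<open>F2\<^sup>r\<close>: the carriers are subsets
  of \<^typ>\<open>'v\<close>, which has to have at least \<open>2\<^sup>r\<close> elements. Records that differ only in
  irrelevant fields, or outside the carrier, are different but isomorphic objects.\<close>

definition Gl_cat ::
  "nat \<Rightarrow> ((bit, 'v) module, (bit, 'v) module \<times> ('v \<Rightarrow> 'v) \<times> (bit, 'v) module) cat" where
  "Gl_cat r =
     concrete_cat
       {V. vectorspace F2 V \<and> (\<exists>f. linear_iso V (module_vec TYPE(bit) r) f)}
       carrier linear_iso"

definition GL_F2 :: "nat \<Rightarrow> bit mat monoid" where
  "GL_F2 r = units_of (ring_mat TYPE(bit) r ())"

end

(* Let F be the homology functor and let G send a space V to the binary matroid of all vectors of V. If M is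
   represented by vectors in V, then its first homology with coefficients in the field with two elements is
   V itself: every zero sum of representing vectors is a disjoint union of circuits. Hence FG is naturally
   isomorphic to the identity. The map e |-> [e] from M to GF(M) identifies parallel elements, so it is not a
   morphism; instead both M and GF(M) embed naturally into the matroid on the disjoint union of their ground
   sets. A natural transformation induces a homotopy of maps of classifying spaces, whence GF and FG induce
   maps homotopic to the identity. The groupoid of r-dimensional spaces is equivalent to the group GL by a
   choice of coordinates on every space.

   The homotopy of a natural transformation is described through points of the prism: a point (t, s) of
   (n-simplex) x [0,1] is represented by any chain of pairs carrying masses that project to t and to (1 - s, s),
   and the resulting point of the realization does not depend on the chain. Independence yields both the
   compatibility with the gluing and the agreement of the pieces of the prism triangulation. *)

theory Submission
  imports Defs "HOL-Analysis.Abstract_Topological_Spaces"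
begin


section \<open>Realizations\<close>

text \<open>Adding a loop is a morphism without inverse, so F is not an equivalence of categories
  and an inverse exists only up to homotopy. Both inclusions point towards the disjoint union, which
  is why the homotopy from GF to the identity is a concatenation with one leg reversed. The union
  keeps the rank of M because its vectors lie in, and span, the same homology. Over the field with
  two elements a linear combination is a subset: adding subset sums means taking the symmetric
  difference, an independent set of size k spans 2^k vectors, and linear maps are the additive maps.
  Dimension arguments thus become counting. Ground sets consist of natural numbers, so the vectors
  of a space are numbered before they form a matroid. Homology of such matroids has elements of type
  \<open>nat H1_F2_elem\<close>; with spaces carried by this type both composites of the functors
  are endofunctors.\<close>

abbreviation simplex_topology :: "nat \<Rightarrow> (nat \<Rightarrow> real) topology" where
  "simplex_topology n \<equiv> subtopology (powertop_real UNIV) (standard_simplex n)"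

definition realization_class :: "'s sset \<Rightarrow> nat \<times> 's \<times> (nat \<Rightarrow> real) \<Rightarrow> (nat \<times> 's \<times> (nat \<Rightarrow> real)) set" where
  "realization_class X p = realization_rel X `` {p}"

lemma sym_realization_rel: "sym (realization_rel X)"
  by (simp add: realization_rel_def sym_Un_converse sym_rtrancl)

lemma trans_realization_rel: "trans (realization_rel X)"
  by (simp add: realization_rel_def trans_rtrancl)

lemma refl_realization_rel: "(p, p) \<in> realization_rel X"
  by (simp add: realization_rel_def)

lemma gluing_imp_realization_rel: "(p, q) \<in> gluing X \<Longrightarrow> (p, q) \<in> realization_rel X"
  by (auto simp: realization_rel_def)

lemma realization_class_cong: "(p, q) \<in> realization_rel X \<Longrightarrow> realization_class X p = realization_class X q"
  unfolding realization_class_def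
  using symD[OF sym_realization_rel[of X]] transD[OF trans_realization_rel[of X]] by blast

text \<open>The relation is generated by the gluing, so a function only has to be checked on gluing
  pairs. This is the test for well-definedness of maps and, later, of the homotopy.\<close>

lemma realization_rel_invariant:
  assumes "(p, q) \<in> realization_rel X"
    and "\<And>p q. (p, q) \<in> gluing X \<Longrightarrow> f p = f q"
  shows "f p = f q"
  using assms(1) unfolding realization_rel_def
proof (induction rule: rtrancl_induct)
  case (step y z)
  then show ?case using assms(2)[of y z] assms(2)[of z y] by auto
qed simp

lemma realization_class_gluing:
  assumes "\<theta> \<in> ord_maps m n" "\<sigma> \<in> simps X n" "t \<in> standard_simplex m"
  shows "realization_class X (m, act X m n \<theta> \<sigma>, t) = realization_class X (n, \<sigma>, simplex_push m \<theta> t)"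
  using assms by (intro realization_class_cong gluing_imp_realization_rel) (auto simp: gluing_def)

lemma topspace_pre_realization:
  "topspace (pre_realization X) = {(n, \<sigma>, t). \<sigma> \<in> simps X n \<and> t \<in> standard_simplex n}"
  by (auto simp: pre_realization_def)

lemma quotient_map_realization_class:
  "quotient_map (pre_realization X) (realization X) (realization_class X)"
  unfolding quotient_map_def realization_def topspace_quotient_topology openin_quotient_topology
  by (auto simp: realization_class_def quotient_def)

lemma topspace_realization:
  "topspace (realization X) = realization_class X ` topspace (pre_realization X)"
  using quotient_map_realization_class quotient_imp_surjective_map by metis

text \<open>A map that commutes with \<open>act\<close> carries gluing pairs to gluing pairs, so all
  classes whose union forms \<open>realization_map\<close> coincide.\<close>

lemma realization_map_class:
  assumes "\<And>m n \<theta> \<sigma>. \<theta> \<in> ord_maps m n \<Longrightarrow> \<sigma> \<in> simps X n \<Longrightarrow>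
     \<phi> n \<sigma> \<in> simps Y n \<and> \<phi> m (act X m n \<theta> \<sigma>) = act Y m n \<theta> (\<phi> n \<sigma>)"
  shows "realization_map Y \<phi> (realization_class X (n, \<sigma>, t)) = realization_class Y (n, \<phi> n \<sigma>, t)"
proof -
  define h where "h = (\<lambda>(n, \<sigma>, t :: nat \<Rightarrow> real). (n, \<phi> n \<sigma>, t))"
  have eq: "realization_class Y (h p) = realization_class Y (h q)" if "(p, q) \<in> realization_rel X" for p q
  proof (rule realization_rel_invariant[OF that])
    fix p q assume "(p, q) \<in> gluing X"
    then obtain m n \<theta> \<sigma> t where pq: "p = (m, act X m n \<theta> \<sigma>, t)" "q = (n, \<sigma>, simplex_push m \<theta> t)"
      "\<theta> \<in> ord_maps m n" "\<sigma> \<in> simps X n" "t \<in> standard_simplex m"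
      unfolding gluing_def by blast
    have "realization_class Y (m, act Y m n \<theta> (\<phi> n \<sigma>), t) = realization_class Y (n, \<phi> n \<sigma>, simplex_push m \<theta> t)"
      using assms[OF pq(3,4)] pq(5) by (intro realization_class_gluing[OF pq(3)]) simp_all
    then show "realization_class Y (h p) = realization_class Y (h q)"
      using assms[OF pq(3,4)] by (simp add: h_def pq(1,2))
  qed
  let ?c = "realization_class X (n, \<sigma>, t)"
  have "realization_map Y \<phi> ?c = (\<Union>p\<in>?c. realization_class Y (h p))"
    unfolding realization_map_def h_def[symmetric] realization_class_def[of Y]
    by (subst Image_eq_UN) simp
  also have "\<dots> = realization_class Y (h (n, \<sigma>, t))"
  proof (rule UN_constant_eq)
    show "(n, \<sigma>, t) \<in> ?c"
      by (simp add: realization_class_def refl_realization_rel)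
    show "\<forall>p\<in>?c. realization_class Y (h p) = realization_class Y (h (n, \<sigma>, t))"
      using eq[of "(n, \<sigma>, t)"] by (simp add: realization_class_def[of X])
  qed
  finally show ?thesis by (simp add: h_def)
qed

lemma continuous_map_simplex_inclusion:
  assumes "\<sigma> \<in> simps X n"
  shows "continuous_map (simplex_topology n) (pre_realization X) (\<lambda>t. (n, \<sigma>, t))"
proof -
  have "continuous_map (simplex_topology n) (prod_topology (discrete_topology (simps X n)) (simplex_topology n)) (\<lambda>t. (\<sigma>, t))"
    using assms by (intro continuous_map_pairedI) auto
  from continuous_map_compose[OF this continuous_map_component_injection[of n UNIV
        "\<lambda>n. prod_topology (discrete_topology (simps X n)) (simplex_topology n)", OF UNIV_I]]
  show ?thesis by (simp add: pre_realization_def o_def)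
qed

lemma openin_pre_realization:
  assumes "\<sigma> \<in> simps X n" "openin (simplex_topology n) U"
  shows "openin (pre_realization X) ((\<lambda>t. (n, \<sigma>, t)) ` U)"
proof -
  have "openin (prod_topology (discrete_topology (simps X n)) (simplex_topology n)) ({\<sigma>} \<times> U)"
    using assms by (simp add: openin_prod_Times_iff)
  then have "openin (pre_realization X) (Pair n ` ({\<sigma>} \<times> U))"
    unfolding pre_realization_def
    using open_map_component_injection[of n UNIV "\<lambda>n. prod_topology (discrete_topology (simps X n)) (simplex_topology n)", OF UNIV_I]
    unfolding open_map_def by simp
  moreover have "Pair n ` ({\<sigma>} \<times> U) = (\<lambda>t. (n, \<sigma>, t)) ` U" by auto
  ultimately show ?thesis by simp
qed

text \<open>Every simplex is an open summand, also after multiplication by \<open>Z\<close>, so a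
  neighbourhood can be sought in the product of \<open>Z\<close> with the one simplex through the
  point.\<close>

lemma continuous_map_from_prod_pre_realization:
  assumes "\<And>n \<sigma>. \<sigma> \<in> simps X n \<Longrightarrow>
     continuous_map (prod_topology Z (simplex_topology n)) Y (\<lambda>(z, t). f (z, (n, \<sigma>, t)))"
  shows "continuous_map (prod_topology Z (pre_realization X)) Y f"
  unfolding continuous_map_def
proof (intro conjI allI impI)
  show "f \<in> topspace (prod_topology Z (pre_realization X)) \<rightarrow> topspace Y"
  proof
    fix p assume "p \<in> topspace (prod_topology Z (pre_realization X))"
    then obtain z n \<sigma> t where p: "p = (z, (n, \<sigma>, t))" "\<sigma> \<in> simps X n" "t \<in> standard_simplex n" "z \<in> topspace Z"
      by (auto simp: topspace_pre_realization)
    have "(\<lambda>(z, t). f (z, (n, \<sigma>, t))) (z, t) \<in> topspace Y"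
      by (rule funcset_mem[OF continuous_map_funspace[OF assms[OF p(2)]]]) (use p in simp)
    then show "f p \<in> topspace Y" using p by simp
  qed
next
  fix V assume V: "openin Y V"
  show "openin (prod_topology Z (pre_realization X)) {p \<in> topspace (prod_topology Z (pre_realization X)). f p \<in> V}"
  proof (subst openin_subopen, intro ballI)
    fix p assume "p \<in> {p \<in> topspace (prod_topology Z (pre_realization X)). f p \<in> V}"
    then obtain z n \<sigma> t where p: "p = (z, (n, \<sigma>, t))" "\<sigma> \<in> simps X n" "t \<in> standard_simplex n" "z \<in> topspace Z" "f p \<in> V"
      by (auto simp: topspace_pre_realization)
    define W where "W = {q \<in> topspace (prod_topology Z (simplex_topology n)). (\<lambda>(z, t). f (z, (n, \<sigma>, t))) q \<in> V}"
    have "openin (prod_topology Z (simplex_topology n)) W"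
      unfolding W_def by (rule openin_continuous_map_preimage[OF assms[OF p(2)] V])
    moreover have "(z, t) \<in> W" using p by (simp add: W_def)
    ultimately have "\<exists>U1 U2. openin Z U1 \<and> openin (simplex_topology n) U2 \<and> z \<in> U1 \<and> t \<in> U2 \<and> U1 \<times> U2 \<subseteq> W"
      by (simp only: openin_prod_topology_alt)
    then obtain U1 U2 where U: "openin Z U1" "openin (simplex_topology n) U2" "z \<in> U1" "t \<in> U2" "U1 \<times> U2 \<subseteq> W"
      by (elim exE conjE)
    have op: "openin (prod_topology Z (pre_realization X)) (U1 \<times> (\<lambda>t. (n, \<sigma>, t)) ` U2)"
      using U(1) openin_pre_realization[OF p(2) U(2)] by (simp add: openin_prod_Times_iff)
    show "\<exists>T. openin (prod_topology Z (pre_realization X)) T \<and> p \<in> T \<and>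
       T \<subseteq> {p \<in> topspace (prod_topology Z (pre_realization X)). f p \<in> V}"
    proof (intro exI conjI)
      show "U1 \<times> (\<lambda>t. (n, \<sigma>, t)) ` U2 \<subseteq> {p \<in> topspace (prod_topology Z (pre_realization X)). f p \<in> V}"
        using openin_subset[OF op] U(5) by (auto simp: W_def)
    qed (use op p U in auto)
  qed
qed

text \<open>The case of a one-point space \<open>Z\<close>.\<close>

lemma continuous_map_from_pre_realization:
  assumes "\<And>n \<sigma>. \<sigma> \<in> simps X n \<Longrightarrow> continuous_map (simplex_topology n) Y (\<lambda>t. f (n, \<sigma>, t))"
  shows "continuous_map (pre_realization X) Y f"
proof -
  have "continuous_map (prod_topology (discrete_topology {()}) (pre_realization X)) Y (f \<circ> snd)"
  proof (rule continuous_map_from_prod_pre_realization)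
    fix n \<sigma> assume "\<sigma> \<in> simps X n"
    from continuous_map_compose[OF continuous_map_snd assms[OF this]]
    show "continuous_map (prod_topology (discrete_topology {()}) (simplex_topology n)) Y (\<lambda>(z, t). (f \<circ> snd) (z, n, \<sigma>, t))"
      by (simp add: o_def case_prod_unfold)
  qed
  moreover have "continuous_map (pre_realization X) (prod_topology (discrete_topology {()}) (pre_realization X)) (\<lambda>p. ((), p))"
    by (intro continuous_map_pairedI) auto
  ultimately have "continuous_map (pre_realization X) Y ((f \<circ> snd) \<circ> (\<lambda>p. ((), p)))"
    by (rule continuous_map_compose[rotated])
  then show ?thesis by (simp add: o_def)
qed

lemma continuous_map_realization_map:
  assumes "\<And>m n \<theta> \<sigma>. \<theta> \<in> ord_maps m n \<Longrightarrow> \<sigma> \<in> simps X n \<Longrightarrow>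
     \<phi> n \<sigma> \<in> simps Y n \<and> \<phi> m (act X m n \<theta> \<sigma>) = act Y m n \<theta> (\<phi> n \<sigma>)"
  shows "continuous_map (realization X) (realization Y) (realization_map Y \<phi>)"
proof (rule continuous_compose_quotient_map[OF quotient_map_realization_class])
  \<comment> \<open>The hypothesis speaks of a simplex together with an operator; the identity
    operator extracts that \<open>\<phi> n \<sigma>\<close> is a simplex.\<close>
  have id: "id \<in> ord_maps n n" for n
    by (auto simp: ord_maps_def mono_on_def)
  show "continuous_map (pre_realization X) (realization Y) (realization_map Y \<phi> \<circ> realization_class X)"
  proof (rule continuous_map_from_pre_realization)
    fix n \<sigma> assume "\<sigma> \<in> simps X n"
    then have "\<phi> n \<sigma> \<in> simps Y n" using assms id by blast
    from continuous_map_compose[OF continuous_map_simplex_inclusion[OF this]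
        quotient_imp_continuous_map[OF quotient_map_realization_class]]
    show "continuous_map (simplex_topology n) (realization Y) (\<lambda>t. (realization_map Y \<phi> \<circ> realization_class X) (n, \<sigma>, t))"
      using assms by (simp add: realization_map_class o_def)
  qed
qed

section \<open>Barycentric coordinates as masses, and their push-forward\<close>

text \<open>Vertices without mass contribute nothing, so vertex maps have to be compared only on the
  support of \<open>w\<close>.\<close>

lemma simplex_push_cong:
  assumes "\<And>j. j \<le> m \<Longrightarrow> w j \<noteq> 0 \<Longrightarrow> f j = g j"
  shows "simplex_push m f w = simplex_push m g w"
proof
  fix j
  have "(\<Sum>i | i \<le> m \<and> f i = j. w i) = (\<Sum>i | i \<le> m \<and> f i = j \<and> w i \<noteq> 0. w i)"
    by (rule sum.mono_neutral_right) auto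
  also have "\<dots> = (\<Sum>i | i \<le> m \<and> g i = j \<and> w i \<noteq> 0. w i)"
    by (rule sum.cong) (use assms in auto)
  also have "\<dots> = (\<Sum>i | i \<le> m \<and> g i = j. w i)"
    by (rule sum.mono_neutral_left) auto
  finally show "simplex_push m f w j = simplex_push m g w j" by (simp add: simplex_push_def)
qed

text \<open>Grouping by the fibres of \<open>f\<close>: a set of vertices receives the mass of its
  preimage.\<close>

lemma sum_simplex_push:
  assumes "f ` {..m} \<subseteq> {..n}" "A \<subseteq> {..n}"
  shows "sum (simplex_push m f w) A = sum w {i. i \<le> m \<and> f i \<in> A}"
proof -
  have A: "finite A" using assms(2) finite_subset by blast
  have "sum w {i. i \<le> m \<and> f i \<in> A} = (\<Sum>j\<in>A. \<Sum>i | i \<in> {i. i \<le> m \<and> f i \<in> A} \<and> f i = j. w i)"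
    by (rule sum.group[symmetric]) (use A in auto)
  also have "\<dots> = (\<Sum>j\<in>A. simplex_push m f w j)"
    unfolding simplex_push_def by (intro sum.cong) auto
  finally show ?thesis by simp
qed

lemma simplex_push_compose:
  assumes "f ` {..m} \<subseteq> {..n}"
  shows "simplex_push n g (simplex_push m f w) = simplex_push m (g \<circ> f) w"
proof
  fix j
  have "(\<Sum>i | i \<le> n \<and> g i = j. simplex_push m f w i) = sum w {i. i \<le> m \<and> f i \<in> {i. i \<le> n \<and> g i = j}}"
    by (rule sum_simplex_push) (use assms in auto)
  also have "{i. i \<le> m \<and> f i \<in> {i. i \<le> n \<and> g i = j}} = {i. i \<le> m \<and> (g \<circ> f) i = j}"
    using assms by auto
  finally show "simplex_push n g (simplex_push m f w) j = simplex_push m (g \<circ> f) w j"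
    by (simp add: simplex_push_def)
qed

lemma standard_simplexI:
  assumes "\<And>i. 0 \<le> x i" "\<And>i. i > p \<Longrightarrow> x i = 0" "sum x {..p} = 1"
  shows "x \<in> standard_simplex p"
proof -
  have "x i \<le> 1" for i
  proof (cases "i \<le> p")
    case True
    then have "x i \<le> sum x {..p}" using assms by (intro member_le_sum) auto
    then show ?thesis using assms by simp
  qed (use assms in auto)
  then show ?thesis using assms by (auto simp: standard_simplex_def)
qed

lemma simplex_push_in_simplex:
  assumes "f ` {..m} \<subseteq> {..n}" "w \<in> standard_simplex m"
  shows "simplex_push m f w \<in> standard_simplex n"
proof (rule standard_simplexI)
  show "0 \<le> simplex_push m f w i" for i
    using assms by (auto simp: simplex_push_def standard_simplex_def intro!: sum_nonneg)
  show "simplex_push m f w i = 0" if "i > n" for i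
  proof -
    have "{j. j \<le> m \<and> f j = i} = {}" using assms that by fastforce
    then show ?thesis by (simp add: simplex_push_def del: Collect_empty_eq)
  qed
  have "{i. i \<le> m \<and> f i \<in> {..n}} = {..m}" using assms by auto
  then show "sum (simplex_push m f w) {..n} = 1"
    using sum_simplex_push[OF assms(1), of "{..n}" w] assms by (simp add: standard_simplex_def)
qed

lemma simplex_push_id: "w \<in> standard_simplex m \<Longrightarrow> simplex_push m id w = w"
proof
  fix j assume w: "w \<in> standard_simplex m"
  have "{i. i \<le> m \<and> id i = j} = (if j \<le> m then {j} else {})" by auto
  then show "simplex_push m id w j = w j" using w by (auto simp: simplex_push_def standard_simplex_def)
qed

lemma ord_maps_compose: "f \<in> ord_maps l m \<Longrightarrow> g \<in> ord_maps m n \<Longrightarrow> g \<circ> f \<in> ord_maps l n"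
  by (fastforce simp: ord_maps_def mono_on_def image_subset_iff)

text \<open>Rounding down to \<open>S\<close>, and up to its minimum where nothing lies below, is
  monotone. With the support of a point as \<open>S\<close> this discards the massless
  vertices.\<close>

lemma ord_maps_retraction:
  assumes "S \<subseteq> {..m}" "S \<noteq> {}"
  obtains r where "r \<in> ord_maps m m" "r ` {..m} \<subseteq> S" "\<And>j. j \<in> S \<Longrightarrow> r j = j"
proof
  define r where "r j = (if \<exists>k\<in>S. k \<le> j then Max {k \<in> S. k \<le> j} else Min S)" for j
  have fin: "finite S" using assms finite_subset by blast
  have inS: "r j \<in> S" for j
    using Max_in[of "{k \<in> S. k \<le> j}"] Min_in[OF fin assms(2)] fin by (auto simp: r_def)
  show "r ` {..m} \<subseteq> S" using inS by auto
  show "r j = j" if "j \<in> S" for j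
    using that fin by (auto simp: r_def intro!: Max_eqI)
  have "r i \<le> r j" if "i \<le> j" for i j
  proof (cases "\<exists>k\<in>S. k \<le> i")
    case True
    then have "Max {k \<in> S. k \<le> i} \<le> Max {k \<in> S. k \<le> j}"
      using fin that by (intro Max_mono) auto
    then show ?thesis using True that by (auto simp: r_def)
  next
    case False
    then have "r i = Min S" by (auto simp: r_def)
    then show ?thesis using inS fin by simp
  qed
  then show "r \<in> ord_maps m m" using inS assms by (auto simp: ord_maps_def mono_on_def)
qed


section \<open>Nerves\<close>

lemma ord_cat_simps [simp]:
  "Ob (ord_cat n) = {..n}" "(i, j) \<in> Mor (ord_cat n) \<longleftrightarrow> i \<le> j \<and> j \<le> n"
  "Dom (ord_cat n) = fst" "Cod (ord_cat n) = snd" "Id (ord_cat n) i = (i, i)"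
  "Comp (ord_cat n) (j', k) (i, j) = (i, k)"
  by (auto simp: ord_cat_def)

lemma small_category_ord_cat: "small_category (ord_cat n)"
  by unfold_locales (auto simp: ord_cat_def)

text \<open>The object map of a functor on \<open>ord_cat n\<close> can be read off as the domain of
  \<open>\<sigma> (i, i)\<close>, which removes the existential quantifier from the definition of
  the nerve.\<close>

lemma simps_nerve_iff:
  assumes "small_category C"
  shows "\<sigma> \<in> simps (nerve C) n \<longleftrightarrow> \<sigma> \<in> extensional (Mor (ord_cat n)) \<and>
    (\<forall>i j. i \<le> j \<longrightarrow> j \<le> n \<longrightarrow> \<sigma> (i, j) \<in> Mor C \<and> Dom C (\<sigma> (i, j)) = Dom C (\<sigma> (i, i)) \<and>
       Cod C (\<sigma> (i, j)) = Dom C (\<sigma> (j, j))) \<and>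
    (\<forall>i\<le>n. \<sigma> (i, i) = Id C (Dom C (\<sigma> (i, i)))) \<and>
    (\<forall>i j k. i \<le> j \<longrightarrow> j \<le> k \<longrightarrow> k \<le> n \<longrightarrow> \<sigma> (i, k) = Comp C (\<sigma> (j, k)) (\<sigma> (i, j)))"
    (is "_ = (_ \<and> ?A \<and> ?B \<and> ?C)")
proof -
  interpret small_category C by fact
  have "(\<exists>x. cat_functor (ord_cat n) C x \<sigma>) \<longleftrightarrow> ?A \<and> ?B \<and> ?C"
  proof
    assume "\<exists>x. cat_functor (ord_cat n) C x \<sigma>"
    then obtain x where "cat_functor (ord_cat n) C x \<sigma>" ..
    then interpret F: cat_functor "ord_cat n" C x \<sigma> .
    have m: "\<sigma> (i, j) \<in> Mor C" "Dom C (\<sigma> (i, j)) = x i" "Cod C (\<sigma> (i, j)) = x j" if "i \<le> j" "j \<le> n" for i j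
      using that F.Fm_Mor[of "(i, j)"] F.Dom_Fm[of "(i, j)"] F.Cod_Fm[of "(i, j)"] by auto
    have ?A using m by simp
    moreover have ?B
    proof (intro allI impI)
      fix i assume i: "i \<le> n"
      have "\<sigma> (i, i) = Id C (x i)" using F.Fm_Id[of i] i by simp
      then show "\<sigma> (i, i) = Id C (Dom C (\<sigma> (i, i)))" unfolding m(2)[OF order_refl i] .
    qed
    moreover have ?C
    proof (intro allI impI)
      fix i j k assume "i \<le> j" "j \<le> k" "k \<le> n"
      then show "\<sigma> (i, k) = Comp C (\<sigma> (j, k)) (\<sigma> (i, j))"
        using F.Fm_Comp[of "(i, j)" "(j, k)"] by simp
    qed
    ultimately show "?A \<and> ?B \<and> ?C" by (intro conjI)
  next
    assume *: "?A \<and> ?B \<and> ?C"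
    have A: "\<sigma> (i, j) \<in> Mor C" "Dom C (\<sigma> (i, j)) = Dom C (\<sigma> (i, i))" "Cod C (\<sigma> (i, j)) = Dom C (\<sigma> (j, j))"
      if "i \<le> j" "j \<le> n" for i j
      using *[THEN conjunct1, rule_format, OF that] by simp_all
    have "cat_functor (ord_cat n) C (\<lambda>i. Dom C (\<sigma> (i, i))) \<sigma>"
    proof (intro cat_functor.intro cat_functor_axioms.intro small_category_ord_cat assms)
      show "Dom C (\<sigma> (i, i)) \<in> Ob C" if "i \<in> Ob (ord_cat n)" for i
        using A[of i i] that Dom_Ob by simp
    next
      fix f g assume fg: "f \<in> Mor (ord_cat n)" "g \<in> Mor (ord_cat n)" "Cod (ord_cat n) f = Dom (ord_cat n) g"
      obtain i j k where f: "f = (i, j)" "g = (j, k)" using fg(3) by (cases f; cases g) simp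
      with fg(1,2) have "i \<le> j" "j \<le> k" "k \<le> n" by simp_all
      then have "\<sigma> (i, k) = Comp C (\<sigma> (j, k)) (\<sigma> (i, j))"
        by (rule *[THEN conjunct2, THEN conjunct2, rule_format])
      then show "\<sigma> (Comp (ord_cat n) g f) = Comp C (\<sigma> g) (\<sigma> f)" by (simp only: f ord_cat_simps)
    next
      fix i assume "i \<in> Ob (ord_cat n)"
      then have "i \<le> n" by simp
      then have "\<sigma> (i, i) = Id C (Dom C (\<sigma> (i, i)))"
        by (rule *[THEN conjunct2, THEN conjunct1, rule_format])
      then show "\<sigma> (Id (ord_cat n) i) = Id C (Dom C (\<sigma> (i, i)))" by (simp only: ord_cat_simps)
    next
      fix f assume "f \<in> Mor (ord_cat n)"
      moreover obtain i j where "f = (i, j)" by (cases f)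
      ultimately show "\<sigma> f \<in> Mor C" "Dom C (\<sigma> f) = Dom C (\<sigma> (Dom (ord_cat n) f, Dom (ord_cat n) f))"
          "Cod C (\<sigma> f) = Dom C (\<sigma> (Cod (ord_cat n) f, Cod (ord_cat n) f))"
        using A[of i j] by simp_all
    qed
    then show "\<exists>x. cat_functor (ord_cat n) C x \<sigma>" by (rule exI[where x = "\<lambda>i. Dom C (\<sigma> (i, i))"])
  qed
  then show ?thesis by (simp add: nerve_def)
qed

lemma simps_nerveD:
  assumes "small_category C" "\<sigma> \<in> simps (nerve C) n"
  shows "i \<le> j \<Longrightarrow> j \<le> n \<Longrightarrow> \<sigma> (i, j) \<in> Mor C"
    "i \<le> j \<Longrightarrow> j \<le> n \<Longrightarrow> Dom C (\<sigma> (i, j)) = Dom C (\<sigma> (i, i))"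
    "i \<le> j \<Longrightarrow> j \<le> n \<Longrightarrow> Cod C (\<sigma> (i, j)) = Dom C (\<sigma> (j, j))"
    "i \<le> n \<Longrightarrow> \<sigma> (i, i) = Id C (Dom C (\<sigma> (i, i)))"
    "i \<le> j \<Longrightarrow> j \<le> k \<Longrightarrow> k \<le> n \<Longrightarrow> \<sigma> (i, k) = Comp C (\<sigma> (j, k)) (\<sigma> (i, j))"
proof -
  note * = iffD1[OF simps_nerve_iff[OF assms(1)] assms(2), THEN conjunct2]
  note a = *[THEN conjunct1, rule_format] and b = *[THEN conjunct2, THEN conjunct1, rule_format]
    and c = *[THEN conjunct2, THEN conjunct2, rule_format]
  show "i \<le> j \<Longrightarrow> j \<le> n \<Longrightarrow> \<sigma> (i, j) \<in> Mor C" by (rule a[THEN conjunct1])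
  show "i \<le> j \<Longrightarrow> j \<le> n \<Longrightarrow> Dom C (\<sigma> (i, j)) = Dom C (\<sigma> (i, i))"
    by (rule a[THEN conjunct2, THEN conjunct1])
  show "i \<le> j \<Longrightarrow> j \<le> n \<Longrightarrow> Cod C (\<sigma> (i, j)) = Dom C (\<sigma> (j, j))"
    by (rule a[THEN conjunct2, THEN conjunct2])
  show "i \<le> n \<Longrightarrow> \<sigma> (i, i) = Id C (Dom C (\<sigma> (i, i)))" by (rule b)
  show "i \<le> j \<Longrightarrow> j \<le> k \<Longrightarrow> k \<le> n \<Longrightarrow> \<sigma> (i, k) = Comp C (\<sigma> (j, k)) (\<sigma> (i, j))" by (rule c)
qed

lemma simps_nerveI:
  assumes "small_category C" "\<sigma> \<in> extensional (Mor (ord_cat n))"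
    and "\<And>i j. i \<le> j \<Longrightarrow> j \<le> n \<Longrightarrow> \<sigma> (i, j) \<in> Mor C"
    and "\<And>i j. i \<le> j \<Longrightarrow> j \<le> n \<Longrightarrow> Dom C (\<sigma> (i, j)) = Dom C (\<sigma> (i, i))"
    and "\<And>i j. i \<le> j \<Longrightarrow> j \<le> n \<Longrightarrow> Cod C (\<sigma> (i, j)) = Dom C (\<sigma> (j, j))"
    and "\<And>i. i \<le> n \<Longrightarrow> \<sigma> (i, i) = Id C (Dom C (\<sigma> (i, i)))"
    and "\<And>i j k. i \<le> j \<Longrightarrow> j \<le> k \<Longrightarrow> k \<le> n \<Longrightarrow> \<sigma> (i, k) = Comp C (\<sigma> (j, k)) (\<sigma> (i, j))"
  shows "\<sigma> \<in> simps (nerve C) n"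
  unfolding simps_nerve_iff[OF assms(1)] by (intro conjI allI impI assms(2-)) assumption+

lemma act_nerve:
  "act (nerve C) m n \<theta> \<sigma> = restrict (\<lambda>(i, j). \<sigma> (\<theta> i, \<theta> j)) (Mor (ord_cat m))"
  by (simp add: nerve_def)

lemma ord_mapsD:
  assumes "\<theta> \<in> ord_maps m n"
  shows "i \<le> j \<Longrightarrow> j \<le> m \<Longrightarrow> \<theta> i \<le> \<theta> j" "i \<le> m \<Longrightarrow> \<theta> i \<le> n"
  using assms by (auto simp: ord_maps_def mono_on_def)

text \<open>The conjunction has the form of the premise of \<open>realization_map_class\<close> and
  \<open>continuous_map_realization_map\<close>.\<close>

lemma nerve_map_natural:
  assumes "cat_functor C D Fo Fm" "\<theta> \<in> ord_maps m n" "\<sigma> \<in> simps (nerve C) n"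
  shows "nerve_map Fm n \<sigma> \<in> simps (nerve D) n \<and>
     nerve_map Fm m (act (nerve C) m n \<theta> \<sigma>) = act (nerve D) m n \<theta> (nerve_map Fm n \<sigma>)"
proof
  interpret cat_functor C D Fo Fm by fact
  note sC = simps_nerveD[OF C.small_category_axioms assms(3)]
  show "nerve_map Fm n \<sigma> \<in> simps (nerve D) n"
  proof (rule simps_nerveI[OF D.small_category_axioms])
    show "nerve_map Fm n \<sigma> \<in> extensional (Mor (ord_cat n))" by (simp add: nerve_map_def)
    fix i j assume ij: "i \<le> j" "j \<le> n"
    show "nerve_map Fm n \<sigma> (i, j) \<in> Mor D"
      "Dom D (nerve_map Fm n \<sigma> (i, j)) = Dom D (nerve_map Fm n \<sigma> (i, i))"
      "Cod D (nerve_map Fm n \<sigma> (i, j)) = Dom D (nerve_map Fm n \<sigma> (j, j))"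
      using ij le_trans[OF ij] sC(1-3)[OF ij] by (simp_all add: nerve_map_def Fm_Mor Dom_Fm Cod_Fm sC(1))
  next
    fix i assume i: "i \<le> n"
    have "Fm (\<sigma> (i, i)) = Id D (Dom D (Fm (\<sigma> (i, i))))"
      using sC(1)[OF order_refl i] sC(4)[OF i] by (metis C.Dom_Ob Dom_Fm Fm_Id)
    then show "nerve_map Fm n \<sigma> (i, i) = Id D (Dom D (nerve_map Fm n \<sigma> (i, i)))"
      using i by (simp add: nerve_map_def)
  next
    fix i j k assume ijk: "i \<le> j" "j \<le> k" "k \<le> n"
    show "nerve_map Fm n \<sigma> (i, k) = Comp D (nerve_map Fm n \<sigma> (j, k)) (nerve_map Fm n \<sigma> (i, j))"
      using ijk le_trans[OF ijk(2,3)] sC(5)[OF ijk] sC(1,3)[OF ijk(1) le_trans[OF ijk(2,3)]] sC(1,2)[OF ijk(2,3)]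
      by (simp add: nerve_map_def Fm_Comp)
  qed
  show "nerve_map Fm m (act (nerve C) m n \<theta> \<sigma>) = act (nerve D) m n \<theta> (nerve_map Fm n \<sigma>)"
    using ord_mapsD[OF assms(2)] by (auto simp: nerve_map_def act_nerve fun_eq_iff restrict_def)
qed

lemma classifying_map_class:
  assumes "cat_functor C D Fo Fm"
  shows "classifying_map D Fm (realization_class (nerve C) (n, \<sigma>, t)) =
    realization_class (nerve D) (n, nerve_map Fm n \<sigma>, t)"
  unfolding classifying_map_def by (rule realization_map_class) (rule nerve_map_natural[OF assms])

lemma continuous_map_classifying_map:
  assumes "cat_functor C D Fo Fm"
  shows "continuous_map (classifying_space C) (classifying_space D) (classifying_map D Fm)"
  unfolding classifying_map_def classifying_space_def
  by (rule continuous_map_realization_map) (rule nerve_map_natural[OF assms])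

text \<open>The composite is a third functor that agrees with \<open>Gm\<close> after
  \<open>Fm\<close> on the morphisms of \<open>C\<close>. This covers functors that are given by
  another term or have other values off the category.\<close>

lemma classifying_map_compose:
  assumes "cat_functor C D Fo Fm" "cat_functor D E Go Gm" "cat_functor C E Ho Hm"
    and "\<And>f. f \<in> Mor C \<Longrightarrow> Hm f = Gm (Fm f)"
    and "c \<in> topspace (classifying_space C)"
  shows "classifying_map E Gm (classifying_map D Fm c) = classifying_map E Hm c"
proof -
  from assms(5) obtain n \<sigma> t where c: "c = realization_class (nerve C) (n, \<sigma>, t)" "\<sigma> \<in> simps (nerve C) n"
    by (auto simp: classifying_space_def topspace_realization topspace_pre_realization)
  have "\<sigma> (i, j) \<in> Mor C" if "i \<le> j" "j \<le> n" for i j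
    using simps_nerveD(1)[OF cat_functor.axioms(1)[OF assms(1)] c(2) that] .
  then have "nerve_map Gm n (nerve_map Fm n \<sigma>) = nerve_map Hm n \<sigma>"
    by (auto simp: nerve_map_def fun_eq_iff restrict_def assms(4))
  then show ?thesis
    by (simp add: c(1) classifying_map_class[OF assms(1)] classifying_map_class[OF assms(2)] classifying_map_class[OF assms(3)])
qed

lemma cat_functor_id:
  assumes "small_category C"
  shows "cat_functor C C id id"
proof -
  interpret small_category C by fact
  show ?thesis by unfold_locales auto
qed

lemma cat_functor_compose:
  assumes "cat_functor C D Fo Fm" "cat_functor D E Go Gm"
  shows "cat_functor C E (Go \<circ> Fo) (Gm \<circ> Fm)"
proof -
  interpret F: cat_functor C D Fo Fm by fact
  interpret G: cat_functor D E Go Gm by fact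
  show ?thesis
    by unfold_locales (simp_all add: F.Fo_Ob F.Fm_Mor F.Dom_Fm F.Cod_Fm F.Fm_Id F.Fm_Comp
      G.Fo_Ob G.Fm_Mor G.Dom_Fm G.Cod_Fm G.Fm_Id G.Fm_Comp)
qed

lemma classifying_map_id:
  assumes "small_category C" "c \<in> topspace (classifying_space C)"
  shows "classifying_map C id c = c"
proof -
  from assms(2) obtain n \<sigma> t where c: "c = realization_class (nerve C) (n, \<sigma>, t)" "\<sigma> \<in> simps (nerve C) n"
    by (auto simp: classifying_space_def topspace_realization topspace_pre_realization)
  have "nerve_map id n \<sigma> = \<sigma>"
    using c(2) extensional_restrict[of \<sigma> "Mor (ord_cat n)"] by (simp add: nerve_map_def nerve_def)
  then show ?thesis
    by (simp add: c(1) classifying_map_class[OF cat_functor_id[OF assms(1)]])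
qed

section \<open>Natural transformations and homotopies\<close>

locale natural_transformation =
  P: cat_functor C D Po Pm + Q: cat_functor C D Qo Qm
  for C :: "('o, 'm) cat" and D :: "('p, 'n) cat" and Po Pm Qo Qm +
  fixes \<alpha> :: "'o \<Rightarrow> 'n"
  assumes component_Mor: "x \<in> Ob C \<Longrightarrow> \<alpha> x \<in> Mor D"
    and Dom_component: "x \<in> Ob C \<Longrightarrow> Dom D (\<alpha> x) = Po x"
    and Cod_component: "x \<in> Ob C \<Longrightarrow> Cod D (\<alpha> x) = Qo x"
    and natural: "f \<in> Mor C \<Longrightarrow> Comp D (\<alpha> (Cod C f)) (Pm f) = Comp D (Qm f) (\<alpha> (Dom C f))"
begin

text \<open>The transformation is a functor on the product of \<^term>\<open>C\<close> and \<^term>\<open>ord_cat 1\<close>. A pair of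
  monotone maps \<open>\<theta>\<close> to \<open>{..n}\<close> and \<open>\<epsilon>\<close> to \<open>{..1}\<close> pulls an \<open>n\<close>-simplex of the nerve of \<^term>\<open>C\<close> and
  the 1-simplex back to a simplex of the product, which is mapped to \<^term>\<open>D\<close>.\<close>

definition cylinder_mor :: "'m \<Rightarrow> nat \<Rightarrow> nat \<Rightarrow> 'n" where
  "cylinder_mor f a b =
     (if b = 0 then Pm f else if a = 0 then Comp D (Qm f) (\<alpha> (Dom C f)) else Qm f)"

definition cylinder_simplex :: "nat \<Rightarrow> (nat \<Rightarrow> nat) \<Rightarrow> (nat \<Rightarrow> nat) \<Rightarrow> (nat \<times> nat \<Rightarrow> 'm) \<Rightarrow> nat \<times> nat \<Rightarrow> 'n" where
  "cylinder_simplex m \<theta> \<epsilon> \<sigma> =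
     restrict (\<lambda>(i, j). cylinder_mor (\<sigma> (\<theta> i, \<theta> j)) (\<epsilon> i) (\<epsilon> j)) (Mor (ord_cat m))"

lemma cylinder_mor:
  assumes "f \<in> Mor C" "a \<le> b"
  shows "cylinder_mor f a b \<in> Mor D"
    "Dom D (cylinder_mor f a b) = (if a = 0 then Po else Qo) (Dom C f)"
    "Cod D (cylinder_mor f a b) = (if b = 0 then Po else Qo) (Cod C f)"
  using assms P.C.Dom_Ob[of f] component_Mor[of "Dom C f"] Dom_component[of "Dom C f"] Cod_component[of "Dom C f"]
  by (auto simp: cylinder_mor_def P.Fm_Mor Q.Fm_Mor P.Dom_Fm Q.Dom_Fm P.Cod_Fm Q.Cod_Fm
      P.D.Comp_Mor P.D.Dom_Comp P.D.Cod_Comp)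

text \<open>The cases record where the passage from level 0 to level 1 happens. The component of
  \<open>\<alpha>\<close> always stands at the source, so it must be moved past \<open>Pm f\<close>
  if the passage happens in \<open>g\<close>; this is where naturality is used.\<close>

lemma cylinder_mor_Comp:
  assumes "f \<in> Mor C" "g \<in> Mor C" "Cod C f = Dom C g" "a \<le> b" "b \<le> c"
  shows "cylinder_mor (Comp C g f) a c = Comp D (cylinder_mor g b c) (cylinder_mor f a b)"
proof -
  note ob = P.C.Dom_Ob[OF assms(1)] P.C.Dom_Ob[OF assms(2)]
  note [simp] = P.Fm_Mor Q.Fm_Mor P.Dom_Fm Q.Dom_Fm P.Cod_Fm Q.Cod_Fm P.Fm_Comp Q.Fm_Comp
    component_Mor Dom_component Cod_component P.C.Dom_Comp
  consider "c = 0" | "c \<noteq> 0" "a \<noteq> 0" | "c \<noteq> 0" "a = 0" "b \<noteq> 0" | "c \<noteq> 0" "a = 0" "b = 0" by blast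
  then show ?thesis
  proof cases
    case 3
    then show ?thesis using assms ob P.D.Comp_assoc[of "\<alpha> (Dom C f)" "Qm f" "Qm g"]
      by (simp add: cylinder_mor_def)
  next
    case 4
    have "Comp D (Comp D (Qm g) (Qm f)) (\<alpha> (Dom C f)) = Comp D (Qm g) (Comp D (\<alpha> (Dom C g)) (Pm f))"
      using assms ob P.D.Comp_assoc[of "\<alpha> (Dom C f)" "Qm f" "Qm g"] natural[OF assms(1)] by simp
    then show ?thesis using 4 assms ob P.D.Comp_assoc[of "Pm f" "\<alpha> (Dom C g)" "Qm g"]
      by (simp add: cylinder_mor_def)
  qed (use assms in \<open>auto simp: cylinder_mor_def\<close>)
qed

lemma cylinder_simplex_in_nerve:
  assumes "\<sigma> \<in> simps (nerve C) n" "\<theta> \<in> ord_maps m n" "\<epsilon> \<in> ord_maps m 1"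
  shows "cylinder_simplex m \<theta> \<epsilon> \<sigma> \<in> simps (nerve D) m"
proof (rule simps_nerveI[OF P.D.small_category_axioms])
  note sC = simps_nerveD[OF P.C.small_category_axioms assms(1)]
  have mor: "\<sigma> (\<theta> i, \<theta> j) \<in> Mor C" "Dom C (\<sigma> (\<theta> i, \<theta> j)) = Dom C (\<sigma> (\<theta> i, \<theta> i))"
      "Cod C (\<sigma> (\<theta> i, \<theta> j)) = Dom C (\<sigma> (\<theta> j, \<theta> j))" "\<epsilon> i \<le> \<epsilon> j" if "i \<le> j" "j \<le> m" for i j
    using that ord_mapsD[OF assms(2)] ord_mapsD[OF assms(3)] sC(1-3)[of "\<theta> i" "\<theta> j"] by simp_all
  show "cylinder_simplex m \<theta> \<epsilon> \<sigma> \<in> extensional (Mor (ord_cat m))" by (simp add: cylinder_simplex_def)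
  fix i j assume ij: "i \<le> j" "j \<le> m"
  note m = mor[OF ij] mor[of i i] mor[of j j]
  show "cylinder_simplex m \<theta> \<epsilon> \<sigma> (i, j) \<in> Mor D"
      "Dom D (cylinder_simplex m \<theta> \<epsilon> \<sigma> (i, j)) = Dom D (cylinder_simplex m \<theta> \<epsilon> \<sigma> (i, i))"
      "Cod D (cylinder_simplex m \<theta> \<epsilon> \<sigma> (i, j)) = Dom D (cylinder_simplex m \<theta> \<epsilon> \<sigma> (j, j))"
    using ij m by (auto simp: cylinder_simplex_def cylinder_mor)
next
  note sC = simps_nerveD[OF P.C.small_category_axioms assms(1)]
  fix i assume i: "i \<le> m"
  define x where "x = Dom C (\<sigma> (\<theta> i, \<theta> i))"
  have "\<theta> i \<le> n" using i ord_mapsD[OF assms(2)] by blast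
  note 1 = sC(1)[OF order_refl this] sC(4)[OF this, folded x_def]
  have "x \<in> Ob C" unfolding x_def by (rule P.C.Dom_Ob[OF 1(1)])
  then have "cylinder_mor (Id C x) (\<epsilon> i) (\<epsilon> i) = Id D ((if \<epsilon> i = 0 then Po else Qo) x)"
    "(if \<epsilon> i = 0 then Po else Qo) x \<in> Ob D"
    by (auto simp: cylinder_mor_def P.Fm_Id Q.Fm_Id P.Fo_Ob Q.Fo_Ob)
  then show "cylinder_simplex m \<theta> \<epsilon> \<sigma> (i, i) = Id D (Dom D (cylinder_simplex m \<theta> \<epsilon> \<sigma> (i, i)))"
    using i by (simp only: cylinder_simplex_def 1(2) ord_cat_simps restrict_apply' prod.case order_refl P.D.Dom_Id if_True simp_thms)
next
  note sC = simps_nerveD[OF P.C.small_category_axioms assms(1)]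
  fix i j k assume ijk: "i \<le> j" "j \<le> k" "k \<le> m"
  have le: "\<theta> i \<le> \<theta> j" "\<theta> j \<le> \<theta> k" "\<theta> k \<le> n" "\<theta> j \<le> n" "\<epsilon> i \<le> \<epsilon> j" "\<epsilon> j \<le> \<epsilon> k"
    using ijk ord_mapsD[OF assms(2)] ord_mapsD[OF assms(3)] by auto
  then have "\<sigma> (\<theta> i, \<theta> j) \<in> Mor C" "\<sigma> (\<theta> j, \<theta> k) \<in> Mor C" "Cod C (\<sigma> (\<theta> i, \<theta> j)) = Dom C (\<sigma> (\<theta> j, \<theta> j))"
       "Dom C (\<sigma> (\<theta> j, \<theta> k)) = Dom C (\<sigma> (\<theta> j, \<theta> j))" "\<sigma> (\<theta> i, \<theta> k) = Comp C (\<sigma> (\<theta> j, \<theta> k)) (\<sigma> (\<theta> i, \<theta> j))"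
    using sC(1-3)[OF le(1,4)] sC(1-3)[OF le(2,3)] sC(5)[OF le(1-3)] by simp_all
  then show "cylinder_simplex m \<theta> \<epsilon> \<sigma> (i, k) = Comp D (cylinder_simplex m \<theta> \<epsilon> \<sigma> (j, k)) (cylinder_simplex m \<theta> \<epsilon> \<sigma> (i, j))"
    using ijk le by (simp add: cylinder_simplex_def cylinder_mor_Comp)
qed

lemma act_cylinder_simplex:
  assumes "\<phi> \<in> ord_maps k m"
  shows "act (nerve D) k m \<phi> (cylinder_simplex m \<theta> \<epsilon> \<sigma>) = cylinder_simplex k (\<theta> \<circ> \<phi>) (\<epsilon> \<circ> \<phi>) \<sigma>"
  using ord_mapsD[OF assms] by (auto simp: act_nerve cylinder_simplex_def fun_eq_iff restrict_def)

lemma cylinder_simplex_act: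
  assumes "\<theta> \<in> ord_maps m k"
  shows "cylinder_simplex m \<theta> \<epsilon> (act (nerve C) k n \<psi> \<sigma>) = cylinder_simplex m (\<psi> \<circ> \<theta>) \<epsilon> \<sigma>"
  using ord_mapsD[OF assms] by (auto simp: act_nerve cylinder_simplex_def fun_eq_iff restrict_def)

abbreviation cylinder_class :: "nat \<Rightarrow> (nat \<Rightarrow> nat) \<Rightarrow> (nat \<Rightarrow> nat) \<Rightarrow> (nat \<times> nat \<Rightarrow> 'm) \<Rightarrow> (nat \<Rightarrow> real) \<Rightarrow> _" where
  "cylinder_class m \<theta> \<epsilon> \<sigma> w \<equiv> realization_class (nerve D) (m, cylinder_simplex m \<theta> \<epsilon> \<sigma>, w)"

text \<open>The gluing relation of the nerve of \<open>D\<close> in terms of vertex maps: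
  precomposing with \<open>\<phi>\<close> amounts to pushing the masses along
  \<open>\<phi>\<close>.\<close>

lemma cylinder_class_push:
  assumes "\<sigma> \<in> simps (nerve C) n" "\<theta> \<in> ord_maps m n" "\<epsilon> \<in> ord_maps m 1" "\<phi> \<in> ord_maps k m" "w \<in> standard_simplex k"
  shows "cylinder_class k (\<theta> \<circ> \<phi>) (\<epsilon> \<circ> \<phi>) \<sigma> w = cylinder_class m \<theta> \<epsilon> \<sigma> (simplex_push k \<phi> w)"
  using realization_class_gluing[OF assms(4) cylinder_simplex_in_nerve[OF assms(1-3)] assms(5)]
  by (simp add: act_cylinder_simplex[OF assms(4)])

lemma cylinder_simplex_cong:
  assumes "\<And>j. j \<le> m \<Longrightarrow> \<theta> j = \<theta>' j \<and> \<epsilon> j = \<epsilon>' j"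
  shows "cylinder_simplex m \<theta> \<epsilon> \<sigma> = cylinder_simplex m \<theta>' \<epsilon>' \<sigma>"
  using assms by (auto simp: cylinder_simplex_def fun_eq_iff restrict_def)

text \<open>Retracting the vertices onto the support of \<open>w\<close> fixes \<open>w\<close> and makes the two simplices equal.\<close>

lemma cylinder_class_cong:
  assumes "\<sigma> \<in> simps (nerve C) n" "\<theta> \<in> ord_maps m n" "\<epsilon> \<in> ord_maps m 1" "\<theta>' \<in> ord_maps m n" "\<epsilon>' \<in> ord_maps m 1"
    and w: "w \<in> standard_simplex m"
    and eq: "\<And>j. j \<le> m \<Longrightarrow> w j \<noteq> 0 \<Longrightarrow> \<theta> j = \<theta>' j \<and> \<epsilon> j = \<epsilon>' j"
  shows "cylinder_class m \<theta> \<epsilon> \<sigma> w = cylinder_class m \<theta>' \<epsilon>' \<sigma> w"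
proof -
  have "{j. j \<le> m \<and> w j \<noteq> 0} \<noteq> {}"
  proof
    assume "{j. j \<le> m \<and> w j \<noteq> 0} = {}"
    then have "sum w {..m} = 0" by (intro sum.neutral) auto
    then show False using w by (simp add: standard_simplex_def)
  qed
  then obtain r where r: "r \<in> ord_maps m m" "r ` {..m} \<subseteq> {j. j \<le> m \<and> w j \<noteq> 0}" "\<And>j. j \<in> {j. j \<le> m \<and> w j \<noteq> 0} \<Longrightarrow> r j = j"
    using ord_maps_retraction[of "{j. j \<le> m \<and> w j \<noteq> 0}" m] by auto
  have "simplex_push m r w = simplex_push m id w"
    by (rule simplex_push_cong) (use r in auto)
  then have push: "simplex_push m r w = w" using simplex_push_id[OF w] by simp
  have "cylinder_class m \<theta> \<epsilon> \<sigma> w = cylinder_class m (\<theta> \<circ> r) (\<epsilon> \<circ> r) \<sigma> w"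
    using cylinder_class_push[OF assms(1-3) r(1) w] by (simp add: push)
  also have "cylinder_simplex m (\<theta> \<circ> r) (\<epsilon> \<circ> r) \<sigma> = cylinder_simplex m (\<theta>' \<circ> r) (\<epsilon>' \<circ> r) \<sigma>"
    using eq r(2) by (intro cylinder_simplex_cong) auto
  also have "cylinder_class m (\<theta>' \<circ> r) (\<epsilon>' \<circ> r) \<sigma> w = cylinder_class m \<theta>' \<epsilon>' \<sigma> w"
    using cylinder_class_push[OF assms(1,4,5) r(1) w] by (simp add: push)
  finally show ?thesis .
qed

end


section \<open>The prism over a simplex\<close>

text \<open>Vertex map of the projection of prism simplex number \<open>i\<close> to the base; it
  hits \<open>i\<close> twice, at the two ends of the vertical edge. The projection to the interval
  is \<open>threshold i\<close>.\<close>

definition degeneracy :: "nat \<Rightarrow> nat \<Rightarrow> nat" where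
  "degeneracy i j = (if j \<le> i then j else j - 1)"

definition threshold :: "nat \<Rightarrow> nat \<Rightarrow> nat" where
  "threshold i j = (if j \<le> i then 0 else 1)"

text \<open>The maximal simplex number \<open>i\<close> of the prism triangulation runs through
  \<open>(0,0), \<dots>, (i,0), (i,1), \<dots>, (n,1)\<close>. A point of it is determined by its images \<open>t\<close> and \<open>(1 - s, s)\<close>
  under the two projections; these are its barycentric coordinates.\<close>

definition prism_weight :: "nat \<Rightarrow> nat \<Rightarrow> (nat \<Rightarrow> real) \<Rightarrow> real \<Rightarrow> nat \<Rightarrow> real" where
  "prism_weight n i t s l =
     (if l < i then t l
      else if l = i then t i - (s - sum t {i<..n})
      else if l = Suc i then s - sum t {i<..n}
      else t (l - 1))"

text \<open>Level 0 carries the mass \<open>1 - s\<close>. The vertical edge stands over the vertex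
  where the masses of \<open>t\<close>, added up from vertex 0, reach this amount. At ties the least
  such vertex is taken; \<open>cylinder_map_prism\<close> shows that the choice is
  immaterial.\<close>

definition prism_index :: "(nat \<Rightarrow> real) \<Rightarrow> real \<Rightarrow> nat" where
  "prism_index t s = (LEAST i. 1 - s \<le> sum t {..i})"

lemma degeneracy_ord_map: "i \<le> n \<Longrightarrow> degeneracy i \<in> ord_maps (Suc n) n"
  by (auto simp: ord_maps_def mono_on_def degeneracy_def)

lemma threshold_ord_map: "threshold i \<in> ord_maps n 1"
  by (auto simp: ord_maps_def mono_on_def threshold_def)

lemma simplex_push_degeneracy:
  assumes "i \<le> n"
  shows "simplex_push (Suc n) (degeneracy i) w j =
    (if j < i then w j else if j = i then w i + w (Suc i) else if j \<le> n then w (Suc j) else 0)"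
proof -
  have "{l. l \<le> Suc n \<and> degeneracy i l = j} =
    (if j < i then {j} else if j = i then {i, Suc i} else if j \<le> n then {Suc j} else {})"
    using assms by (auto simp: degeneracy_def split: if_splits)
  then show ?thesis by (auto simp: simplex_push_def)
qed

lemma simplex_push_threshold: "simplex_push n (threshold i) w 1 = sum w {i<..n}"
proof -
  have "{l. l \<le> n \<and> threshold i l = 1} = {i<..n}"
    by (auto simp: threshold_def)
  then show ?thesis by (simp add: simplex_push_def)
qed

lemma sum_greaterThanAtMost_Suc_shift: "(\<Sum>j\<in>{i<..n}. w (Suc j)) = sum w {Suc i<..Suc n}"
  by (rule sum.reindex_bij_witness[of _ "\<lambda>j. j - 1" Suc]) auto

lemma sum_greaterThanAtMost_first:
  fixes w :: "nat \<Rightarrow> real"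
  assumes "i \<le> n"
  shows "sum w {i<..Suc n} = w (Suc i) + sum w {Suc i<..Suc n}"
proof -
  have "{i<..Suc n} = insert (Suc i) {Suc i<..Suc n}" using assms by auto
  then show ?thesis by simp
qed

text \<open>The push along \<open>threshold i\<close> yields the mass beyond vertex
  \<open>i\<close>. Subtracting what \<open>degeneracy i\<close> sends beyond \<open>i\<close>
  leaves the weight of vertex \<open>Suc i\<close>, after which the masses in the base determine all
  others.\<close>

lemma prism_weight_unique:
  assumes "w \<in> standard_simplex (Suc n)" "i \<le> n"
  shows "prism_weight n i (simplex_push (Suc n) (degeneracy i) w) (simplex_push (Suc n) (threshold i) w 1) = w"
proof
  fix l
  have "sum (simplex_push (Suc n) (degeneracy i) w) {i<..n} = (\<Sum>j\<in>{i<..n}. w (Suc j))"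
    by (intro sum.cong) (auto simp: simplex_push_degeneracy[OF assms(2)])
  then have a: "simplex_push (Suc n) (threshold i) w 1 - sum (simplex_push (Suc n) (degeneracy i) w) {i<..n} = w (Suc i)"
    using sum_greaterThanAtMost_first[OF assms(2), of w]
    by (simp add: simplex_push_threshold sum_greaterThanAtMost_Suc_shift del: One_nat_def)
  have "w l = 0" if "l > Suc n"
    using assms(1) that by (simp add: standard_simplex_def)
  then show "prism_weight n i (simplex_push (Suc n) (degeneracy i) w) (simplex_push (Suc n) (threshold i) w 1) l = w l"
    unfolding prism_weight_def a by (auto simp: simplex_push_degeneracy[OF assms(2)] not_less_eq)
qed

lemma sum_split_at:
  fixes t :: "nat \<Rightarrow> real"
  assumes "i \<le> n"
  shows "sum t {..n} = sum t {..i} + sum t {i<..n}"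
proof -
  have "{..n} = {..i} \<union> {i<..n}" using assms by auto
  then show ?thesis by (simp add: sum.union_disjoint[symmetric] disjoint_iff)
qed

text \<open>The two inequalities say that the parts into which \<open>t i\<close> is split along the
  vertical edge, \<open>1 - s - sum t {..<i}\<close> and \<open>sum t {..i} - (1 - s)\<close>, are
  nonnegative.\<close>

lemma prism_weight:
  assumes t: "t \<in> standard_simplex n" and i: "i \<le> n" and s: "sum t {..<i} \<le> 1 - s" "1 - s \<le> sum t {..i}"
  shows "prism_weight n i t s \<in> standard_simplex (Suc n)"
    "simplex_push (Suc n) (degeneracy i) (prism_weight n i t s) = t"
    "simplex_push (Suc n) (threshold i) (prism_weight n i t s) 1 = s"
proof -
  let ?w = "prism_weight n i t s"
  have t0: "t j \<ge> 0" "j > n \<Longrightarrow> t j = 0" "sum t {..n} = 1" for j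
    using t by (auto simp: standard_simplex_def)
  have i1: "sum t {..i} = sum t {..<i} + t i"
    by (simp add: lessThan_Suc_atMost[symmetric])
  have a: "s - sum t {i<..n} = sum t {..i} - (1 - s)"
    using sum_split_at[OF i, of t] t0(3) by simp
  show deg: "simplex_push (Suc n) (degeneracy i) ?w = t"
  proof
    fix j show "simplex_push (Suc n) (degeneracy i) ?w j = t j"
      using t0(2)[of j] by (auto simp: simplex_push_degeneracy[OF i] prism_weight_def)
  qed
  show "simplex_push (Suc n) (threshold i) ?w 1 = s"
  proof -
    have "sum ?w {Suc i<..Suc n} = (\<Sum>j\<in>{i<..n}. ?w (Suc j))"
      by (rule sum_greaterThanAtMost_Suc_shift[symmetric])
    also have "\<dots> = sum t {i<..n}"
      by (intro sum.cong) (auto simp: prism_weight_def)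
    finally show ?thesis
      unfolding simplex_push_threshold sum_greaterThanAtMost_first[OF i]
      by (simp add: prism_weight_def)
  qed
  show "?w \<in> standard_simplex (Suc n)"
  proof (rule standard_simplexI)
    show "0 \<le> ?w l" for l
      using t0(1) s i1 unfolding prism_weight_def a by auto
    show "?w l = 0" if "l > Suc n" for l
      using that i t0(2)[of "l - 1"] by (auto simp: prism_weight_def)
    \<comment> \<open>Push-forward preserves the total mass, so the sum of \<open>?w\<close> equals
      that of \<open>t\<close>.\<close>
    have "degeneracy i ` {..Suc n} \<subseteq> {..n}" using degeneracy_ord_map[OF i] by (simp add: ord_maps_def)
    from sum_simplex_push[OF this order_refl, of ?w]
    have "sum t {..n} = sum ?w {j. j \<le> Suc n \<and> degeneracy i j \<in> {..n}}" by (simp only: deg)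
    also have "{j. j \<le> Suc n \<and> degeneracy i j \<in> {..n}} = {..Suc n}"
      using i by (auto simp: degeneracy_def)
    finally show "sum ?w {..Suc n} = 1" using t0(3) by simp
  qed
qed

lemma prism_index:
  assumes "t \<in> standard_simplex n" "0 \<le> s" "s \<le> 1"
  shows "prism_index t s \<le> n" "sum t {..<prism_index t s} \<le> 1 - s" "1 - s \<le> sum t {..prism_index t s}"
proof -
  have n: "1 - s \<le> sum t {..n}" using assms by (simp add: standard_simplex_def)
  show "prism_index t s \<le> n" unfolding prism_index_def by (rule Least_le) (rule n)
  show "1 - s \<le> sum t {..prism_index t s}" unfolding prism_index_def by (rule LeastI) (rule n)
  show "sum t {..<prism_index t s} \<le> 1 - s"
  proof (cases "prism_index t s")
    case (Suc k)
    then have "\<not> 1 - s \<le> sum t {..k}"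
      unfolding prism_index_def by (intro not_less_Least) simp
    then show ?thesis using Suc by (simp add: lessThan_Suc_atMost)
  qed (use assms in simp)
qed

text \<open>A chain carrying mass over \<open>t\<close> and \<open>(1 - s, s)\<close> lies in the prism simplex where the partial
  sums of \<open>t\<close> reach \<open>1 - s\<close>.\<close>

lemma support_in_prism_simplex:
  assumes w: "w \<in> standard_simplex m" and \<theta>: "\<theta> \<in> ord_maps m n" and \<epsilon>: "\<epsilon> \<in> ord_maps m 1"
    and t: "t = simplex_push m \<theta> w" and s: "s = simplex_push m \<epsilon> w 1"
    and j: "j \<le> m" "w j \<noteq> 0"
  shows "\<epsilon> j = 0 \<Longrightarrow> \<theta> j \<le> prism_index t s" "\<epsilon> j \<noteq> 0 \<Longrightarrow> prism_index t s \<le> \<theta> j"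
proof -
  have w0: "w k \<ge> 0" for k using w by (simp add: standard_simplex_def)
  with j have wj: "w j > 0" by (simp add: order_less_le)
  have img: "\<theta> ` {..m} \<subseteq> {..n}" "\<epsilon> ` {..m} \<subseteq> {..1}" using \<theta> \<epsilon> by (auto simp: ord_maps_def)
  have "sum w {..m} = sum w {k. k \<le> m \<and> \<epsilon> k = 0} + sum w {k. k \<le> m \<and> \<epsilon> k = 1}"
    using img(2) by (subst sum.union_disjoint[symmetric]) (auto intro!: sum.cong simp: image_subset_iff le_Suc_eq)
  then have s0: "1 - s = sum w {k. k \<le> m \<and> \<epsilon> k = 0}"
    using w by (simp add: s simplex_push_def standard_simplex_def)
  have st: "sum t {..i} = sum w {k. k \<le> m \<and> \<theta> k \<le> i}" if "i \<le> n" for i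
    using sum_simplex_push[OF img(1), of "{..i}" w] that by (simp add: t)
  have pushed: "t \<in> standard_simplex n" "simplex_push m \<epsilon> w \<in> standard_simplex 1"
    unfolding t by (rule simplex_push_in_simplex[OF img(1) w] simplex_push_in_simplex[OF img(2) w])+
  then have s01: "0 \<le> s" "s \<le> 1" by (auto simp: s standard_simplex_def)
  note pi = prism_index[OF pushed(1) s01]
  show "\<theta> j \<le> prism_index t s" if e: "\<epsilon> j = 0"
  proof (rule ccontr)
    assume "\<not> \<theta> j \<le> prism_index t s"
    then have lt: "prism_index t s < \<theta> j" by simp
    \<comment> \<open>If the claim failed, \<open>j\<close> and all vertices over
      \<open>{..prism_index t s}\<close> would lie on level 0. Together they weigh at least
      \<open>1 - s + w j\<close>, more than level 0 carries.\<close>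
    have "k \<le> j" if "k \<le> m" "\<theta> k \<le> prism_index t s" for k
      using ord_mapsD(1)[OF \<theta>, of j k] that lt by (meson leD le_trans nat_le_linear)
    then have sub: "insert j {k. k \<le> m \<and> \<theta> k \<le> prism_index t s} \<subseteq> {k. k \<le> m \<and> \<epsilon> k = 0}"
      using ord_mapsD(1)[OF \<epsilon>, of _ j] e j by fastforce
    have "sum w (insert j {k. k \<le> m \<and> \<theta> k \<le> prism_index t s}) \<le> 1 - s"
      unfolding s0 by (rule sum_mono2[OF _ sub]) (auto simp: w0)
    then show False using lt pi(3) st[OF pi(1)] wj by simp
  qed
  show "prism_index t s \<le> \<theta> j" if e: "\<epsilon> j \<noteq> 0"
  proof -
    \<comment> \<open>Level 0 lies entirely before \<open>j\<close>, so its mass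
      \<open>1 - s\<close> is part of \<open>sum t {..\<theta> j}\<close>, and the least index
      cannot exceed \<open>\<theta> j\<close>.\<close>
    have "k \<le> j" if "k \<le> m" "\<epsilon> k = 0" for k
      using ord_mapsD(1)[OF \<epsilon>, of j k] that e by (metis le_zero_eq nat_le_linear)
    then have sub: "{k. k \<le> m \<and> \<epsilon> k = 0} \<subseteq> {k. k \<le> m \<and> \<theta> k \<le> \<theta> j}"
      using ord_mapsD(1)[OF \<theta>, of _ j] j by auto
    have "1 - s \<le> sum w {k. k \<le> m \<and> \<theta> k \<le> \<theta> j}"
      unfolding s0 by (rule sum_mono2[OF _ sub]) (auto simp: w0)
    also have "\<dots> = sum t {..\<theta> j}" using st ord_mapsD(2)[OF \<theta> j(1)] by simp
    finally show ?thesis unfolding prism_index_def by (rule Least_le)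
  qed
qed

context natural_transformation
begin

text \<open>A canonical chain over the point \<open>(t, s)\<close>. The interval coordinate comes
  first, as in \<open>homotopic_with\<close>.\<close>

definition cylinder_map where
  "cylinder_map = (\<lambda>(s, (n, \<sigma>, t)). cylinder_class (Suc n) (degeneracy (prism_index t s))
     (threshold (prism_index t s)) \<sigma> (prism_weight n (prism_index t s) t s))"

text \<open>On the support of \<open>w\<close> the chain runs inside one prism simplex that depends
  only on the point, so it factors through this simplex; there the masses are determined by the two
  projections.\<close>

lemma cylinder_class_eq_map:
  assumes \<sigma>: "\<sigma> \<in> simps (nerve C) n" and \<theta>: "\<theta> \<in> ord_maps m n" and \<epsilon>: "\<epsilon> \<in> ord_maps m 1"
    and w: "w \<in> standard_simplex m"
  shows "cylinder_class m \<theta> \<epsilon> \<sigma> w = cylinder_map (simplex_push m \<epsilon> w 1, (n, \<sigma>, simplex_push m \<theta> w))"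
proof -
  define t where "t = simplex_push m \<theta> w"
  define s where "s = simplex_push m \<epsilon> w 1"
  define i where "i = prism_index t s"
  have img: "\<theta> ` {..m} \<subseteq> {..n}" "\<epsilon> ` {..m} \<subseteq> {..1}" using \<theta> \<epsilon> by (auto simp: ord_maps_def)
  have pushed: "t \<in> standard_simplex n" "simplex_push m \<epsilon> w \<in> standard_simplex 1"
    unfolding t_def by (rule simplex_push_in_simplex[OF img(1) w] simplex_push_in_simplex[OF img(2) w])+
  then have s01: "0 \<le> s" "s \<le> 1" by (auto simp: s_def standard_simplex_def)
  have i: "i \<le> n" unfolding i_def by (rule prism_index[OF pushed(1) s01])
  \<comment> \<open>The position of \<open>(a, b)\<close> among the vertices of the prism simplex is
    \<open>a + b\<close>: the pairs on level 1 are shifted by one.\<close>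
  define \<kappa> where "\<kappa> j = \<theta> j + \<epsilon> j" for j
  have \<kappa>: "\<kappa> \<in> ord_maps m (Suc n)"
  proof -
    have "\<kappa> j \<le> \<kappa> k" if "j \<le> k" "k \<le> m" for j k
      using ord_mapsD(1)[OF \<theta> that] ord_mapsD(1)[OF \<epsilon> that] by (simp add: \<kappa>_def)
    moreover have "\<kappa> j \<le> Suc n" if "j \<le> m" for j
      using ord_mapsD(2)[OF \<theta> that] ord_mapsD(2)[OF \<epsilon> that] by (simp add: \<kappa>_def)
    ultimately show ?thesis by (auto simp: ord_maps_def mono_on_def)
  qed
  \<comment> \<open>The factorisation may fail at massless vertices, which
    \<open>cylinder_class_cong\<close> ignores.\<close>
  have agree: "degeneracy i (\<kappa> j) = \<theta> j" "threshold i (\<kappa> j) = \<epsilon> j" if "j \<le> m" "w j \<noteq> 0" for j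
    using support_in_prism_simplex[OF w \<theta> \<epsilon> t_def s_def that] ord_mapsD(2)[OF \<epsilon> that(1)]
    by (auto simp: i_def degeneracy_def threshold_def \<kappa>_def le_Suc_eq)
  have "cylinder_class m \<theta> \<epsilon> \<sigma> w = cylinder_class m (degeneracy i \<circ> \<kappa>) (threshold i \<circ> \<kappa>) \<sigma> w"
    using agree by (intro cylinder_class_cong[OF \<sigma> \<theta> \<epsilon> _ _ w]
        ord_maps_compose[OF \<kappa>] degeneracy_ord_map[OF i] threshold_ord_map) auto
  also have "\<dots> = cylinder_class (Suc n) (degeneracy i) (threshold i) \<sigma> (simplex_push m \<kappa> w)"
    by (rule cylinder_class_push[OF \<sigma> degeneracy_ord_map[OF i] threshold_ord_map \<kappa> w])
  also have "simplex_push m \<kappa> w = prism_weight n i t s"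
  proof -
    have \<kappa>img: "\<kappa> ` {..m} \<subseteq> {..Suc n}" using \<kappa> by (simp add: ord_maps_def)
    have "simplex_push (Suc n) (degeneracy i) (simplex_push m \<kappa> w) = t"
      "simplex_push (Suc n) (threshold i) (simplex_push m \<kappa> w) 1 = s"
      using simplex_push_cong[of m w "degeneracy i \<circ> \<kappa>" \<theta>] simplex_push_cong[of m w "threshold i \<circ> \<kappa>" \<epsilon>] agree
      unfolding simplex_push_compose[OF \<kappa>img] t_def s_def by auto
    then show ?thesis
      using prism_weight_unique[OF simplex_push_in_simplex[OF \<kappa>img w] i] by simp
  qed
  finally show ?thesis by (simp add: cylinder_map_def i_def t_def s_def)
qed

text \<open>By independence of the chain any admissible \<open>i\<close> may replace
  \<open>prism_index t s\<close>. On a face shared by two prism simplices both formulas therefore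
  describe the same point, which makes closed pieces possible in the proof of continuity.\<close>

lemma cylinder_map_prism:
  assumes "\<sigma> \<in> simps (nerve C) n" "t \<in> standard_simplex n" "i \<le> n" "sum t {..<i} \<le> 1 - s" "1 - s \<le> sum t {..i}"
  shows "cylinder_map (s, (n, \<sigma>, t)) =
    cylinder_class (Suc n) (degeneracy i) (threshold i) \<sigma> (prism_weight n i t s)"
  using cylinder_class_eq_map[OF assms(1) degeneracy_ord_map[OF assms(3)] threshold_ord_map prism_weight(1)[OF assms(2-5)]]
  by (simp add: prism_weight(2,3)[OF assms(2-5)] del: One_nat_def)

text \<open>After composition with \<open>\<psi>\<close> a chain over the face or degeneracy becomes
  a chain over \<open>\<sigma>\<close> with the same masses, and its masses in the base are pushed
  along \<open>\<psi>\<close>.\<close>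

lemma cylinder_map_gluing:
  assumes "(p, q) \<in> gluing (nerve C)" "0 \<le> s" "s \<le> 1"
  shows "cylinder_map (s, p) = cylinder_map (s, q)"
proof -
  obtain m n \<psi> \<sigma> t where pq: "p = (m, act (nerve C) m n \<psi> \<sigma>, t)" "q = (n, \<sigma>, simplex_push m \<psi> t)"
    "\<psi> \<in> ord_maps m n" "\<sigma> \<in> simps (nerve C) n" "t \<in> standard_simplex m"
    using assms(1) unfolding gluing_def by blast
  define i where "i = prism_index t s"
  note pi = prism_index[OF pq(5) assms(2,3), folded i_def]
  note pw = prism_weight[OF pq(5) pi]
  note di = degeneracy_ord_map[OF pi(1)]
  have "cylinder_map (s, p) = cylinder_class (Suc m) (degeneracy i) (threshold i) (act (nerve C) m n \<psi> \<sigma>) (prism_weight m i t s)"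
    by (simp add: pq(1) cylinder_map_def i_def)
  also have "\<dots> = cylinder_class (Suc m) (\<psi> \<circ> degeneracy i) (threshold i) \<sigma> (prism_weight m i t s)"
    by (simp only: cylinder_simplex_act[OF di])
  also have "\<dots> = cylinder_map (simplex_push (Suc m) (threshold i) (prism_weight m i t s) 1,
      (n, \<sigma>, simplex_push (Suc m) (\<psi> \<circ> degeneracy i) (prism_weight m i t s)))"
    by (rule cylinder_class_eq_map[OF pq(4) ord_maps_compose[OF di pq(3)] threshold_ord_map pw(1)])
  also have "simplex_push (Suc m) (\<psi> \<circ> degeneracy i) (prism_weight m i t s) = simplex_push m \<psi> t"
    using simplex_push_compose[of "degeneracy i" "Suc m" m \<psi> "prism_weight m i t s"] di
    unfolding pw(2) by (simp add: ord_maps_def)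
  finally show ?thesis by (simp only: pw(3) pq(2))
qed

text \<open>By independence the chain \<open>id\<close> on a constant level represents the end
  points of the homotopy. It has no vertical edge, so its simplex is the image under
  \<open>Pm\<close> or \<open>Qm\<close>.\<close>

lemma cylinder_map_ends:
  assumes "\<sigma> \<in> simps (nerve C) n" "t \<in> standard_simplex n"
  shows "cylinder_map (0, (n, \<sigma>, t)) = realization_class (nerve D) (n, nerve_map Pm n \<sigma>, t)"
    "cylinder_map (1, (n, \<sigma>, t)) = realization_class (nerve D) (n, nerve_map Qm n \<sigma>, t)"
proof -
  have id: "id \<in> ord_maps n n" and const: "(\<lambda>_. b) \<in> ord_maps n 1" if "b \<le> 1" for b :: nat
    using that by (auto simp: ord_maps_def mono_on_def)
  have "simplex_push n (\<lambda>_. b) t 1 = b" if "b \<le> 1" for b :: nat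
    using assms(2) that by (auto simp: simplex_push_def standard_simplex_def le_Suc_eq atMost_def)
  then have eq: "cylinder_map (real b, (n, \<sigma>, t)) = cylinder_class n id (\<lambda>_. b) \<sigma> t" if "b \<le> 1" for b :: nat
    using cylinder_class_eq_map[OF assms(1) id const assms(2), of b] that simplex_push_id[OF assms(2)]
    by (simp del: One_nat_def)
  have "cylinder_simplex n id (\<lambda>_. 0) \<sigma> = nerve_map Pm n \<sigma>" "cylinder_simplex n id (\<lambda>_. 1) \<sigma> = nerve_map Qm n \<sigma>"
    by (auto simp: cylinder_simplex_def cylinder_mor_def nerve_map_def fun_eq_iff restrict_def)
  then show "cylinder_map (0, (n, \<sigma>, t)) = realization_class (nerve D) (n, nerve_map Pm n \<sigma>, t)"
    "cylinder_map (1, (n, \<sigma>, t)) = realization_class (nerve D) (n, nerve_map Qm n \<sigma>, t)"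
    using eq[of 0] eq[of 1] by simp_all
qed

end


section \<open>Continuity of the homotopy and descent to the realization\<close>

lemma continuous_map_snd_coordinate:
  "continuous_map (prod_topology Z (simplex_topology n)) euclideanreal (\<lambda>p. snd p j)"
proof -
  have "continuous_map (prod_topology Z (simplex_topology n)) (powertop_real UNIV) snd"
    using continuous_map_snd[of Z "simplex_topology n"] continuous_map_into_fulltopology by blast
  then show ?thesis by (simp add: continuous_map_componentwise_UNIV)
qed

context natural_transformation
begin

lemma continuous_map_prism_weight:
  assumes "i \<le> n"
  shows "continuous_map (prod_topology (top_of_set {0..1}) (simplex_topology n)) euclideanreal
     (\<lambda>(s, t). prism_weight n i t s l)"
proof -
  let ?X = "prod_topology (top_of_set {0..1::real}) (simplex_topology n)"
  have s: "continuous_map ?X euclideanreal fst"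
    using continuous_map_fst[of "top_of_set {0..1::real}" "simplex_topology n"] continuous_map_into_fulltopology by blast
  have t: "continuous_map ?X euclideanreal (\<lambda>p. snd p j)" for j
    by (rule continuous_map_snd_coordinate)
  show ?thesis
    unfolding prism_weight_def case_prod_unfold
    using s t by (auto intro!: continuous_map_sum continuous_map_diff)
qed

text \<open>The sets \<open>A i\<close> are the maximal prism simplices. Each is closed,
  \<open>prism_weight\<close> is continuous on it, and the pasted pieces are restrictions of one
  function, so they agree on overlaps automatically.\<close>

lemma continuous_map_cylinder_map_simplex:
  assumes \<sigma>: "\<sigma> \<in> simps (nerve C) n"
  shows "continuous_map (prod_topology (top_of_set {0..1}) (simplex_topology n)) (realization (nerve D))
     (\<lambda>(s, t). cylinder_map (s, (n, \<sigma>, t)))"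
proof (rule pasting_lemma_closed)
  let ?X = "prod_topology (top_of_set {0..1::real}) (simplex_topology n)"
  define A where "A i = {p \<in> topspace ?X. sum (snd p) {..<i} \<le> 1 - fst p \<and> 1 - fst p \<le> sum (snd p) {..i}}" for i
  have s: "continuous_map ?X euclideanreal fst"
    using continuous_map_fst[of "top_of_set {0..1::real}" "simplex_topology n"] continuous_map_into_fulltopology by blast
  have t: "continuous_map ?X euclideanreal (\<lambda>p. snd p j)" for j
    by (rule continuous_map_snd_coordinate)
  show "finite {..n}" by simp
  show "closedin ?X (A i)" if "i \<in> {..n}" for i
  proof -
    have A: "A i = {p \<in> topspace ?X. (1 - fst p) - sum (snd p) {..<i} \<in> {0..}} \<inter>
        {p \<in> topspace ?X. sum (snd p) {..i} - (1 - fst p) \<in> {0..}}"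
      by (auto simp: A_def)
    have "continuous_map ?X euclideanreal (\<lambda>p. (1 - fst p) - sum (snd p) {..<i})"
      "continuous_map ?X euclideanreal (\<lambda>p. sum (snd p) {..i} - (1 - fst p))"
      using s t by (auto intro!: continuous_map_sum continuous_map_diff)
    then show ?thesis
      unfolding A by (intro closedin_Int closedin_continuous_map_preimage) auto
  qed
  show "continuous_map (subtopology ?X (A i)) (realization (nerve D)) ((\<lambda>(s, t). cylinder_map (s, (n, \<sigma>, t))))"
    if "i \<in> {..n}" for i
  proof -
    have i: "i \<le> n" using that by simp
    have top: "topspace (subtopology ?X (A i)) = A i" by (auto simp: A_def)
    have "continuous_map (subtopology ?X (A i)) (simplex_topology (Suc n)) (\<lambda>(s, t). prism_weight n i t s)"
      unfolding continuous_map_in_subtopology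
    proof
      show "continuous_map (subtopology ?X (A i)) (powertop_real UNIV) (\<lambda>(s, t). prism_weight n i t s)"
        using continuous_map_prism_weight[OF i]
        by (auto simp: continuous_map_componentwise_UNIV case_prod_unfold intro!: continuous_map_from_subtopology)
      show "(\<lambda>(s, t). prism_weight n i t s) \<in> topspace (subtopology ?X (A i)) \<rightarrow> standard_simplex (Suc n)"
        unfolding top using prism_weight(1)[OF _ i] by (auto simp: A_def)
    qed
    moreover have "cylinder_simplex (Suc n) (degeneracy i) (threshold i) \<sigma> \<in> simps (nerve D) (Suc n)"
      by (rule cylinder_simplex_in_nerve[OF \<sigma> degeneracy_ord_map[OF i] threshold_ord_map])
    ultimately have "continuous_map (subtopology ?X (A i)) (realization (nerve D))
       (realization_class (nerve D) \<circ> ((\<lambda>w. (Suc n, cylinder_simplex (Suc n) (degeneracy i) (threshold i) \<sigma>, w)) \<circ> (\<lambda>(s, t). prism_weight n i t s)))"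
      by (intro continuous_map_compose[OF _ quotient_imp_continuous_map[OF quotient_map_realization_class]]
            continuous_map_compose[OF _ continuous_map_simplex_inclusion])
    then show ?thesis
      by (rule continuous_map_eq) (use cylinder_map_prism[OF \<sigma> _ i] in \<open>auto simp: top A_def\<close>)
  qed
  show "\<exists>j. j \<in> {..n} \<and> p \<in> A j \<and> (\<lambda>(s, t). cylinder_map (s, (n, \<sigma>, t))) p = (\<lambda>(s, t). cylinder_map (s, (n, \<sigma>, t))) p"
    if "p \<in> topspace ?X" for p
  proof (intro exI conjI refl)
    show "prism_index (snd p) (fst p) \<in> {..n}" "p \<in> A (prism_index (snd p) (fst p))"
      using that prism_index[of "snd p" n "fst p"] by (auto simp: A_def)
  qed
qed auto

theorem homotopic_classifying_maps:
  "homotopic_with (\<lambda>_. True) (classifying_space C) (classifying_space D) (classifying_map D Pm) (classifying_map D Qm)"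
proof -
  let ?I = "top_of_set {0..1::real}"
  let ?q = "\<lambda>(s :: real, p). (s, realization_class (nerve C) p)"
  \<comment> \<open>The interval is locally compact Hausdorff, so its product with a quotient map is
    a quotient map. Hence the homotopy may be defined before gluing.\<close>
  have q: "quotient_map (prod_topology ?I (pre_realization (nerve C))) (prod_topology ?I (classifying_space C)) ?q"
    unfolding classifying_space_def
    by (rule quotient_map_prod_right[OF _ _ quotient_map_realization_class])
      (auto intro!: compact_imp_locally_compact_space Hausdorff_space_subtopology simp: compact_space_subtopology)
  have cont: "continuous_map (prod_topology ?I (pre_realization (nerve C))) (classifying_space D) cylinder_map"
    unfolding classifying_space_def
    by (rule continuous_map_from_prod_pre_realization) (rule continuous_map_cylinder_map_simplex)
  obtain H where H: "continuous_map (prod_topology ?I (classifying_space C)) (classifying_space D) H"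
    "\<And>x. x \<in> topspace (prod_topology ?I (pre_realization (nerve C))) \<Longrightarrow> H (?q x) = cylinder_map x"
  proof (rule quotient_map_lift_exists[OF q cont])
    fix x y assume xy: "x \<in> topspace (prod_topology ?I (pre_realization (nerve C)))"
      "y \<in> topspace (prod_topology ?I (pre_realization (nerve C)))" "?q x = ?q y"
    obtain s p q where x: "x = (s, p)" "y = (s, q)" "0 \<le> s" "s \<le> 1"
        "realization_class (nerve C) p = realization_class (nerve C) q"
      using xy by (cases x; cases y) auto
    then have "(p, q) \<in> realization_rel (nerve C)"
      using refl_realization_rel[of q "nerve C"] by (auto simp: realization_class_def)
    then show "cylinder_map x = cylinder_map y"
      unfolding x(1,2) by (rule realization_rel_invariant) (rule cylinder_map_gluing[OF _ x(3,4)])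
  qed metis
  have ends: "H (0, c) = classifying_map D Pm c \<and> H (1, c) = classifying_map D Qm c" if "c \<in> topspace (classifying_space C)" for c
  proof -
    from that obtain n \<sigma> t where c: "c = realization_class (nerve C) (n, \<sigma>, t)" "\<sigma> \<in> simps (nerve C) n" "t \<in> standard_simplex n"
      by (auto simp: classifying_space_def topspace_realization topspace_pre_realization)
    show ?thesis
      using H(2)[of "(0, (n, \<sigma>, t))"] H(2)[of "(1, (n, \<sigma>, t))"] cylinder_map_ends[OF c(2,3)] c(2,3)
      by (simp add: c(1) topspace_pre_realization classifying_map_class[OF P.cat_functor_axioms]
          classifying_map_class[OF Q.cat_functor_axioms])
  qed
  have "homotopic_with (\<lambda>_. True) (classifying_space C) (classifying_space D) (\<lambda>c. H (0, c)) (\<lambda>c. H (1, c))"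
    unfolding homotopic_with_def using H(1) by (intro exI[of _ H]) auto
  then show ?thesis
    by (rule homotopic_with_eq) (use ends in auto)
qed

end


section \<open>Vector spaces over the field with two elements\<close>

text \<open>With scalars 0 and 1 only, a vector space is an abelian group in which every double
  vanishes and the scalars act in the obvious way.\<close>

locale F2_space = abelian_group V for V :: "(bit, 'v) module" +
  assumes double: "x \<in> carrier V \<Longrightarrow> x \<oplus>\<^bsub>V\<^esub> x = \<zero>\<^bsub>V\<^esub>"
    and smult_0: "x \<in> carrier V \<Longrightarrow> 0 \<odot>\<^bsub>V\<^esub> x = \<zero>\<^bsub>V\<^esub>"
    and smult_1: "x \<in> carrier V \<Longrightarrow> 1 \<odot>\<^bsub>V\<^esub> x = x"

lemma (in F2_space) vectorspace_F2: "vectorspace F2 V"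
proof -
  have c: "c = 0 \<or> c = 1" for c :: bit by (cases c) auto
  have "Module.module F2 V"
  proof (intro Module.module.intro module_axioms.intro)
    show "cring (F2 :: bit ring)" by (rule class_cring.cring_axioms)
    show "abelian_group V" by (rule abelian_group_axioms)
  next
    fix a x assume "x \<in> carrier V"
    then show "a \<odot>\<^bsub>V\<^esub> x \<in> carrier V" using c[of a] by (auto simp: smult_0 smult_1)
  next
    fix a b x assume x: "x \<in> carrier V"
    then show "(a \<oplus>\<^bsub>F2\<^esub> b) \<odot>\<^bsub>V\<^esub> x = a \<odot>\<^bsub>V\<^esub> x \<oplus>\<^bsub>V\<^esub> b \<odot>\<^bsub>V\<^esub> x"
      using c[of a] c[of b] by (auto simp: smult_0 smult_1 double)
    show "(a \<otimes>\<^bsub>F2\<^esub> b) \<odot>\<^bsub>V\<^esub> x = a \<odot>\<^bsub>V\<^esub> (b \<odot>\<^bsub>V\<^esub> x)"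
      using x c[of a] c[of b] by (auto simp: smult_0 smult_1)
  next
    fix a x y assume "x \<in> carrier V" "y \<in> carrier V"
    then show "a \<odot>\<^bsub>V\<^esub> (x \<oplus>\<^bsub>V\<^esub> y) = a \<odot>\<^bsub>V\<^esub> x \<oplus>\<^bsub>V\<^esub> a \<odot>\<^bsub>V\<^esub> y"
      using c[of a] by (auto simp: smult_0 smult_1)
  next
    fix x assume "x \<in> carrier V"
    then show "\<one>\<^bsub>F2\<^esub> \<odot>\<^bsub>V\<^esub> x = x" by (simp add: smult_1)
  qed
  then show ?thesis by (intro vectorspace.intro class_field)
qed

lemma vectorspace_F2_iff: "vectorspace F2 V \<longleftrightarrow> F2_space V"
proof
  assume "vectorspace F2 V"
  then interpret vectorspace F2 V .
  show "F2_space V"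
  proof
    fix x assume x: "x \<in> carrier V"
    show 0: "0 \<odot>\<^bsub>V\<^esub> x = \<zero>\<^bsub>V\<^esub>" using smult_l_null[OF x] by simp
    show 1: "1 \<odot>\<^bsub>V\<^esub> x = x" using smult_one[OF x] by simp
    show "x \<oplus>\<^bsub>V\<^esub> x = \<zero>\<^bsub>V\<^esub>" using smult_l_distr[of 1 1 x] x 0 1 by simp
  qed
qed (rule F2_space.vectorspace_F2)

text \<open>An additive map sends zero to an element equal to its own double, hence to zero. It
  therefore respects the scalar 0, and the scalar 1 acts trivially.\<close>

lemma linear_map_F2_iff:
  assumes "F2_space V" "F2_space W"
  shows "linear_map F2 V W f \<longleftrightarrow> f \<in> carrier V \<rightarrow> carrier W \<and>
    (\<forall>x\<in>carrier V. \<forall>y\<in>carrier V. f (x \<oplus>\<^bsub>V\<^esub> y) = f x \<oplus>\<^bsub>W\<^esub> f y)" (is "_ \<longleftrightarrow> ?R")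
proof -
  interpret V: F2_space V by fact
  interpret W: F2_space W by fact
  interpret VV: vectorspace F2 V by (rule V.vectorspace_F2)
  interpret WW: vectorspace F2 W by (rule W.vectorspace_F2)
  have "linear_map F2 V W f \<longleftrightarrow> f \<in> module_hom F2 V W"
  proof
    assume "linear_map F2 V W f"
    then interpret linear_map F2 V W f .
    show "f \<in> module_hom F2 V W" by (rule f_hom)
  next
    assume "f \<in> module_hom F2 V W"
    then show "linear_map F2 V W f"
      by (intro linear_map.intro mod_hom.intro mod_hom_axioms.intro VV.vectorspace_axioms WW.vectorspace_axioms
        VV.module_axioms WW.module_axioms)
  qed
  also have "\<dots> \<longleftrightarrow> ?R"
  proof
    assume R: ?R
    have "f \<zero>\<^bsub>V\<^esub> \<oplus>\<^bsub>W\<^esub> f \<zero>\<^bsub>V\<^esub> = f \<zero>\<^bsub>V\<^esub>" using R by (metis V.r_zero V.zero_closed)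
    moreover have f0: "f \<zero>\<^bsub>V\<^esub> \<in> carrier W" using R by auto
    ultimately have "f \<zero>\<^bsub>V\<^esub> = \<zero>\<^bsub>W\<^esub>" using W.double[OF f0] by simp
    then have "f (c \<odot>\<^bsub>V\<^esub> x) = c \<odot>\<^bsub>W\<^esub> f x" if "x \<in> carrier V" for c x
      using R that by (cases c) (auto simp: V.smult_0 V.smult_1 W.smult_0 W.smult_1 Pi_iff)
    with R show "f \<in> module_hom F2 V W" by (simp add: module_hom_def)
  qed (auto simp: module_hom_def)
  finally show ?thesis .
qed

section \<open>Families of vectors and the matroids they represent\<close>

text \<open>A nontrivial linear combination over two scalars is a sum over a nonempty subset.
  Summing over indices instead of vectors makes a repeated vector dependent, so injectivity on
  \<open>S\<close> is built in.\<close>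

definition F2_free :: "(bit, 'v) module \<Rightarrow> ('e \<Rightarrow> 'v) \<Rightarrow> 'e set \<Rightarrow> bool" where
  "F2_free V \<rho> S \<longleftrightarrow> (\<forall>T\<subseteq>S. T \<noteq> {} \<longrightarrow> finsum V \<rho> T \<noteq> \<zero>\<^bsub>V\<^esub>)"

definition F2_span :: "(bit, 'v) module \<Rightarrow> ('e \<Rightarrow> 'v) \<Rightarrow> 'e set \<Rightarrow> 'v set" where
  "F2_span V \<rho> S = finsum V \<rho> ` Pow S"

text \<open>The vector matroid of the family. An equation between \<open>M\<close> and such a record
  will express that \<open>M\<close> is represented.\<close>

definition family_matroid :: "(bit, 'v) module \<Rightarrow> 'e set \<Rightarrow> ('e \<Rightarrow> 'v) \<Rightarrow> 'e matroid" where
  "family_matroid V E \<rho> = \<lparr>ground = E, indep = {S. S \<subseteq> E \<and> F2_free V \<rho> S}\<rparr>"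

locale F2_family = F2_space V for V :: "(bit, 'v) module" +
  fixes E :: "'e set" and \<rho> :: "'e \<Rightarrow> 'v"
  assumes finite_E: "finite E" and \<rho>_closed: "\<rho> \<in> E \<rightarrow> carrier V"
begin

lemma finsum_family_closed: "T \<subseteq> E \<Longrightarrow> finsum V \<rho> T \<in> carrier V"
  using \<rho>_closed by (intro finsum_closed) auto

lemma finite_subset_E: "T \<subseteq> E \<Longrightarrow> finite T"
  using finite_E finite_subset by blast

text \<open>The elements of the intersection are counted twice and cancel. Thus
  \<open>finsum\<close> is a homomorphism from the subsets of \<open>E\<close> under symmetric
  difference.\<close>

lemma finsum_sym_diff:
  assumes "S \<subseteq> E" "T \<subseteq> E"
  shows "finsum V \<rho> (sym_diff S T) = finsum V \<rho> S \<oplus>\<^bsub>V\<^esub> finsum V \<rho> T"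
proof -
  have c: "finsum V \<rho> A \<in> carrier V" if "A \<subseteq> S \<union> T" for A
    using that assms by (intro finsum_family_closed) auto
  have split: "finsum V \<rho> A = finsum V \<rho> (A \<inter> B) \<oplus>\<^bsub>V\<^esub> finsum V \<rho> (A - B)" if "A \<subseteq> E" for A B
  proof -
    have "finsum V \<rho> ((A \<inter> B) \<union> (A - B)) = finsum V \<rho> (A \<inter> B) \<oplus>\<^bsub>V\<^esub> finsum V \<rho> (A - B)"
      using that \<rho>_closed finite_subset_E[OF that] by (intro finsum_Un_disjoint) auto
    moreover have "(A \<inter> B) \<union> (A - B) = A" by auto
    ultimately show ?thesis by simp
  qed
  let ?i = "finsum V \<rho> (S \<inter> T)" and ?a = "finsum V \<rho> (S - T)" and ?b = "finsum V \<rho> (T - S)"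
  have cc: "?i \<in> carrier V" "?a \<in> carrier V" "?b \<in> carrier V" by (rule c, blast)+
  have "finsum V \<rho> (sym_diff S T) = ?a \<oplus>\<^bsub>V\<^esub> ?b"
    using assms \<rho>_closed finite_subset_E by (intro finsum_Un_disjoint) auto
  also have "\<dots> = (?i \<oplus>\<^bsub>V\<^esub> ?i) \<oplus>\<^bsub>V\<^esub> (?a \<oplus>\<^bsub>V\<^esub> ?b)" using cc by (simp add: double)
  also have "\<dots> = (?i \<oplus>\<^bsub>V\<^esub> ?a) \<oplus>\<^bsub>V\<^esub> (?i \<oplus>\<^bsub>V\<^esub> ?b)" using cc by (simp add: a_ac)
  also have "\<dots> = finsum V \<rho> S \<oplus>\<^bsub>V\<^esub> finsum V \<rho> T"
    using split[OF assms(1), of T] split[OF assms(2), of S] by (simp add: Int_commute)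
  finally show ?thesis .
qed

lemma finsum_eq_iff:
  assumes "S \<subseteq> E" "T \<subseteq> E"
  shows "finsum V \<rho> S = finsum V \<rho> T \<longleftrightarrow> finsum V \<rho> (sym_diff S T) = \<zero>\<^bsub>V\<^esub>"
proof -
  have c: "finsum V \<rho> S \<in> carrier V" "finsum V \<rho> T \<in> carrier V" using assms finsum_family_closed by auto
  show ?thesis
    unfolding finsum_sym_diff[OF assms] using c double
    by (metis a_assoc r_zero l_zero)
qed

lemma F2_free_subset: "F2_free V \<rho> S \<Longrightarrow> T \<subseteq> S \<Longrightarrow> F2_free V \<rho> T"
  by (auto simp: F2_free_def)

lemma F2_free_empty: "F2_free V \<rho> {}"
  by (auto simp: F2_free_def)

lemma F2_freeD: "F2_free V \<rho> S \<Longrightarrow> T \<subseteq> S \<Longrightarrow> finsum V \<rho> T = \<zero>\<^bsub>V\<^esub> \<Longrightarrow> T = {}"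
  unfolding F2_free_def by metis

lemma inj_on_finsum:
  assumes "S \<subseteq> E" "F2_free V \<rho> S"
  shows "inj_on (finsum V \<rho>) (Pow S)"
proof (rule inj_onI)
  fix A B assume AB: "A \<in> Pow S" "B \<in> Pow S" "finsum V \<rho> A = finsum V \<rho> B"
  then have "finsum V \<rho> (sym_diff A B) = \<zero>\<^bsub>V\<^esub>"
    using iffD1[OF finsum_eq_iff, of A B] assms(1) by (meson PowD order_trans)
  moreover have "sym_diff A B \<subseteq> S" using AB(1,2) by auto
  ultimately have "sym_diff A B = {}" by (rule F2_freeD[OF assms(2), rotated])
  then show "A = B" by blast
qed

text \<open>Counting takes the place of dimension. Two subsets of a free set with equal sums would
  have a relation as their symmetric difference, so all subset sums are distinct.\<close>

lemma card_F2_span: "S \<subseteq> E \<Longrightarrow> F2_free V \<rho> S \<Longrightarrow> card (F2_span V \<rho> S) = 2 ^ card S"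
  unfolding F2_span_def by (simp add: card_image inj_on_finsum card_Pow finite_subset_E)

lemma finsum_one: "e \<in> E \<Longrightarrow> finsum V \<rho> {e} = \<rho> e"
  using \<rho>_closed by (subst finsum_insert) (auto simp: Pi_iff)

lemma in_F2_span_self:
  assumes "e \<in> S" "S \<subseteq> E"
  shows "\<rho> e \<in> F2_span V \<rho> S"
  unfolding F2_span_def
proof (rule image_eqI)
  show "\<rho> e = finsum V \<rho> {e}" using assms finsum_one[of e] by auto
  show "{e} \<in> Pow S" using assms by simp
qed

lemma in_F2_span_if_dependent:
  assumes "S \<subseteq> E" "F2_free V \<rho> S" "e \<in> E" "\<not> F2_free V \<rho> (insert e S)"
  shows "\<rho> e \<in> F2_span V \<rho> S"
proof -
  obtain T where T: "T \<subseteq> insert e S" "T \<noteq> {}" "finsum V \<rho> T = \<zero>\<^bsub>V\<^esub>"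
    using assms(4) by (auto simp: F2_free_def)
  \<comment> \<open>A relation avoiding \<open>e\<close> would lie in the free set \<open>S\<close>;
    one containing \<open>e\<close> can be solved for \<open>\<rho> e\<close>.\<close>
  have "e \<in> T"
  proof (rule ccontr)
    assume "e \<notin> T"
    then have "T \<subseteq> S" using T(1) by auto
    then show False using F2_freeD[OF assms(2) _ T(3)] T(2) by simp
  qed
  then have "sym_diff {e} (T - {e}) = T" by auto
  then have "finsum V \<rho> {e} = finsum V \<rho> (T - {e})"
    using finsum_eq_iff[of "{e}" "T - {e}"] T assms by auto
  then have "\<rho> e = finsum V \<rho> (T - {e})" using finsum_one assms by simp
  then show ?thesis unfolding F2_span_def using T by blast
qed

lemma F2_span_subset:
  assumes S: "S \<subseteq> E" and T: "T \<subseteq> E" and gen: "\<And>e. e \<in> T \<Longrightarrow> \<rho> e \<in> F2_span V \<rho> S"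
  shows "F2_span V \<rho> T \<subseteq> F2_span V \<rho> S"
proof -
  have "finsum V \<rho> A \<in> F2_span V \<rho> S" if "finite A" "A \<subseteq> T" for A
    using that
  proof (induction A)
    case empty
    have "finsum V \<rho> {} \<in> finsum V \<rho> ` Pow S" by blast
    then show ?case by (simp add: F2_span_def)
  next
    case (insert e A)
    then obtain B where B: "B \<subseteq> S" "finsum V \<rho> A = finsum V \<rho> B" by (auto simp: F2_span_def)
    obtain B' where B': "B' \<subseteq> S" "\<rho> e = finsum V \<rho> B'" using gen[of e] insert.prems by (auto simp: F2_span_def)
    have "finsum V \<rho> (insert e A) = \<rho> e \<oplus>\<^bsub>V\<^esub> finsum V \<rho> A"
      using insert.hyps insert.prems T \<rho>_closed by (intro finsum_insert) auto
    also have "\<dots> = finsum V \<rho> (sym_diff B' B)"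
      using B B' S by (subst finsum_sym_diff) auto
    finally have "finsum V \<rho> (insert e A) = finsum V \<rho> (sym_diff B' B)" .
    moreover have "sym_diff B' B \<in> Pow S" using B B' by auto
    ultimately show ?case unfolding F2_span_def by blast
  qed
  then have "finsum V \<rho> A \<in> F2_span V \<rho> S" if "A \<subseteq> T" for A
    using that finite_subset[OF that finite_subset_E[OF T]] by simp
  then show ?thesis unfolding F2_span_def[of V \<rho> T] by auto
qed

lemma finite_F2_span: "S \<subseteq> E \<Longrightarrow> finite (F2_span V \<rho> S)"
  by (simp add: F2_span_def finite_subset_E)

text \<open>Exchange by counting: if no element of \<open>T\<close> extended \<open>S\<close>, the
  span of \<open>S\<close>, with \<open>2 ^ card S\<close> elements, would contain the span of
  \<open>T\<close>, with \<open>2 ^ card T\<close> elements.\<close>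

lemma is_matroid_family_matroid: "is_matroid (family_matroid V E \<rho>)"
proof -
  have "\<exists>e\<in>T - S. insert e S \<subseteq> E \<and> F2_free V \<rho> (insert e S)"
    if S: "S \<subseteq> E" "F2_free V \<rho> S" and T: "T \<subseteq> E" "F2_free V \<rho> T" and lt: "card S < card T" for S T
  proof (rule ccontr)
    assume *: "\<not> ?thesis"
    have "\<rho> e \<in> F2_span V \<rho> S" if e: "e \<in> T" for e
    proof (cases "e \<in> S")
      case True
      then show ?thesis using S by (intro in_F2_span_self)
    next
      case False
      then show ?thesis using * e S T by (intro in_F2_span_if_dependent) auto
    qed
    then have "F2_span V \<rho> T \<subseteq> F2_span V \<rho> S" by (rule F2_span_subset[OF S(1) T(1)])
    then have "card (F2_span V \<rho> T) \<le> card (F2_span V \<rho> S)" using finite_F2_span[OF S(1)] card_mono by blast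
    then show False using lt card_F2_span[OF S] card_F2_span[OF T] by simp
  qed
  then show ?thesis
    unfolding is_matroid_def family_matroid_def
    using finite_E F2_free_empty F2_free_subset by auto
qed

text \<open>A free set of maximal size cannot be enlarged, so all other vectors depend on it. This
  ties the rank to the number of spanned vectors.\<close>

lemma maximal_free_subset:
  obtains S where "S \<subseteq> E" "F2_free V \<rho> S" "card S = matroid_rank (family_matroid V E \<rho>)"
    "F2_span V \<rho> E = F2_span V \<rho> S"
proof -
  let ?I = "{S. S \<subseteq> E \<and> F2_free V \<rho> S}"
  have fin: "finite ?I" using finite_E by simp
  have r: "matroid_rank (family_matroid V E \<rho>) = Max (card ` ?I)"
    by (simp add: matroid_rank_def family_matroid_def)
  have "Max (card ` ?I) \<in> card ` ?I"
    using fin F2_free_empty by (intro Max_in) auto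
  then obtain S where S: "S \<subseteq> E" "F2_free V \<rho> S" "card S = Max (card ` ?I)" by auto
  have "\<rho> e \<in> F2_span V \<rho> S" if e: "e \<in> E" for e
  proof (cases "e \<in> S")
    case True
    then show ?thesis using S by (intro in_F2_span_self)
  next
    case False
    have "\<not> F2_free V \<rho> (insert e S)"
    proof
      assume "F2_free V \<rho> (insert e S)"
      then have "card (insert e S) \<le> Max (card ` ?I)" using e S fin by (intro Max_ge) auto
      then show False using S False finite_subset_E by simp
    qed
    then show ?thesis using e S by (intro in_F2_span_if_dependent) auto
  qed
  then have "F2_span V \<rho> E \<subseteq> F2_span V \<rho> S" by (rule F2_span_subset[OF S(1) order_refl])
  moreover have "F2_span V \<rho> S \<subseteq> F2_span V \<rho> E" using S(1) by (auto simp: F2_span_def)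
  ultimately show ?thesis using that S r by auto
qed

lemma card_spanned_space: "F2_span V \<rho> E = carrier V \<Longrightarrow> card (carrier V) = 2 ^ matroid_rank (family_matroid V E \<rho>)"
  by (metis card_F2_span maximal_free_subset)

lemma finsum_eq_image:
  assumes "S \<subseteq> E" "inj_on \<rho> S"
  shows "finsum V \<rho> S = finsum V (\<lambda>v. v) (\<rho> ` S)"
proof -
  have "(\<lambda>v. v) \<in> \<rho> ` S \<rightarrow> carrier V" using assms \<rho>_closed by auto
  from finsum_reindex[OF this assms(2)] show ?thesis by simp
qed

text \<open>A coefficient function with two values is the indicator of its support.\<close>

lemma lincomb_eq_finsum:
  assumes "finite A" "A \<subseteq> carrier V"
  shows "LinearCombinations.module.lincomb V a A = finsum V (\<lambda>v. v) {v \<in> A. a v \<noteq> 0}"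
proof -
  interpret vectorspace F2 V by (rule vectorspace_F2)
  have c: "a v \<odot>\<^bsub>V\<^esub> v = (if a v \<noteq> 0 then v else \<zero>\<^bsub>V\<^esub>)" if "v \<in> carrier V" for v
    using that by (cases "a v") (auto simp: smult_0 smult_1)
  have "lincomb a A = finsum V (\<lambda>v. a v \<odot>\<^bsub>V\<^esub> v) A" by (rule lincomb_def)
  also have "\<dots> = finsum V (\<lambda>v. if a v \<noteq> 0 then v else \<zero>\<^bsub>V\<^esub>) A"
  proof (rule finsum_cong'[OF refl])
    show "(\<lambda>v. if a v \<noteq> 0 then v else \<zero>\<^bsub>V\<^esub>) \<in> A \<rightarrow> carrier V" using assms by auto
    show "a v \<odot>\<^bsub>V\<^esub> v = (if a v \<noteq> 0 then v else \<zero>\<^bsub>V\<^esub>)" if "v \<in> A" for v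
      using c that assms(2) by blast
  qed
  also have "\<dots> = finsum V (\<lambda>v. if a v \<noteq> 0 then v else \<zero>\<^bsub>V\<^esub>) ({v \<in> A. a v \<noteq> 0} \<union> {v \<in> A. a v = 0})"
    by (rule arg_cong[where f = "finsum V _"]) auto
  also have "\<dots> = finsum V (\<lambda>v. if a v \<noteq> 0 then v else \<zero>\<^bsub>V\<^esub>) {v \<in> A. a v \<noteq> 0} \<oplus>\<^bsub>V\<^esub>
      finsum V (\<lambda>v. if a v \<noteq> 0 then v else \<zero>\<^bsub>V\<^esub>) {v \<in> A. a v = 0}"
    using assms by (intro finsum_Un_disjoint) auto
  also have "finsum V (\<lambda>v. if a v \<noteq> 0 then v else \<zero>\<^bsub>V\<^esub>) {v \<in> A. a v = 0} = finsum V (\<lambda>v. \<zero>\<^bsub>V\<^esub>) {v \<in> A. a v = 0}"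
    by (intro finsum_cong') auto
  also have "\<dots> = \<zero>\<^bsub>V\<^esub>" by (rule finsum_zero)
  also have "finsum V (\<lambda>v. if a v \<noteq> 0 then v else \<zero>\<^bsub>V\<^esub>) {v \<in> A. a v \<noteq> 0} = finsum V (\<lambda>v. v) {v \<in> A. a v \<noteq> 0}"
    using assms by (intro finsum_cong') auto
  finally show ?thesis using assms by (simp add: subset_iff)
qed

lemma lin_dep_iff:
  assumes "A \<subseteq> carrier V" "finite A"
  shows "LinearCombinations.module.lin_dep F2 V A \<longleftrightarrow> (\<exists>B\<subseteq>A. B \<noteq> {} \<and> finsum V (\<lambda>v. v) B = \<zero>\<^bsub>V\<^esub>)"
proof -
  interpret vectorspace F2 V by (rule vectorspace_F2)
  show ?thesis
  proof
    assume "lin_dep A"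
    then obtain B a v where B: "finite B" "B \<subseteq> A" "lincomb a B = \<zero>\<^bsub>V\<^esub>" "v \<in> B" "a v \<noteq> 0"
      unfolding lin_dep_def by auto
    then show "\<exists>B\<subseteq>A. B \<noteq> {} \<and> finsum V (\<lambda>v. v) B = \<zero>\<^bsub>V\<^esub>"
      using lincomb_eq_finsum[of B a] assms by (intro exI[of _ "{v \<in> B. a v \<noteq> 0}"]) auto
  next
    assume "\<exists>B\<subseteq>A. B \<noteq> {} \<and> finsum V (\<lambda>v. v) B = \<zero>\<^bsub>V\<^esub>"
    then obtain B v where B: "B \<subseteq> A" "v \<in> B" "finsum V (\<lambda>v. v) B = \<zero>\<^bsub>V\<^esub>" by auto
    moreover have "lincomb (\<lambda>_. 1) B = finsum V (\<lambda>v. v) B"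
      using lincomb_eq_finsum[of B "\<lambda>_. 1"] B assms finite_subset by auto
    ultimately show "lin_dep A"
      unfolding lin_dep_def using assms finite_subset by (intro exI[of _ B] exI[of _ "\<lambda>_. 1"] exI[of _ v]) auto
  qed
qed

text \<open>Links the set-based independence in the definition of a representation to families. Two
  indices with the same vector sum to zero, which yields injectivity.\<close>

lemma F2_free_iff:
  assumes S: "S \<subseteq> E"
  shows "inj_on \<rho> S \<and> \<not> LinearCombinations.module.lin_dep F2 V (\<rho> ` S) \<longleftrightarrow> F2_free V \<rho> S"
proof -
  have A: "\<rho> ` S \<subseteq> carrier V" "finite (\<rho> ` S)" using S \<rho>_closed finite_subset_E by auto
  have inj: "inj_on \<rho> S" if "F2_free V \<rho> S"
  proof (rule inj_onI, rule ccontr)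
    fix x y assume xy: "x \<in> S" "y \<in> S" "\<rho> x = \<rho> y" "x \<noteq> y"
    then have "finsum V \<rho> {x} = finsum V \<rho> {y}"
      using subsetD[OF S xy(1)] subsetD[OF S xy(2)] finsum_one[of x] finsum_one[of y] by simp
    then have "finsum V \<rho> (sym_diff {x} {y}) = \<zero>\<^bsub>V\<^esub>" using finsum_eq_iff[of "{x}" "{y}"] xy S by auto
    moreover have "sym_diff {x} {y} \<subseteq> S" "sym_diff {x} {y} \<noteq> {}" using xy by auto
    ultimately show False by (metis F2_freeD[OF that])
  qed
  have "(\<exists>B\<subseteq>\<rho> ` S. B \<noteq> {} \<and> finsum V (\<lambda>v. v) B = \<zero>\<^bsub>V\<^esub>) \<longleftrightarrow> \<not> F2_free V \<rho> S" if "inj_on \<rho> S"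
  proof -
    have eq: "finsum V \<rho> T = finsum V (\<lambda>v. v) (\<rho> ` T)" if "T \<subseteq> S" for T
      using that S \<open>inj_on \<rho> S\<close> by (intro finsum_eq_image) (auto dest: inj_on_subset)
    show ?thesis
    proof
      assume "\<exists>B\<subseteq>\<rho> ` S. B \<noteq> {} \<and> finsum V (\<lambda>v. v) B = \<zero>\<^bsub>V\<^esub>"
      then obtain T where "T \<subseteq> S" "\<rho> ` T \<noteq> {}" "finsum V (\<lambda>v. v) (\<rho> ` T) = \<zero>\<^bsub>V\<^esub>"
        by (metis subset_image_iff)
      then show "\<not> F2_free V \<rho> S" using eq unfolding F2_free_def by auto
    next
      assume "\<not> F2_free V \<rho> S"
      then obtain T where "T \<subseteq> S" "T \<noteq> {}" "finsum V \<rho> T = \<zero>\<^bsub>V\<^esub>" by (auto simp: F2_free_def)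
      then show "\<exists>B\<subseteq>\<rho> ` S. B \<noteq> {} \<and> finsum V (\<lambda>v. v) B = \<zero>\<^bsub>V\<^esub>"
        using eq by (intro exI[of _ "\<rho> ` T"]) auto
    qed
  qed
  then show ?thesis using lin_dep_iff[OF A] inj by blast
qed

lemma finsum_family_induct:
  assumes "T \<subseteq> E" "\<zero>\<^bsub>V\<^esub> \<in> G" "\<And>e x. e \<in> E \<Longrightarrow> x \<in> G \<Longrightarrow> \<rho> e \<oplus>\<^bsub>V\<^esub> x \<in> G"
  shows "finsum V \<rho> T \<in> G"
  using finite_subset_E[OF assms(1)] assms(1)
proof (induction T)
  case (insert e T)
  then have "finsum V \<rho> (insert e T) = \<rho> e \<oplus>\<^bsub>V\<^esub> finsum V \<rho> T"
    using \<rho>_closed by (intro finsum_insert) auto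
  then show ?case using insert assms(3) by simp
qed (simp add: assms(2))

lemma span_eq_F2_span: "LinearCombinations.module.span F2 V (\<rho> ` E) = F2_span V \<rho> E"
proof -
  interpret vectorspace F2 V by (rule vectorspace_F2)
  have A: "\<rho> ` E \<subseteq> carrier V" "finite (\<rho> ` E)" using \<rho>_closed finite_E by auto
  interpret image: F2_family V "\<rho> ` E" "\<lambda>v. v"
    using A by unfold_locales auto
  have span: "span (\<rho> ` E) = F2_span V (\<lambda>v. v) (\<rho> ` E)"
  proof
    show "span (\<rho> ` E) \<subseteq> F2_span V (\<lambda>v. v) (\<rho> ` E)"
    proof
      fix x assume "x \<in> span (\<rho> ` E)"
      then obtain a B where B: "finite B" "B \<subseteq> \<rho> ` E" "x = lincomb a B" unfolding span_def by blast
      then have x: "x = finsum V (\<lambda>v. v) {v \<in> B. a v \<noteq> 0}" using lincomb_eq_finsum[of B a] A by auto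
      show "x \<in> F2_span V (\<lambda>v. v) (\<rho> ` E)"
        unfolding F2_span_def by (rule image_eqI[of x "finsum V (\<lambda>v. v)", OF x]) (use B in auto)
    qed
    show "F2_span V (\<lambda>v. v) (\<rho> ` E) \<subseteq> span (\<rho> ` E)"
    proof
      fix x assume "x \<in> F2_span V (\<lambda>v. v) (\<rho> ` E)"
      then obtain B where B: "B \<subseteq> \<rho> ` E" "x = finsum V (\<lambda>v. v) B" unfolding F2_span_def by blast
      then have "x = lincomb (\<lambda>_. 1) B"
        using lincomb_eq_finsum[OF finite_subset[OF B(1) A(2)] order_trans[OF B(1) A(1)], of "\<lambda>_. 1"] by simp
      moreover have "(\<lambda>_. 1) \<in> B \<rightarrow> carrier (F2 :: bit ring)" by simp
      ultimately show "x \<in> span (\<rho> ` E)" unfolding span_def using B(1) finite_subset[OF B(1) A(2)] by blast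
    qed
  qed
  \<comment> \<open>A set of vectors lifts to a set of indices on which \<open>\<rho>\<close> is
    injective. In the other direction equal vectors cancel in pairs, which the induction with
    symmetric differences takes care of.\<close>
  have "F2_span V \<rho> E = F2_span V (\<lambda>v. v) (\<rho> ` E)"
  proof
    show "F2_span V (\<lambda>v. v) (\<rho> ` E) \<subseteq> F2_span V \<rho> E"
    proof
      fix x assume "x \<in> F2_span V (\<lambda>v. v) (\<rho> ` E)"
      then obtain B where B: "B \<subseteq> \<rho> ` E" "x = finsum V (\<lambda>v. v) B" unfolding F2_span_def by blast
      obtain T where T: "T \<subseteq> E" "inj_on \<rho> T" "B = \<rho> ` T"
        using B(1) subset_image_inj[of B \<rho> E] by auto
      show "x \<in> F2_span V \<rho> E"
        unfolding F2_span_def by (rule image_eqI[of _ _ T]) (use B(2) T finsum_eq_image[OF T(1,2)] in auto)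
    qed
    show "F2_span V \<rho> E \<subseteq> F2_span V (\<lambda>v. v) (\<rho> ` E)"
    proof
      fix x assume "x \<in> F2_span V \<rho> E"
      then obtain T where T: "T \<subseteq> E" "x = finsum V \<rho> T" unfolding F2_span_def by blast
      show "x \<in> F2_span V (\<lambda>v. v) (\<rho> ` E)" unfolding T(2)
      proof (rule finsum_family_induct[OF T(1)])
        show "\<zero>\<^bsub>V\<^esub> \<in> F2_span V (\<lambda>v. v) (\<rho> ` E)"
          unfolding F2_span_def by (rule image_eqI[of _ _ "{}"]) auto
        fix e x assume e: "e \<in> E" and "x \<in> F2_span V (\<lambda>v. v) (\<rho> ` E)"
        then obtain B where B: "B \<subseteq> \<rho> ` E" "x = finsum V (\<lambda>v. v) B" unfolding F2_span_def by blast
        have "\<rho> e \<oplus>\<^bsub>V\<^esub> x = finsum V (\<lambda>v. v) {\<rho> e} \<oplus>\<^bsub>V\<^esub> finsum V (\<lambda>v. v) B"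
          using B(2) image.finsum_one[of "\<rho> e"] e by simp
        also have "\<dots> = finsum V (\<lambda>v. v) (sym_diff {\<rho> e} B)"
          using B(1) e by (intro image.finsum_sym_diff[symmetric]) auto
        finally have eq: "\<rho> e \<oplus>\<^bsub>V\<^esub> x = finsum V (\<lambda>v. v) (sym_diff {\<rho> e} B)" .
        show "\<rho> e \<oplus>\<^bsub>V\<^esub> x \<in> F2_span V (\<lambda>v. v) (\<rho> ` E)"
          unfolding F2_span_def by (rule image_eqI[of _ "finsum V (\<lambda>v. v)", OF eq]) (use B(1) e in auto)
      qed
    qed
  qed
  then show ?thesis using span by (rule trans[OF _ sym, rotated])
qed

end


text \<open>The translations of independence and span turn representability into an equation of
  records, by which \<open>M\<close> can be rewritten.\<close>

lemma representation_iff: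
  assumes "is_matroid M" "vectorspace F2 V" "\<rho> \<in> ground M \<rightarrow> carrier V"
  shows "representation F2 V M \<rho> \<longleftrightarrow>
    M = family_matroid V (ground M) \<rho> \<and> F2_span V \<rho> (ground M) = carrier V"
proof -
  interpret F2_space V using assms(2) vectorspace_F2_iff by blast
  interpret F2_family V "ground M" \<rho>
    by unfold_locales (use assms in \<open>auto simp: is_matroid_def\<close>)
  have "representation F2 V M \<rho> \<longleftrightarrow> (\<forall>S\<subseteq>ground M. S \<in> indep M \<longleftrightarrow>
     inj_on \<rho> S \<and> \<not> LinearCombinations.module.lin_dep F2 V (\<rho> ` S)) \<and>
     LinearCombinations.module.span F2 V (\<rho> ` ground M) = carrier V"
    using assms(2,3) by (simp only: representation_def simp_thms)
  also have "\<dots> \<longleftrightarrow> (\<forall>S\<subseteq>ground M. S \<in> indep M \<longleftrightarrow> F2_free V \<rho> S) \<and> F2_span V \<rho> (ground M) = carrier V"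
    unfolding span_eq_F2_span using F2_free_iff by (metis (no_types, lifting))
  also have "(\<forall>S\<subseteq>ground M. S \<in> indep M \<longleftrightarrow> F2_free V \<rho> S) \<longleftrightarrow> M = family_matroid V (ground M) \<rho>"
  proof
    assume *: "\<forall>S\<subseteq>ground M. S \<in> indep M \<longleftrightarrow> F2_free V \<rho> S"
    have "indep M = {S. S \<subseteq> ground M \<and> F2_free V \<rho> S}"
      using * assms(1) unfolding is_matroid_def by auto
    then show "M = family_matroid V (ground M) \<rho>" by (simp add: family_matroid_def)
  next
    assume "M = family_matroid V (ground M) \<rho>"
    then have "indep M = {S. S \<subseteq> ground M \<and> F2_free V \<rho> S}" by (metis family_matroid_def matroid.select_convs(2))
    then show "\<forall>S\<subseteq>ground M. S \<in> indep M \<longleftrightarrow> F2_free V \<rho> S" by simp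
  qed
  finally show ?thesis .
qed

section \<open>Linear maps, isomorphisms and the matroid morphisms over them\<close>

lemma F2_space_hom_zero:
  assumes "F2_space V" "F2_space W" "linear_map F2 V W f"
  shows "f \<zero>\<^bsub>V\<^esub> = \<zero>\<^bsub>W\<^esub>"
proof -
  interpret V: F2_space V by fact
  interpret W: F2_space W by fact
  note f = assms(3)[unfolded linear_map_F2_iff[OF assms(1,2)]]
  have "f (\<zero>\<^bsub>V\<^esub> \<oplus>\<^bsub>V\<^esub> \<zero>\<^bsub>V\<^esub>) = f \<zero>\<^bsub>V\<^esub> \<oplus>\<^bsub>W\<^esub> f \<zero>\<^bsub>V\<^esub>" using f V.zero_closed by blast
  moreover have f0: "f \<zero>\<^bsub>V\<^esub> \<in> carrier W" using f by auto
  ultimately show ?thesis using W.double[OF f0] by simp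
qed

lemma finsum_linear:
  assumes "F2_space V" "F2_space W" "linear_map F2 V W f" "finite T" "\<rho> \<in> T \<rightarrow> carrier V"
  shows "f (finsum V \<rho> T) = finsum W (\<lambda>e. f (\<rho> e)) T"
proof -
  interpret V: F2_space V by fact
  interpret W: F2_space W by fact
  note f = assms(3)[unfolded linear_map_F2_iff[OF assms(1,2)]]
  show ?thesis using assms(4,5)
  proof (induction T)
    case empty
    then show ?case using F2_space_hom_zero[OF assms(1-3)] by simp
  next
    case (insert e T)
    have "f (finsum V \<rho> (insert e T)) = f (\<rho> e \<oplus>\<^bsub>V\<^esub> finsum V \<rho> T)"
      using insert.hyps insert.prems by (subst V.finsum_insert) auto
    also have "\<dots> = f (\<rho> e) \<oplus>\<^bsub>W\<^esub> f (finsum V \<rho> T)"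
      using f insert.prems V.finsum_closed[of \<rho> T] by (auto simp: Pi_iff)
    also have "f (finsum V \<rho> T) = finsum W (\<lambda>e. f (\<rho> e)) T" using insert by auto
    also have "f (\<rho> e) \<oplus>\<^bsub>W\<^esub> \<dots> = finsum W (\<lambda>e. f (\<rho> e)) (insert e T)"
      using insert.hyps insert.prems f by (subst W.finsum_insert) (auto simp: Pi_iff)
    finally show ?case .
  qed
qed

lemma linear_isoD:
  assumes "linear_iso V W f"
  shows "F2_space V" "F2_space W" "linear_map F2 V W f" "f \<in> carrier V \<rightarrow> carrier W" "inj_on f (carrier V)"
    "f ` carrier V = carrier W"
    "\<And>x y. x \<in> carrier V \<Longrightarrow> y \<in> carrier V \<Longrightarrow> f (x \<oplus>\<^bsub>V\<^esub> y) = f x \<oplus>\<^bsub>W\<^esub> f y"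
proof -
  have f: "linear_map F2 V W f" "bij_betw f (carrier V) (carrier W)" using assms by (auto simp: linear_iso_def)
  show 1: "linear_map F2 V W f" by (rule f)
  show V: "F2_space V" and W: "F2_space W"
    using f(1) unfolding linear_map_def vectorspace_F2_iff by (rule conjunct1, rule conjunct1[OF conjunct2])
  show "inj_on f (carrier V)" "f ` carrier V = carrier W" using f(2) by (auto simp: bij_betw_def)
  show "f \<in> carrier V \<rightarrow> carrier W"
    "\<And>x y. x \<in> carrier V \<Longrightarrow> y \<in> carrier V \<Longrightarrow> f (x \<oplus>\<^bsub>V\<^esub> y) = f x \<oplus>\<^bsub>W\<^esub> f y"
    using f(1) linear_map_F2_iff[OF V W] by blast+
qed

lemma linear_isoI:
  assumes "F2_space V" "F2_space W" "bij_betw f (carrier V) (carrier W)"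
    "\<And>x y. x \<in> carrier V \<Longrightarrow> y \<in> carrier V \<Longrightarrow> f (x \<oplus>\<^bsub>V\<^esub> y) = f x \<oplus>\<^bsub>W\<^esub> f y"
  shows "linear_iso V W f"
  unfolding linear_iso_def linear_map_F2_iff[OF assms(1,2)] using assms(3,4) bij_betwE by blast

lemma linear_iso_compose:
  assumes "linear_iso U V f" "linear_iso V W g"
  shows "linear_iso U W (g \<circ> f)"
proof (rule linear_isoI)
  show "bij_betw (g \<circ> f) (carrier U) (carrier W)"
    using assms by (auto simp: linear_iso_def intro: bij_betw_trans)
qed (use linear_isoD[OF assms(1)] linear_isoD[OF assms(2)] in \<open>auto simp: Pi_iff\<close>)

lemma linear_iso_cong:
  assumes "linear_iso V W f" "\<And>x. x \<in> carrier V \<Longrightarrow> f x = g x"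
  shows "linear_iso V W g"
proof (rule linear_isoI)
  note f = linear_isoD[OF assms(1)]
  show "F2_space V" "F2_space W" by (rule f)+
  interpret F2_space V by (rule f)
  have "bij_betw f (carrier V) (carrier W) = bij_betw g (carrier V) (carrier W)"
    by (rule bij_betw_cong) (rule assms(2))
  then show "bij_betw g (carrier V) (carrier W)" using assms(1) by (simp add: linear_iso_def)
  fix x y assume xy: "x \<in> carrier V" "y \<in> carrier V"
  have "g (x \<oplus>\<^bsub>V\<^esub> y) = f (x \<oplus>\<^bsub>V\<^esub> y)" by (rule assms(2)[symmetric]) (use xy in simp)
  then show "g (x \<oplus>\<^bsub>V\<^esub> y) = g x \<oplus>\<^bsub>W\<^esub> g y" using f(7) xy by (simp only: assms(2)[OF xy(1)] assms(2)[OF xy(2)])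
qed

lemma linear_iso_inv:
  assumes "linear_iso V W f"
  shows "linear_iso W V (inv_into (carrier V) f)"
proof -
  note f = linear_isoD[OF assms]
  interpret V: F2_space V by (rule f(1))
  have bij: "bij_betw f (carrier V) (carrier W)" using assms by (simp add: linear_iso_def)
  note b = bij_betw_inv_into[OF bij]
  show ?thesis
  proof (rule linear_isoI[OF f(2,1) b])
    fix x y assume xy: "x \<in> carrier W" "y \<in> carrier W"
    define x' y' where x': "x' = inv_into (carrier V) f x" and y': "y' = inv_into (carrier V) f y"
    have c: "x' \<in> carrier V" "y' \<in> carrier V" using xy b by (auto simp: x' y' dest: bij_betwE)
    have "x = f x'" "y = f y'" using xy f(6) by (auto simp: x' y' f_inv_into_f)
    then have "x \<oplus>\<^bsub>W\<^esub> y = f (x' \<oplus>\<^bsub>V\<^esub> y')" using f(7) c by simp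
    then show "inv_into (carrier V) f (x \<oplus>\<^bsub>W\<^esub> y) = x' \<oplus>\<^bsub>V\<^esub> y'"
      using c f(5) by simp
  qed
qed

lemma linear_iso_id: "F2_space V \<Longrightarrow> linear_iso V V (\<lambda>x. x)"
  by (intro linear_isoI) (auto simp: bij_betw_def)

text \<open>Since \<open>f\<close> lies over the injective linear map \<open>g\<close>, a subset
  sums to zero exactly if its image does. The morphisms between the matroids constructed below are
  all obtained in this way.\<close>

lemma matroid_hom_family_matroid:
  assumes V: "F2_family V E \<rho>" and W: "F2_family W E' \<rho>'" and g: "linear_map F2 V W g" "inj_on g (carrier V)"
    and f: "f \<in> E \<rightarrow> E'" "inj_on f E" and compat: "\<And>e. e \<in> E \<Longrightarrow> \<rho>' (f e) = g (\<rho> e)"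
  shows "matroid_hom (family_matroid V E \<rho>) (family_matroid W E' \<rho>') f"
proof -
  interpret V: F2_family V E \<rho> by fact
  interpret W: F2_family W E' \<rho>' by fact
  have sum: "finsum W \<rho>' (f ` T) = g (finsum V \<rho> T)" if T: "T \<subseteq> E" for T
  proof -
    have "finsum W \<rho>' (f ` T) = finsum W (\<lambda>e. \<rho>' (f e)) T"
      using T f W.\<rho>_closed by (intro W.finsum_reindex) (auto dest: inj_on_subset)
    also have "\<dots> = finsum W (\<lambda>e. g (\<rho> e)) T"
      using T compat f W.\<rho>_closed by (intro W.finsum_cong') (auto simp: Pi_iff, metis subsetD)
    also have "\<dots> = g (finsum V \<rho> T)"
      using T V.\<rho>_closed V.finite_subset_E[OF T] by (intro finsum_linear[OF V.F2_space_axioms W.F2_space_axioms g(1), symmetric]) auto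
    finally show ?thesis .
  qed
  have zero: "finsum W \<rho>' (f ` T) = \<zero>\<^bsub>W\<^esub> \<longleftrightarrow> finsum V \<rho> T = \<zero>\<^bsub>V\<^esub>" if T: "T \<subseteq> E" for T
  proof -
    have "g (finsum V \<rho> T) = g \<zero>\<^bsub>V\<^esub> \<longleftrightarrow> finsum V \<rho> T = \<zero>\<^bsub>V\<^esub>"
      using inj_on_eq_iff[OF g(2)] V.finsum_family_closed[OF T] by simp
    then show ?thesis
      by (simp add: sum[OF T] F2_space_hom_zero[OF V.F2_space_axioms W.F2_space_axioms g(1)])
  qed
  have "F2_free V \<rho> S \<longleftrightarrow> F2_free W \<rho>' (f ` S)" if S: "S \<subseteq> E" for S
  proof
    assume free: "F2_free V \<rho> S"
    show "F2_free W \<rho>' (f ` S)"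
      unfolding F2_free_def
    proof (intro allI impI)
      fix T assume T: "T \<subseteq> f ` S" "T \<noteq> {}"
      then obtain T' where T': "T' \<subseteq> S" "T = f ` T'" by (auto simp: subset_image_iff)
      then have "T' \<noteq> {}" using T by auto
      then show "finsum W \<rho>' T \<noteq> \<zero>\<^bsub>W\<^esub>"
        using zero[OF order_trans[OF T'(1) S]] free T' by (simp add: F2_free_def)
    qed
  next
    assume free: "F2_free W \<rho>' (f ` S)"
    show "F2_free V \<rho> S"
      unfolding F2_free_def
    proof (intro allI impI)
      fix T assume T: "T \<subseteq> S" "T \<noteq> {}"
      then have "f ` T \<subseteq> f ` S" "f ` T \<noteq> {}" by auto
      then show "finsum V \<rho> T \<noteq> \<zero>\<^bsub>V\<^esub>"
        using zero[OF order_trans[OF T(1) S]] free unfolding F2_free_def by metis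
    qed
  qed
  then show ?thesis
    using f by (auto simp: matroid_hom_def family_matroid_def)
qed

lemma F2_space_module_vec: "F2_space (module_vec TYPE(bit) r)"
proof -
  interpret vec_space "TYPE(bit)" r .
  have "vectorspace F2 (module_vec TYPE(bit) r)" by (rule vectorspace_axioms)
  then show ?thesis by (simp only: vectorspace_F2_iff)
qed

lemma bij_betw_carrier_vec:
  "bij_betw (\<lambda>w. {i. i < r \<and> w $ i = (1 :: bit)}) (carrier_vec r) (Pow {..<r})"
  by (rule bij_betw_byWitness[where f' = "\<lambda>T. vec r (\<lambda>i. if i \<in> T then 1 else 0)"])
    (auto intro!: eq_vecI split: if_splits)

lemma card_carrier_vec_bit: "card (carrier_vec r :: bit vec set) = 2 ^ r"
  using bij_betw_same_card[OF bij_betw_carrier_vec[of r]] by (simp add: card_Pow)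

text \<open>The space is regarded as the family of its own vectors. A maximal free subset is a
  basis, and a coordinate vector is sent to the sum of the basis vectors in its support; the inverse
  of this map is the isomorphism.\<close>

lemma linear_iso_module_vec:
  assumes "F2_space V" "card (carrier V) = 2 ^ r"
  obtains f where "linear_iso V (module_vec TYPE(bit) r) f"
proof -
  interpret F2_space V by fact
  have fin: "finite (carrier V)" using assms(2) card_ge_0_finite by force
  interpret F2_family V "carrier V" "\<lambda>v. v" using fin by unfold_locales auto
  have full: "F2_span V (\<lambda>v. v) (carrier V) = carrier V"
    using in_F2_span_self[of _ "carrier V"] finsum_family_closed by (auto simp: F2_span_def[of _ _ "carrier V"])
  obtain S where S: "S \<subseteq> carrier V" "F2_free V (\<lambda>v. v) S" "F2_span V (\<lambda>v. v) S = carrier V"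
    using maximal_free_subset full by metis
  have "card S = r" using card_F2_span[OF S(1,2)] S(3) assms(2) by simp
  then obtain b where b: "bij_betw b {..<r} S"
    using ex_bij_betw_nat_finite[OF finite_subset_E[OF S(1)]] by (auto simp: lessThan_atLeast0)
  let ?F = "\<lambda>w :: bit vec. finsum V (\<lambda>v. v) (b ` {i. i < r \<and> w $ i = 1})"
  have 1: "bij_betw (\<lambda>A. b ` A) (Pow {..<r}) (Pow S)"
    by (rule bij_betw_Pow[OF b])
  have 2: "bij_betw (finsum V (\<lambda>v. v)) (Pow S) (carrier V)"
    using inj_on_finsum[OF S(1,2)] S(3) by (simp add: bij_betw_def F2_span_def)
  have "bij_betw (finsum V (\<lambda>v. v) \<circ> ((\<lambda>A. b ` A) \<circ> (\<lambda>w. {i. i < r \<and> w $ i = (1 :: bit)}))) (carrier_vec r) (carrier V)"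
    by (intro bij_betw_trans[OF bij_betw_trans[OF bij_betw_carrier_vec 1] 2])
  then have bij: "bij_betw ?F (carrier_vec r) (carrier V)" by (simp add: o_def)
  have "linear_iso (module_vec TYPE(bit) r) V ?F"
  proof (rule linear_isoI[OF F2_space_module_vec assms(1)])
    show "bij_betw ?F (carrier (module_vec TYPE(bit) r)) (carrier V)" using bij by (simp add: module_vec_simps)
    fix x y assume "x \<in> carrier (module_vec TYPE(bit) r)" "y \<in> carrier (module_vec TYPE(bit) r)"
    then have xy: "x \<in> carrier_vec r" "y \<in> carrier_vec r" by (simp_all add: module_vec_simps)
    let ?X = "{i. i < r \<and> x $ i = 1}" and ?Y = "{i. i < r \<and> y $ i = 1}"
    have "{i. i < r \<and> (x + y) $ i = 1} = sym_diff ?X ?Y"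
      using xy by auto
    then have "b ` {i. i < r \<and> (x + y) $ i = 1} = sym_diff (b ` ?X) (b ` ?Y)"
      using b by (auto simp: bij_betw_def inj_on_def)
    then show "?F (x \<oplus>\<^bsub>module_vec TYPE(bit) r\<^esub> y) = ?F x \<oplus>\<^bsub>V\<^esub> ?F y"
      using finsum_sym_diff[of "b ` ?X" "b ` ?Y"] b S(1) by (auto simp: module_vec_simps bij_betw_def)
  qed
  from linear_iso_inv[OF this] that show ?thesis by blast
qed

text \<open>The number of vectors reveals the dimension, so membership in the objects of
  \<open>Gl_cat\<close> becomes a count.\<close>

lemma linear_iso_module_vec_iff:
  "vectorspace F2 V \<and> (\<exists>f. linear_iso V (module_vec TYPE(bit) r) f) \<longleftrightarrow>
   F2_space V \<and> card (carrier V) = 2 ^ r"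
proof
  assume "vectorspace F2 V \<and> (\<exists>f. linear_iso V (module_vec TYPE(bit) r) f)"
  then obtain f where "F2_space V" "linear_iso V (module_vec TYPE(bit) r) f"
    using vectorspace_F2_iff by blast
  then show "F2_space V \<and> card (carrier V) = 2 ^ r"
    using bij_betw_same_card[of f "carrier V" "carrier_vec r"] card_carrier_vec_bit
    by (simp add: linear_iso_def module_vec_simps)
qed (metis linear_iso_module_vec vectorspace_F2_iff)


section \<open>Presented abelian groups and matroid homology\<close>

lemma keys_if_mem_free_Abelian_group:
  "A \<subseteq> carrier (free_Abelian_group S) \<Longrightarrow> x \<in> A \<Longrightarrow> Poly_Mapping.keys x \<subseteq> S"
  by (drule subsetD) simp_all

text \<open>Both \<open>H1\<close> and \<open>tensor_group\<close> are free abelian groups modulo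
  generated subgroups. Universal property, induced maps and induction on generators are proved once
  for both.\<close>

locale presented_group =
  fixes S :: "'a set" and R :: "('a \<Rightarrow>\<^sub>0 int) set"
  assumes R_closed: "R \<subseteq> carrier (free_Abelian_group S)"
begin

abbreviation "F \<equiv> free_Abelian_group S"
abbreviation "N \<equiv> generate F R"
abbreviation "Q \<equiv> F Mod N"
abbreviation "cls c \<equiv> N #>\<^bsub>F\<^esub> c"

sublocale F: comm_group F by (rule abelian_free_Abelian_group)

lemma N_subgroup: "subgroup N F"
  by (rule F.generate_is_subgroup[OF R_closed])

sublocale N: normal N F by (rule F.subgroup_imp_normal[OF N_subgroup])

sublocale Q: comm_group Q by (rule F.abelian_FactGroup[OF N_subgroup])

lemma carrier_Q: "carrier Q = cls ` {c. Poly_Mapping.keys c \<subseteq> S}"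
  by (simp add: carrier_FactGroup free_Abelian_group_def)

lemma cls_closed: "Poly_Mapping.keys c \<subseteq> S \<Longrightarrow> cls c \<in> carrier Q"
  by (auto simp: carrier_Q)

lemma cls_mult: "Poly_Mapping.keys c \<subseteq> S \<Longrightarrow> Poly_Mapping.keys d \<subseteq> S \<Longrightarrow> cls c \<otimes>\<^bsub>Q\<^esub> cls d = cls (c + d)"
  using N.rcos_sum[of c d] by simp

lemma cls_one: "n \<in> N \<Longrightarrow> cls n = \<one>\<^bsub>Q\<^esub>"
  using F.coset_join2[OF _ N_subgroup] N.subset by auto

lemma cls_zero: "cls 0 = \<one>\<^bsub>Q\<^esub>"
  using cls_one[of 0] N.one_closed by simp

text \<open>The difference \<open>x - y - z\<close> is the shape of the bilinearity relations of the
  tensor product.\<close>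

lemma cls_rel3:
  assumes "x - y - z \<in> R" "Poly_Mapping.keys y \<subseteq> S" "Poly_Mapping.keys z \<subseteq> S"
  shows "cls x = cls y \<otimes>\<^bsub>Q\<^esub> cls z"
proof -
  have r: "x - y - z \<in> N" by (rule generate.incl[OF assms(1)])
  then have k: "Poly_Mapping.keys (x - y - z) \<subseteq> S" by (rule keys_if_mem_free_Abelian_group[OF N.subset])
  have k2: "Poly_Mapping.keys (y + z) \<subseteq> S" using assms(2,3) keys_add[of y z] by blast
  have "cls x = cls ((x - y - z) + (y + z))" by simp
  also have "\<dots> = cls (x - y - z) \<otimes>\<^bsub>Q\<^esub> cls (y + z)" by (rule cls_mult[OF k k2, symmetric])
  also have "\<dots> = cls (y + z)" using cls_closed[OF k2] by (simp only: cls_one[OF r] Q.l_one)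
  also have "\<dots> = cls y \<otimes>\<^bsub>Q\<^esub> cls z" by (rule cls_mult[OF assms(2,3), symmetric])
  finally show ?thesis .
qed

lemma presented_induct:
  assumes "X \<in> carrier Q" "subgroup K Q" "\<And>s. s \<in> S \<Longrightarrow> cls (frag_of s) \<in> K"
  shows "X \<in> K"
proof -
  obtain c where c: "Poly_Mapping.keys c \<subseteq> S" "X = cls c" using assms(1) by (auto simp: carrier_Q)
  interpret K: subgroup K Q by fact
  have "Poly_Mapping.keys c \<subseteq> S \<and> cls c \<in> K" using c(1)
  proof (induction rule: frag_induction)
    case zero
    then show ?case using cls_zero K.one_closed by simp
  next
    case (one x)
    then show ?case using assms(3) by simp
  next
    case (diff a b)
    have k: "Poly_Mapping.keys (a - b) \<subseteq> S" using diff keys_diff[of a b] by blast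
    have "cls a = cls (a - b) \<otimes>\<^bsub>Q\<^esub> cls b" using cls_mult[OF k] diff by simp
    then have "cls (a - b) = cls a \<otimes>\<^bsub>Q\<^esub> inv\<^bsub>Q\<^esub> (cls b)"
      using Q.inv_solve_right cls_closed k diff by metis
    then show ?case using k diff K.m_closed K.m_inv_closed by metis
  qed
  then show ?thesis using c by simp
qed

text \<open>The extension \<open>h\<close> to the free group is obtained inside the proof, so
  \<open>rel\<close> quantifies over every homomorphism with the prescribed values on
  generators.\<close>

lemma presented_universal:
  assumes G: "comm_group G" and f: "f \<in> S \<rightarrow> carrier G"
    and rel: "\<And>h r. h \<in> hom F G \<Longrightarrow> (\<And>s. s \<in> S \<Longrightarrow> h (frag_of s) = f s) \<Longrightarrow> r \<in> R \<Longrightarrow> h r = \<one>\<^bsub>G\<^esub>"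
  obtains g where "g \<in> hom Q G" "\<And>s. s \<in> S \<Longrightarrow> g (cls (frag_of s)) = f s"
proof -
  interpret G: comm_group G by fact
  obtain h where h: "h \<in> hom F G" "\<And>s. s \<in> S \<Longrightarrow> h (frag_of s) = f s"
    using G.free_Abelian_group_universal[of f S] f by blast
  interpret h: group_hom F G h
    by (intro group_hom.intro group_hom_axioms.intro h(1) F.group_axioms G.group_axioms)
  have "R \<subseteq> kernel F G h" using rel[OF h(1) h(2)] R_closed unfolding kernel_def by blast
  then have "N \<subseteq> kernel F G h" by (rule F.generate_subgroup_incl[OF _ h.subgroup_kernel])
  then obtain g where g: "g \<in> hom Q G" "\<And>x. x \<in> carrier F \<Longrightarrow> g (cls x) = h x"
    using h.FactGroup_universal_kernel[OF N.normal_axioms] by blast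
  show ?thesis
  proof (rule that[OF g(1)])
    fix s assume "s \<in> S"
    then show "g (cls (frag_of s)) = f s" using g(2)[of "frag_of s"] h(2) by simp
  qed
qed

end

lemma frag_extend_keys_closed:
  assumes "\<And>s. s \<in> S \<Longrightarrow> Poly_Mapping.keys (\<phi> s) \<subseteq> S'" "Poly_Mapping.keys c \<subseteq> S"
  shows "Poly_Mapping.keys (frag_extend \<phi> c) \<subseteq> S'"
  using keys_frag_extend[of \<phi> c] assms by blast

text \<open>Evaluates the formula in \<open>H1_map\<close> and \<open>tensor_map\<close>. The image
  of a coset lies in a single coset because relations go to relations, and multiplication by the
  subgroup fills this coset up.\<close>

lemma presented_induced_map:
  assumes P: "presented_group S R" and P': "presented_group S' R'"
    and \<phi>: "\<And>s. s \<in> S \<Longrightarrow> Poly_Mapping.keys (\<phi> s) \<subseteq> S'"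
    and rel: "\<And>r. r \<in> R \<Longrightarrow> frag_extend \<phi> r \<in> R'"
    and c: "Poly_Mapping.keys c \<subseteq> S"
  shows "generate (free_Abelian_group S') R' <#>\<^bsub>free_Abelian_group S'\<^esub>
      frag_extend \<phi> ` (generate (free_Abelian_group S) R #>\<^bsub>free_Abelian_group S\<^esub> c) =
    generate (free_Abelian_group S') R' #>\<^bsub>free_Abelian_group S'\<^esub> frag_extend \<phi> c"
proof -
  interpret P: presented_group S R by fact
  interpret P': presented_group S' R' by fact
  have N: "frag_extend \<phi> n \<in> P'.N" if "n \<in> P.N" for n
    using that
  proof (induction rule: generate.induct)
    case one
    then show ?case using P'.N.one_closed by simp
  next
    case (incl h)
    then show ?case by (intro generate.incl rel)
  next
    case (inv h)
    have "Poly_Mapping.keys h \<subseteq> S" "Poly_Mapping.keys (frag_extend \<phi> h) \<subseteq> S'"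
      by (rule keys_if_mem_free_Abelian_group[OF P.R_closed inv] keys_if_mem_free_Abelian_group[OF P'.R_closed rel[OF inv]])+
    then show ?case using generate.inv[OF rel[OF inv], of "free_Abelian_group S'"] by (simp add: frag_extend_minus)
  next
    case (eng h1 h2)
    then show ?case using P'.N.m_closed by (simp add: frag_extend_add)
  qed
  have z: "0 \<in> P'.N" "0 \<in> P.N" using P'.N.one_closed P.N.one_closed by simp_all
  show ?thesis
  proof
    show "P'.N <#>\<^bsub>P'.F\<^esub> frag_extend \<phi> ` P.cls c \<subseteq> P'.cls (frag_extend \<phi> c)"
    proof
      fix x assume "x \<in> P'.N <#>\<^bsub>P'.F\<^esub> frag_extend \<phi> ` P.cls c"
      then obtain n' n where n: "n' \<in> P'.N" "n \<in> P.N" "x = n' + frag_extend \<phi> (n + c)"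
        by (auto simp: set_mult_def r_coset_def)
      then have "x = (n' + frag_extend \<phi> n) + frag_extend \<phi> c" by (simp add: frag_extend_add)
      moreover have "n' + frag_extend \<phi> n \<in> P'.N" using P'.N.m_closed[OF n(1) N[OF n(2)]] by simp
      ultimately show "x \<in> P'.cls (frag_extend \<phi> c)" unfolding r_coset_def by auto
    qed
    show "P'.cls (frag_extend \<phi> c) \<subseteq> P'.N <#>\<^bsub>P'.F\<^esub> frag_extend \<phi> ` P.cls c"
    proof
      fix x assume "x \<in> P'.cls (frag_extend \<phi> c)"
      then obtain n' where n: "n' \<in> P'.N" "x = n' + frag_extend \<phi> c" by (auto simp: r_coset_def)
      have "c \<in> P.cls c" using z(2) by (force simp: r_coset_def)
      then show "x \<in> P'.N <#>\<^bsub>P'.F\<^esub> frag_extend \<phi> ` P.cls c" using n by (auto simp: set_mult_def)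
    qed
  qed
qed

lemma presented_induced_hom:
  assumes P: "presented_group S R" and P': "presented_group S' R'"
    and \<phi>: "\<And>s. s \<in> S \<Longrightarrow> Poly_Mapping.keys (\<phi> s) \<subseteq> S'"
    and rel: "\<And>r. r \<in> R \<Longrightarrow> frag_extend \<phi> r \<in> R'"
  shows "(\<lambda>X. generate (free_Abelian_group S') R' <#>\<^bsub>free_Abelian_group S'\<^esub> frag_extend \<phi> ` X)
    \<in> hom (free_Abelian_group S Mod generate (free_Abelian_group S) R)
          (free_Abelian_group S' Mod generate (free_Abelian_group S') R')"
    (is "?h \<in> _")
proof (rule homI)
  interpret P: presented_group S R by fact
  interpret P': presented_group S' R' by fact
  note eq = presented_induced_map[OF P P' \<phi> rel]
  note cl = frag_extend_keys_closed[of S \<phi> S', OF \<phi>]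
  show "?h X \<in> carrier P'.Q" if "X \<in> carrier P.Q" for X
    using that P'.cls_closed[OF cl] by (auto simp: P.carrier_Q eq simp del: mult_FactGroup)
  fix X Y assume "X \<in> carrier P.Q" "Y \<in> carrier P.Q"
  then obtain c d where c: "Poly_Mapping.keys c \<subseteq> S" "X = P.cls c" and d: "Poly_Mapping.keys d \<subseteq> S" "Y = P.cls d"
    by (auto simp: P.carrier_Q)
  have k: "Poly_Mapping.keys (c + d) \<subseteq> S" using c d keys_add[of c d] by blast
  show "?h (X \<otimes>\<^bsub>P.Q\<^esub> Y) = ?h X \<otimes>\<^bsub>P'.Q\<^esub> ?h Y"
    using P'.cls_mult[OF cl[OF _ c(1)] cl[OF _ d(1)]]
    by (simp only: c(2) d(2) P.cls_mult[OF c(1) d(1)] eq[OF _ _ c(1)] eq[OF _ _ d(1)] eq[OF _ _ k] frag_extend_add)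
qed


section \<open>The circuit relations and the tensor product with F2\<close>

lemma presented_group_circuits:
  "presented_group (ground M) {\<Sum>e\<in>C. frag_of e | C. circuit M C}"
proof
  show "{\<Sum>e\<in>C. frag_of e | C. circuit M C} \<subseteq> carrier (free_Abelian_group (ground M))"
  proof
    fix x assume "x \<in> {\<Sum>e\<in>C. frag_of e | C. circuit M C}"
    then obtain C where C: "circuit M C" "x = (\<Sum>e\<in>C. frag_of e)" by blast
    then have "C \<subseteq> ground M" by (simp add: circuit_def)
    then show "x \<in> carrier (free_Abelian_group (ground M))"
      unfolding C(2) by (intro sum_closed_free_Abelian_group) auto
  qed
qed

abbreviation tensor_relations where
  "tensor_relations A B \<equiv>
       ({frag_of (a \<otimes>\<^bsub>A\<^esub> a', b) - frag_of (a, b) - frag_of (a', b) | a a' b.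
           a \<in> carrier A \<and> a' \<in> carrier A \<and> b \<in> carrier B} \<union>
        {frag_of (a, b \<otimes>\<^bsub>B\<^esub> b') - frag_of (a, b) - frag_of (a, b') | a b b'.
           a \<in> carrier A \<and> b \<in> carrier B \<and> b' \<in> carrier B})"

lemma keys_diff3:
  "s \<in> S \<Longrightarrow> t \<in> S \<Longrightarrow> u \<in> S \<Longrightarrow> Poly_Mapping.keys (frag_of s - frag_of t - frag_of u :: 'a \<Rightarrow>\<^sub>0 int) \<subseteq> S"
  using keys_diff[of "frag_of s - frag_of t" "frag_of u"] keys_diff[of "frag_of s" "frag_of t"] by auto

lemma presented_group_tensor:
  assumes "monoid A" "monoid B"
  shows "presented_group (carrier A \<times> carrier B) (tensor_relations A B)"
proof
  interpret A: monoid A by fact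
  interpret B: monoid B by fact
  show "tensor_relations A B \<subseteq> carrier (free_Abelian_group (carrier A \<times> carrier B))"
  proof
    fix x assume "x \<in> tensor_relations A B"
    then show "x \<in> carrier (free_Abelian_group (carrier A \<times> carrier B))"
      by (elim UnE CollectE exE conjE; simp only: carrier_free_Abelian_group_iff; intro keys_diff3)
        (simp_all add: A.m_closed B.m_closed)
  qed
qed

lemma tensor_relations_hom:
  assumes f: "f \<in> hom A A'" and g: "g \<in> hom B B'" and r: "r \<in> tensor_relations A B"
  shows "frag_extend (\<lambda>(a, b). frag_of (f a, g b)) r \<in> tensor_relations A' B'"
  using r
proof (elim UnE CollectE exE conjE)
  fix a a' b assume "r = frag_of (a \<otimes>\<^bsub>A\<^esub> a', b) - frag_of (a, b) - frag_of (a', b)"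
    and c: "a \<in> carrier A" "a' \<in> carrier A" "b \<in> carrier B"
  then have "frag_extend (\<lambda>(a, b). frag_of (f a, g b)) r =
      frag_of (f a \<otimes>\<^bsub>A'\<^esub> f a', g b) - frag_of (f a, g b) - frag_of (f a', g b)"
    using f by (simp add: frag_extend_diff hom_mult)
  then show ?thesis
    using c hom_in_carrier[OF f] hom_in_carrier[OF g] by blast
next
  fix a b b' assume "r = frag_of (a, b \<otimes>\<^bsub>B\<^esub> b') - frag_of (a, b) - frag_of (a, b')"
    and c: "a \<in> carrier A" "b \<in> carrier B" "b' \<in> carrier B"
  then have "frag_extend (\<lambda>(a, b). frag_of (f a, g b)) r =
      frag_of (f a, g b \<otimes>\<^bsub>B'\<^esub> g b') - frag_of (f a, g b) - frag_of (f a, g b')"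
    using g by (simp add: frag_extend_diff hom_mult)
  then show ?thesis
    using c hom_in_carrier[OF f] hom_in_carrier[OF g] by blast
qed

lemma tensor_map_class:
  assumes "monoid A" "monoid B" "monoid A'" "monoid B'" "f \<in> hom A A'" "g \<in> hom B B'"
    and "Poly_Mapping.keys c \<subseteq> carrier A \<times> carrier B"
  shows "tensor_map A' B' f g (tensor_subgroup A B #>\<^bsub>free_Abelian_group (carrier A \<times> carrier B)\<^esub> c) =
    tensor_subgroup A' B' #>\<^bsub>free_Abelian_group (carrier A' \<times> carrier B')\<^esub> frag_extend (\<lambda>(a, b). frag_of (f a, g b)) c"
  unfolding tensor_map_def tensor_subgroup_def
  by (rule presented_induced_map[OF presented_group_tensor[OF assms(1,2)] presented_group_tensor[OF assms(3,4)]
      _ tensor_relations_hom[OF assms(5,6)] assms(7)])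
    (use hom_in_carrier[OF assms(5)] hom_in_carrier[OF assms(6)] in auto)

lemma tensor_map_hom:
  assumes "monoid A" "monoid B" "monoid A'" "monoid B'" "f \<in> hom A A'" "g \<in> hom B B'"
  shows "tensor_map A' B' f g \<in> hom (tensor_group A B) (tensor_group A' B')"
  unfolding tensor_map_def[abs_def] tensor_subgroup_def tensor_group_def
  by (rule presented_induced_hom[OF presented_group_tensor[OF assms(1,2)] presented_group_tensor[OF assms(3,4)]
      _ tensor_relations_hom[OF assms(5,6)]])
    (use hom_in_carrier[OF assms(5)] hom_in_carrier[OF assms(6)] in auto)

text \<open>\<^term>\<open>F2\<close> is an abbreviation for a record of arithmetic operations on \<^typ>\<open>bit\<close>, which the simplifier
  rewrites; a constant for its additive group keeps the tensor product stable.\<close>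

definition F2_add :: "bit monoid" where
  "F2_add = add_monoid F2"

lemma F2_add_simps [simp]: "carrier F2_add = UNIV" "x \<otimes>\<^bsub>F2_add\<^esub> y = x + y" "\<one>\<^bsub>F2_add\<^esub> = 0"
  by (simp_all add: F2_add_def)

lemma bit_double: "(b :: bit) + b = 0"
  by (cases b) auto

lemma comm_group_F2_add: "comm_group F2_add"
  by (rule comm_groupI) (auto simp only: F2_add_simps UNIV_I ac_simps add_0_left add_0_right intro: bit_double)

lemma monoid_F2_add: "monoid F2_add"
  using comm_group_F2_add by (simp add: comm_group_def group_def)

definition H1_class :: "'a matroid \<Rightarrow> ('a \<Rightarrow>\<^sub>0 int) \<Rightarrow> ('a \<Rightarrow>\<^sub>0 int) set" where
  "H1_class M c = circuit_subgroup M #>\<^bsub>free_Abelian_group (ground M)\<^esub> c"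

definition H1_tensor :: "'a matroid \<Rightarrow> ('a \<Rightarrow>\<^sub>0 int) set \<Rightarrow> bit \<Rightarrow> 'a H1_F2_elem" where
  "H1_tensor M a b = tensor_subgroup (H1 M) F2_add
     #>\<^bsub>free_Abelian_group (carrier (H1 M) \<times> carrier F2_add)\<^esub> frag_of (a, b)"

definition H1_tensor_group :: "'a matroid \<Rightarrow> 'a H1_F2_elem monoid" where
  "H1_tensor_group M = tensor_group (H1 M) F2_add"

text \<open>The class of \<open>e\<close> tensored with 1. For binary \<open>M\<close> these vectors
  turn out to represent \<open>M\<close>, and they involve no choice.\<close>

definition H1_F2_vec :: "'a matroid \<Rightarrow> 'a \<Rightarrow> 'a H1_F2_elem" where
  "H1_F2_vec M e = H1_tensor M (H1_class M (frag_of e)) 1"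

context
  fixes M :: "'a matroid"
begin

interpretation C: presented_group "ground M" "{\<Sum>e\<in>C. frag_of e | C. circuit M C}"
  by (rule presented_group_circuits)

lemma H1_eq: "H1 M = C.Q" by (simp add: H1_def circuit_subgroup_def)

lemma comm_group_H1: "comm_group (H1 M)" unfolding H1_eq by (rule C.Q.comm_group_axioms)

lemma monoid_H1: "monoid (H1 M)" using comm_group_H1 by (simp add: comm_group_def group_def)

lemma H1_class_eq: "H1_class M c = C.cls c" by (simp add: H1_class_def circuit_subgroup_def)

lemma H1_class_hom: "H1_class M \<in> hom (free_Abelian_group (ground M)) (H1 M)"
  unfolding H1_eq H1_class_eq[abs_def]
  by (rule homI) (use C.cls_closed C.cls_mult in \<open>auto simp del: mult_FactGroup\<close>)

lemma H1_class_circuit: "circuit M C \<Longrightarrow> H1_class M (\<Sum>e\<in>C. frag_of e) = \<one>\<^bsub>H1 M\<^esub>"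
  unfolding H1_eq H1_class_eq by (rule C.cls_one) (auto intro: generate.incl)

interpretation T: presented_group "carrier (H1 M) \<times> carrier F2_add" "tensor_relations (H1 M) F2_add"
  by (rule presented_group_tensor[OF monoid_H1 monoid_F2_add])

lemma H1_tensor_group_eq: "H1_tensor_group M = T.Q"
  unfolding H1_tensor_group_def tensor_group_def tensor_subgroup_def by (rule refl)

lemma comm_group_H1_tensor_group: "comm_group (H1_tensor_group M)"
  unfolding H1_tensor_group_eq by (rule T.Q.comm_group_axioms)

interpretation G: comm_group "H1_tensor_group M"
  by (rule comm_group_H1_tensor_group)

lemma H1_tensor_eq: "H1_tensor M a b = T.cls (frag_of (a, b))"
  unfolding H1_tensor_def tensor_subgroup_def by (rule refl)

lemma H1_F2_simps:
  "carrier (H1_F2 M) = carrier (H1_tensor_group M)" "x \<oplus>\<^bsub>H1_F2 M\<^esub> y = x \<otimes>\<^bsub>H1_tensor_group M\<^esub> y"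
  "\<zero>\<^bsub>H1_F2 M\<^esub> = \<one>\<^bsub>H1_tensor_group M\<^esub>" "k \<odot>\<^bsub>H1_F2 M\<^esub> x = tensor_map (H1 M) F2_add id (\<lambda>b. k * b) x"
  unfolding H1_F2_def H1_tensor_group_def F2_add_def
  by (simp_all only: partial_object.simps ring.simps monoid.simps module.simps)

lemma H1_tensor_closed: "a \<in> carrier (H1 M) \<Longrightarrow> H1_tensor M a b \<in> carrier (H1_tensor_group M)"
  unfolding H1_tensor_eq H1_tensor_group_eq by (rule T.cls_closed) simp

lemma H1_tensor_mult_left:
  assumes "a \<in> carrier (H1 M)" "a' \<in> carrier (H1 M)"
  shows "H1_tensor M (a \<otimes>\<^bsub>H1 M\<^esub> a') b = H1_tensor M a b \<otimes>\<^bsub>H1_tensor_group M\<^esub> H1_tensor M a' b"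
  unfolding H1_tensor_eq H1_tensor_group_eq
proof (rule T.cls_rel3)
  show "frag_of (a \<otimes>\<^bsub>H1 M\<^esub> a', b) - frag_of (a, b) - frag_of (a', b) \<in> tensor_relations (H1 M) F2_add"
    using assms UNIV_I[of b] unfolding F2_add_simps(1) by blast
qed (use assms in simp_all)

lemma tensor_relation_right:
  "a \<in> carrier (H1 M) \<Longrightarrow> frag_of (a, b + b') - frag_of (a, b) - frag_of (a, b') \<in> tensor_relations (H1 M) F2_add"
  unfolding F2_add_simps(1,2) by blast

lemma H1_tensor_add_right:
  assumes "a \<in> carrier (H1 M)"
  shows "H1_tensor M a (b + b') = H1_tensor M a b \<otimes>\<^bsub>H1_tensor_group M\<^esub> H1_tensor M a b'"
  unfolding H1_tensor_eq H1_tensor_group_eq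
  by (rule T.cls_rel3[OF tensor_relation_right]) (use assms in simp_all)

lemma H1_tensor_0:
  assumes a: "a \<in> carrier (H1 M)"
  shows "H1_tensor M a 0 = \<one>\<^bsub>H1_tensor_group M\<^esub>"
  using H1_tensor_add_right[OF a, of 0 0] H1_tensor_closed[OF a, of 0] G.l_cancel_one' by simp

lemma H1_tensor_group_induct:
  assumes "X \<in> carrier (H1_tensor_group M)" "subgroup K (H1_tensor_group M)"
    "\<And>a b. a \<in> carrier (H1 M) \<Longrightarrow> H1_tensor M a b \<in> K"
  shows "X \<in> K"
  by (rule T.presented_induct[OF assms(1,2)[unfolded H1_tensor_group_eq]])
    (use assms(3) in \<open>auto simp only: H1_tensor_eq F2_add_simps mem_Times_iff split_paired_all fst_conv snd_conv\<close>)

text \<open>A pure tensor can be doubled in its second factor, where the result is 0, and the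
  elements with trivial double form a subgroup.\<close>

lemma H1_tensor_group_double:
  assumes "X \<in> carrier (H1_tensor_group M)"
  shows "X \<otimes>\<^bsub>H1_tensor_group M\<^esub> X = \<one>\<^bsub>H1_tensor_group M\<^esub>"
proof -
  let ?K = "{X \<in> carrier (H1_tensor_group M). X \<otimes>\<^bsub>H1_tensor_group M\<^esub> X = \<one>\<^bsub>H1_tensor_group M\<^esub>}"
  have "X \<in> ?K"
  proof (rule H1_tensor_group_induct[OF assms])
    show "subgroup ?K (H1_tensor_group M)"
    proof (rule G.subgroupI)
      have "\<one>\<^bsub>H1_tensor_group M\<^esub> \<in> ?K" by simp
      then show "?K \<noteq> {}" by blast
    next
      fix a assume a: "a \<in> ?K"
      then show "inv\<^bsub>H1_tensor_group M\<^esub> a \<in> ?K"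
        using G.inv_mult_group[of a a] by simp
      fix b assume b: "b \<in> ?K"
      have "(a \<otimes>\<^bsub>H1_tensor_group M\<^esub> b) \<otimes>\<^bsub>H1_tensor_group M\<^esub> (a \<otimes>\<^bsub>H1_tensor_group M\<^esub> b) =
          (a \<otimes>\<^bsub>H1_tensor_group M\<^esub> a) \<otimes>\<^bsub>H1_tensor_group M\<^esub> (b \<otimes>\<^bsub>H1_tensor_group M\<^esub> b)"
        using a b by (simp add: G.m_ac)
      then show "a \<otimes>\<^bsub>H1_tensor_group M\<^esub> b \<in> ?K" using a b by simp
    qed blast
    fix a b assume a: "a \<in> carrier (H1 M)"
    have "H1_tensor M a b \<otimes>\<^bsub>H1_tensor_group M\<^esub> H1_tensor M a b = H1_tensor M a (b + b)"
      by (rule H1_tensor_add_right[OF a, symmetric])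
    then show "H1_tensor M a b \<in> ?K"
      using H1_tensor_closed[OF a] H1_tensor_0[OF a] by (simp only: bit_double mem_Collect_eq simp_thms)
  qed
  then show ?thesis by blast
qed

lemma smult_hom: "id \<in> hom (H1 M) (H1 M)" "(\<lambda>b. k * b) \<in> hom F2_add F2_add"
  by (simp add: hom_def) (rule homI, simp_all only: F2_add_simps distrib_left UNIV_I)

lemma smult_H1_tensor:
  assumes a: "a \<in> carrier (H1 M)"
  shows "k \<odot>\<^bsub>H1_F2 M\<^esub> H1_tensor M a b = H1_tensor M a (k * b)"
  using tensor_map_class[OF monoid_H1 monoid_F2_add monoid_H1 monoid_F2_add smult_hom, of "frag_of (a, b)" k] a
  unfolding H1_F2_simps(4) H1_tensor_def
  by (simp only: keys_frag_of mem_Times_iff frag_extend_of prod.case id_apply F2_add_simps UNIV_I fst_conv snd_conv simp_thms insert_subset empty_subsetI)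

lemma smult_H1_F2_hom: "(\<lambda>x. k \<odot>\<^bsub>H1_F2 M\<^esub> x) \<in> hom (H1_tensor_group M) (H1_tensor_group M)"
  unfolding H1_F2_simps(4) H1_tensor_group_def
  by (rule tensor_map_hom[OF monoid_H1 monoid_F2_add monoid_H1 monoid_F2_add smult_hom])

end

lemma subgroup_equalizer:
  assumes "group G" "h \<in> hom G H" "h' \<in> hom G H" "group H"
  shows "subgroup {x \<in> carrier G. h x = h' x} G"
proof -
  interpret G: group G by fact
  interpret h: group_hom G H h by (intro group_hom.intro group_hom_axioms.intro assms)
  interpret h': group_hom G H h' by (intro group_hom.intro group_hom_axioms.intro assms)
  show ?thesis
    by (rule G.subgroupI) (auto intro: exI[of _ "\<one>\<^bsub>G\<^esub>"])
qed

text \<open>The equalizer is a subgroup that contains the pure tensors, which generate the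
  group.\<close>

lemma H1_F2_hom_eq:
  assumes "h \<in> hom (H1_tensor_group M) G" "h' \<in> hom (H1_tensor_group M) G" "group G"
    and "\<And>a b. a \<in> carrier (H1 M) \<Longrightarrow> h (H1_tensor M a b) = h' (H1_tensor M a b)"
    and "X \<in> carrier (H1_tensor_group M)"
  shows "h X = h' X"
proof -
  have "X \<in> {x \<in> carrier (H1_tensor_group M). h x = h' x}"
    by (rule H1_tensor_group_induct[OF assms(5) subgroup_equalizer])
      (use assms comm_group_H1_tensor_group H1_tensor_closed in \<open>auto simp: comm_group_def\<close>)
  then show ?thesis by simp
qed

text \<open>The scalars 0 and 1 act as the zero map and the identity because they do so on pure
  tensors.\<close>

lemma F2_space_H1_F2: "F2_space (H1_F2 M)"
proof -
  interpret G: comm_group "H1_tensor_group M" by (rule comm_group_H1_tensor_group)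
  note [simp] = H1_F2_simps(1-3)
  show ?thesis
  proof (intro F2_space.intro F2_space_axioms.intro)
    show "abelian_group (H1_F2 M)"
    proof (rule abelian_groupI)
      fix x assume "x \<in> carrier (H1_F2 M)"
      then show "\<exists>y\<in>carrier (H1_F2 M). y \<oplus>\<^bsub>H1_F2 M\<^esub> x = \<zero>\<^bsub>H1_F2 M\<^esub>"
        by (auto intro!: bexI[of _ "inv\<^bsub>H1_tensor_group M\<^esub> x"])
    qed (simp_all add: G.m_assoc, simp add: G.m_comm)
  next
    fix x assume "x \<in> carrier (H1_F2 M)"
    then have x: "x \<in> carrier (H1_tensor_group M)" by simp
    show "x \<oplus>\<^bsub>H1_F2 M\<^esub> x = \<zero>\<^bsub>H1_F2 M\<^esub>" using H1_tensor_group_double[OF x] by simp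
    have id: "(\<lambda>x. x) \<in> hom (H1_tensor_group M) (H1_tensor_group M)" by (rule homI) auto
    show "1 \<odot>\<^bsub>H1_F2 M\<^esub> x = x"
      by (rule H1_F2_hom_eq[OF smult_H1_F2_hom id G.group_axioms _ x]) (simp only: smult_H1_tensor mult_1_left)
    have one: "(\<lambda>x. \<one>\<^bsub>H1_tensor_group M\<^esub>) \<in> hom (H1_tensor_group M) (H1_tensor_group M)" by (rule homI) auto
    show "0 \<odot>\<^bsub>H1_F2 M\<^esub> x = \<zero>\<^bsub>H1_F2 M\<^esub>"
      unfolding H1_F2_simps(3)
      by (rule H1_F2_hom_eq[OF smult_H1_F2_hom one G.group_axioms _ x]) (simp only: smult_H1_tensor mult_zero_left H1_tensor_0)
  qed
qed

lemma H1_tensor_H1_class_hom: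
  "(\<lambda>c. H1_tensor M (H1_class M c) 1) \<in> hom (free_Abelian_group (ground M)) (H1_tensor_group M)"
proof -
  have "(\<lambda>a. H1_tensor M a 1) \<in> hom (H1 M) (H1_tensor_group M)"
    by (rule homI) (simp_all only: H1_tensor_closed H1_tensor_mult_left)
  from hom_compose[OF H1_class_hom this] show ?thesis by (simp add: o_def)
qed

lemma H1_class_closed: "Poly_Mapping.keys c \<subseteq> ground M \<Longrightarrow> H1_class M c \<in> carrier (H1 M)"
  using hom_in_carrier[OF H1_class_hom, of c] by simp

lemma H1_F2_vec_closed: "e \<in> ground M \<Longrightarrow> H1_F2_vec M e \<in> carrier (H1_F2 M)"
  unfolding H1_F2_vec_def H1_F2_simps by (intro H1_tensor_closed H1_class_closed) simp


text \<open>Counterpart of \<open>cls_rel3\<close> for maps out of a tensor product: a bilinear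
  assignment kills the defining relations.\<close>

lemma hom_diff3_one:
  assumes "comm_group G" "h \<in> hom (free_Abelian_group S) G"
    and "Poly_Mapping.keys x \<subseteq> S" "Poly_Mapping.keys y \<subseteq> S" "Poly_Mapping.keys z \<subseteq> S"
    and "h x = h y \<otimes>\<^bsub>G\<^esub> h z"
  shows "h (x - y - z) = \<one>\<^bsub>G\<^esub>"
proof -
  interpret G: comm_group G by fact
  have k: "Poly_Mapping.keys (x - y - z) \<subseteq> S" "Poly_Mapping.keys (y + z) \<subseteq> S"
    using keys_diff[of "x - y" z] keys_diff[of x y] keys_add[of y z] assms(3-5) by blast+
  have c: "h a \<in> carrier G" if "Poly_Mapping.keys a \<subseteq> S" for a
    using hom_in_carrier[OF assms(2), of a] that by simp
  have m: "h (a + b) = h a \<otimes>\<^bsub>G\<^esub> h b" if "Poly_Mapping.keys a \<subseteq> S" "Poly_Mapping.keys b \<subseteq> S" for a b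
    using hom_mult[OF assms(2), of a b] that by simp
  have "h x = h ((x - y - z) + (y + z))" by simp
  also have "\<dots> = h (x - y - z) \<otimes>\<^bsub>G\<^esub> h x"
    unfolding m[OF k] m[OF assms(4,5)] assms(6) by (rule refl)
  finally show ?thesis using c[OF k(1)] c[OF assms(3)] G.r_cancel_one' by metis
qed

lemma hom_free_Abelian_group_sum:
  assumes "abelian_group V" "h \<in> hom (free_Abelian_group S) (add_monoid V)" "finite C" "C \<subseteq> S"
  shows "h (\<Sum>e\<in>C. frag_of e) = finsum V (\<lambda>e. h (frag_of e)) C"
proof -
  interpret V: abelian_group V by fact
  have c: "h a \<in> carrier V" if "Poly_Mapping.keys a \<subseteq> S" for a
    using hom_in_carrier[OF assms(2), of a] that by simp
  have m: "h (a + b) = h a \<oplus>\<^bsub>V\<^esub> h b" if "Poly_Mapping.keys a \<subseteq> S" "Poly_Mapping.keys b \<subseteq> S" for a b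
    using hom_mult[OF assms(2), of a b] that by simp
  show ?thesis using assms(3,4)
  proof (induction C)
    case empty
    have "h 0 \<oplus>\<^bsub>V\<^esub> h 0 = h 0" using m[of 0 0] by simp
    then show ?case using c[of 0] V.add.l_cancel_one' by simp
  next
    case (insert e C)
    have k: "Poly_Mapping.keys (\<Sum>e\<in>C. frag_of e) \<subseteq> S"
      using sum_closed_free_Abelian_group[of C frag_of S] insert.prems by auto
    have "h (\<Sum>e\<in>insert e C. frag_of e) = h (frag_of e) \<oplus>\<^bsub>V\<^esub> h (\<Sum>e\<in>C. frag_of e)"
      using insert k m[of "frag_of e" "\<Sum>e\<in>C. frag_of e"] by simp
    also have "\<dots> = finsum V (\<lambda>e. h (frag_of e)) (insert e C)"
      using insert c by (subst V.finsum_insert) auto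
    finally show ?case .
  qed
qed

lemma hom_add_monoid_H1_F2: "hom G (add_monoid (H1_F2 M)) = hom G (H1_tensor_group M)"
  by (simp add: hom_def H1_F2_simps)

lemma finsum_H1_F2_vec:
  assumes "finite C" "C \<subseteq> ground M"
  shows "finsum (H1_F2 M) (H1_F2_vec M) C = H1_tensor M (H1_class M (\<Sum>e\<in>C. frag_of e)) 1"
proof -
  have "abelian_group (H1_F2 M)" by (rule F2_space.axioms(1)[OF F2_space_H1_F2])
  from hom_free_Abelian_group_sum[OF this H1_tensor_H1_class_hom[folded hom_add_monoid_H1_F2] assms]
  show ?thesis unfolding H1_F2_vec_def by (rule sym)
qed

lemma finsum_H1_F2_vec_circuit:
  assumes "is_matroid M" "circuit M C"
  shows "finsum (H1_F2 M) (H1_F2_vec M) C = \<zero>\<^bsub>H1_F2 M\<^esub>"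
proof -
  interpret H: comm_group "H1 M" by (rule comm_group_H1)
  interpret G: comm_group "H1_tensor_group M" by (rule comm_group_H1_tensor_group)
  have C: "C \<subseteq> ground M" "finite C"
    using assms by (auto simp: circuit_def is_matroid_def intro: finite_subset)
  \<comment> \<open>The neutral element of \<open>H1 M\<close> is its own square, hence so is its
    tensor with 1, which must therefore be neutral.\<close>
  have "H1_tensor M \<one>\<^bsub>H1 M\<^esub> 1 = H1_tensor M \<one>\<^bsub>H1 M\<^esub> 1 \<otimes>\<^bsub>H1_tensor_group M\<^esub> H1_tensor M \<one>\<^bsub>H1 M\<^esub> 1"
    using H1_tensor_mult_left[OF H.one_closed H.one_closed, of 1] by simp
  then have "H1_tensor M \<one>\<^bsub>H1 M\<^esub> 1 = \<one>\<^bsub>H1_tensor_group M\<^esub>"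
    using G.l_cancel_one' H1_tensor_closed[OF H.one_closed] by metis
  then show ?thesis
    unfolding finsum_H1_F2_vec[OF C(2,1)] H1_class_circuit[OF assms(2)] H1_F2_simps .
qed

lemma F2_family_H1_F2_vec: "is_matroid M \<Longrightarrow> F2_family (H1_F2 M) (ground M) (H1_F2_vec M)"
  by (intro F2_family.intro F2_family_axioms.intro F2_space_H1_F2) (auto simp: is_matroid_def H1_F2_vec_closed)

text \<open>Subset sums are closed under addition by symmetric differences, and every element is its
  own inverse. They contain every class tensored with 1, by induction on a representing chain, and
  the second factor of a pure tensor is 0 or 1.\<close>

lemma F2_span_H1_F2_vec:
  assumes "is_matroid M"
  shows "F2_span (H1_F2 M) (H1_F2_vec M) (ground M) = carrier (H1_F2 M)"
proof -
  interpret F2_family "H1_F2 M" "ground M" "H1_F2_vec M" by (rule F2_family_H1_F2_vec[OF assms])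
  interpret G: comm_group "H1_tensor_group M" by (rule comm_group_H1_tensor_group)
  let ?K = "F2_span (H1_F2 M) (H1_F2_vec M) (ground M)"
  have K: "subgroup ?K (H1_tensor_group M)"
  proof (rule G.subgroupI)
    show sub: "?K \<subseteq> carrier (H1_tensor_group M)"
      using finsum_family_closed by (auto simp: F2_span_def H1_F2_simps)
    show "?K \<noteq> {}" by (auto simp: F2_span_def)
    fix x assume x: "x \<in> ?K"
    then have "inv\<^bsub>H1_tensor_group M\<^esub> x = x"
      using sub H1_tensor_group_double by (intro G.inv_equality) auto
    then show "inv\<^bsub>H1_tensor_group M\<^esub> x \<in> ?K" using x by simp
    fix y assume y: "y \<in> ?K"
    obtain A B where AB: "A \<subseteq> ground M" "B \<subseteq> ground M" "x = finsum (H1_F2 M) (H1_F2_vec M) A" "y = finsum (H1_F2 M) (H1_F2_vec M) B"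
      using x y unfolding F2_span_def by blast
    have eq: "x \<otimes>\<^bsub>H1_tensor_group M\<^esub> y = finsum (H1_F2 M) (H1_F2_vec M) (sym_diff A B)"
      using finsum_sym_diff[OF AB(1,2)] AB by (simp only: H1_F2_simps)
    show "x \<otimes>\<^bsub>H1_tensor_group M\<^esub> y \<in> ?K"
      unfolding F2_span_def eq by (rule imageI) (use AB in auto)
  qed
  interpret K: subgroup ?K "H1_tensor_group M" by (rule K)
  note hom = H1_tensor_H1_class_hom[of M]
  have gen: "H1_tensor M (H1_class M c) 1 \<in> ?K" if "Poly_Mapping.keys c \<subseteq> ground M" for c
  proof -
    have "Poly_Mapping.keys c \<subseteq> ground M \<and> H1_tensor M (H1_class M c) 1 \<in> ?K" using that
    proof (induction rule: frag_induction)
      case zero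
      show ?case using hom_one[OF hom] G.group_axioms K.one_closed by simp
    next
      case (one e)
      then show ?case using in_F2_span_self[of e "ground M"] by (simp add: H1_F2_vec_def[of M e])
    next
      case (diff a b)
      have k: "Poly_Mapping.keys (a - b) \<subseteq> ground M" using diff keys_diff[of a b] by blast
      have "H1_tensor M (H1_class M a) 1 =
          H1_tensor M (H1_class M (a - b)) 1 \<otimes>\<^bsub>H1_tensor_group M\<^esub> H1_tensor M (H1_class M b) 1"
        using hom_mult[OF hom, of "a - b" b] k diff by simp
      then have "H1_tensor M (H1_class M (a - b)) 1 =
          H1_tensor M (H1_class M a) 1 \<otimes>\<^bsub>H1_tensor_group M\<^esub> inv\<^bsub>H1_tensor_group M\<^esub> H1_tensor M (H1_class M b) 1"
        using G.inv_solve_right H1_tensor_closed[OF H1_class_closed] k diff by metis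
      then show ?case using k diff K.m_closed K.m_inv_closed by metis
    qed
    then show ?thesis ..
  qed
  have "X \<in> ?K" if "X \<in> carrier (H1_tensor_group M)" for X
  proof (rule H1_tensor_group_induct[OF that K])
    fix a b assume a: "a \<in> carrier (H1 M)"
    show "H1_tensor M a b \<in> ?K"
    proof (cases b)
      case zero
      then show ?thesis using H1_tensor_0[OF a] K.one_closed by simp
    next
      case one
      obtain c where "Poly_Mapping.keys c \<subseteq> ground M" "a = H1_class M c"
        using a by (auto simp: H1_def H1_class_def carrier_FactGroup)
      then show ?thesis using gen one by simp
    qed
  qed
  then show ?thesis using K.subset by (auto simp: H1_F2_simps)
qed

section \<open>Homology of a represented matroid\<close>

context F2_family
begin

text \<open>A dependent set contains a nonempty zero sum, and no proper subset of a circuit can be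
  one. In particular the defining relations of \<open>H1\<close> hold in every representing
  space.\<close>

lemma circuit_iff_minimal_relation:
  "circuit (family_matroid V E \<rho>) C \<longleftrightarrow> C \<subseteq> E \<and> C \<noteq> {} \<and> finsum V \<rho> C = \<zero>\<^bsub>V\<^esub> \<and>
    (\<forall>B. B \<subset> C \<longrightarrow> B \<noteq> {} \<longrightarrow> finsum V \<rho> B \<noteq> \<zero>\<^bsub>V\<^esub>)"
proof
  assume "circuit (family_matroid V E \<rho>) C"
  then have C: "C \<subseteq> E" "\<not> F2_free V \<rho> C" "\<And>S. S \<subset> C \<Longrightarrow> F2_free V \<rho> S"
    by (auto simp: circuit_def family_matroid_def)
  obtain B where B: "B \<subseteq> C" "B \<noteq> {}" "finsum V \<rho> B = \<zero>\<^bsub>V\<^esub>" using C(2) unfolding F2_free_def by auto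
  have "B = C" using C(3)[of B] B F2_freeD[of B B] by blast
  moreover have "finsum V \<rho> B' \<noteq> \<zero>\<^bsub>V\<^esub>" if "B' \<subset> C" "B' \<noteq> {}" for B'
    using F2_freeD[OF C(3)[OF that(1)] order_refl] that(2) by metis
  ultimately show "C \<subseteq> E \<and> C \<noteq> {} \<and> finsum V \<rho> C = \<zero>\<^bsub>V\<^esub> \<and>
    (\<forall>B. B \<subset> C \<longrightarrow> B \<noteq> {} \<longrightarrow> finsum V \<rho> B \<noteq> \<zero>\<^bsub>V\<^esub>)" using B C(1) by simp
next
  assume *: "C \<subseteq> E \<and> C \<noteq> {} \<and> finsum V \<rho> C = \<zero>\<^bsub>V\<^esub> \<and>
    (\<forall>B. B \<subset> C \<longrightarrow> B \<noteq> {} \<longrightarrow> finsum V \<rho> B \<noteq> \<zero>\<^bsub>V\<^esub>)"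
  then have "\<not> F2_free V \<rho> C" using F2_freeD[of C C] by blast
  moreover have "F2_free V \<rho> S" if "S \<subset> C" for S
    unfolding F2_free_def
  proof (intro allI impI)
    fix T assume "T \<subseteq> S" "T \<noteq> {}"
    then show "finsum V \<rho> T \<noteq> \<zero>\<^bsub>V\<^esub>" using * that by (meson subset_psubset_trans)
  qed
  ultimately show "circuit (family_matroid V E \<rho>) C"
    using * unfolding circuit_def family_matroid_def by auto
qed

text \<open>Every relation is a sum of circuits.\<close>

lemma relation_H1_F2_vec:
  assumes "T \<subseteq> E" "finsum V \<rho> T = \<zero>\<^bsub>V\<^esub>"
  defines "M \<equiv> family_matroid V E \<rho>"
  shows "finsum (H1_F2 M) (H1_F2_vec M) T = \<zero>\<^bsub>H1_F2 M\<^esub>"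
proof -
  have mat: "is_matroid M" unfolding M_def by (rule is_matroid_family_matroid)
  have ground: "ground M = E" by (simp add: M_def family_matroid_def)
  interpret H: F2_family "H1_F2 M" E "H1_F2_vec M"
    using F2_family_H1_F2_vec[OF mat] by (simp only: ground)
  show ?thesis
    using finite_subset_E[OF assms(1)] assms(1,2)
  proof (induction T rule: finite_psubset_induct)
    case (psubset T)
    show ?case
    proof (cases "T = {}")
      case False
      let ?A = "{B. B \<subseteq> T \<and> B \<noteq> {} \<and> finsum V \<rho> B = \<zero>\<^bsub>V\<^esub>}"
      have "finite ?A" using psubset.hyps by simp
      moreover have "?A \<noteq> {}" using False psubset.prems by blast
      ultimately have "\<exists>B\<in>?A. \<forall>b\<in>?A. b \<subseteq> B \<longrightarrow> B = b" by (rule finite_has_minimal)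
      then obtain B where B: "B \<in> ?A" and min: "\<forall>b\<in>?A. b \<subseteq> B \<longrightarrow> B = b" ..
      \<comment> \<open>A minimal nonempty zero-sum subset of \<open>T\<close> is a circuit and
        vanishes in homology. The rest of \<open>T\<close> is again a zero sum, to which the
        induction hypothesis applies.\<close>
      have "circuit M B"
        unfolding M_def circuit_iff_minimal_relation
      proof (intro conjI allI impI)
        fix b assume b: "b \<subset> B" "b \<noteq> {}"
        show "finsum V \<rho> b \<noteq> \<zero>\<^bsub>V\<^esub>"
        proof
          assume "finsum V \<rho> b = \<zero>\<^bsub>V\<^esub>"
          then have "b \<in> ?A" using b B by blast
          then show False using bspec[OF min, of b] b(1) by blast
        qed
      qed (use B psubset.prems in auto)
      then have vB: "finsum (H1_F2 M) (H1_F2_vec M) B = \<zero>\<^bsub>H1_F2 M\<^esub>"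
        by (rule finsum_H1_F2_vec_circuit[OF mat])
      have B': "B \<subseteq> E" "T - B \<subseteq> E" "T - B \<subset> T" using B psubset.prems by auto
      have sd: "sym_diff T B = T - B" "sym_diff (T - B) B = T" using B by auto
      have "finsum V \<rho> (T - B) = \<zero>\<^bsub>V\<^esub>"
        using finsum_sym_diff[OF psubset.prems(1) B'(1)] B psubset.prems(2) by (simp add: sd)
      then have vT: "finsum (H1_F2 M) (H1_F2_vec M) (T - B) = \<zero>\<^bsub>H1_F2 M\<^esub>"
        by (rule psubset.IH[OF B'(3,2)])
      show ?thesis
        using H.finsum_sym_diff[OF B'(2,1)] unfolding sd(2) vT vB by simp
    qed simp
  qed
qed

text \<open>Circuits sum to zero in \<open>V\<close>, so \<open>\<rho>\<close> extends to
  \<open>g1\<close> on \<open>H1 M\<close>. The bilinear map that multiplies \<open>g1 a\<close> by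
  the scalar \<open>b\<close> then extends to the tensor product.\<close>

lemma H1_F2_universal:
  defines "M \<equiv> family_matroid V E \<rho>"
  obtains g where "linear_map F2 (H1_F2 M) V g" "\<And>e. e \<in> E \<Longrightarrow> g (H1_F2_vec M e) = \<rho> e"
proof -
  have ground: "ground M = E" by (simp add: M_def family_matroid_def)
  interpret A: comm_group "add_monoid V" by (rule a_comm_group)
  interpret C: presented_group "ground M" "{\<Sum>e\<in>C. frag_of e | C. circuit M C}"
    by (rule presented_group_circuits)
  interpret T: presented_group "carrier (H1 M) \<times> carrier F2_add" "tensor_relations (H1 M) F2_add"
    by (rule presented_group_tensor[OF monoid_H1 monoid_F2_add])
  obtain g1 where g1: "g1 \<in> hom C.Q (add_monoid V)" "\<And>e. e \<in> ground M \<Longrightarrow> g1 (C.cls (frag_of e)) = \<rho> e"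
  proof (rule C.presented_universal[OF a_comm_group])
    show "\<rho> \<in> ground M \<rightarrow> carrier (add_monoid V)" using \<rho>_closed by (simp add: ground)
    fix h r assume h: "h \<in> hom C.F (add_monoid V)" "\<And>e. e \<in> ground M \<Longrightarrow> h (frag_of e) = \<rho> e"
      and "r \<in> {\<Sum>e\<in>C. frag_of e | C. circuit M C}"
    then obtain C where C: "circuit M C" "r = (\<Sum>e\<in>C. frag_of e)" by blast
    then have C': "C \<subseteq> E" "finsum V \<rho> C = \<zero>\<^bsub>V\<^esub>" unfolding M_def circuit_iff_minimal_relation by auto
    have "h r = finsum V (\<lambda>e. h (frag_of e)) C"
      unfolding C(2) by (rule hom_free_Abelian_group_sum[OF abelian_group_axioms h(1)])
        (use C' finite_subset_E ground in auto)
    also have "\<dots> = finsum V \<rho> C"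
      using C'(1) h(2) \<rho>_closed by (intro finsum_cong') (auto simp: ground)
    finally show "h r = \<one>\<^bsub>add_monoid V\<^esub>" using C'(2) by simp
  qed blast
  have g1': "g1 \<in> hom (H1 M) (add_monoid V)" using g1(1) by (simp only: H1_eq)
  have g1c: "g1 a \<in> carrier V" if "a \<in> carrier (H1 M)" for a using hom_in_carrier[OF g1' that] by simp
  have g1m: "g1 (a \<otimes>\<^bsub>H1 M\<^esub> a') = g1 a \<oplus>\<^bsub>V\<^esub> g1 a'" if "a \<in> carrier (H1 M)" "a' \<in> carrier (H1 M)" for a a'
    using hom_mult[OF g1' that] by simp
  interpret VS: vectorspace F2 V by (rule vectorspace_F2)
  have sc: "b \<odot>\<^bsub>V\<^esub> v \<in> carrier V" if "v \<in> carrier V" for b v using VS.smult_closed[of b v] that by simp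
  have sl: "(b + b') \<odot>\<^bsub>V\<^esub> v = b \<odot>\<^bsub>V\<^esub> v \<oplus>\<^bsub>V\<^esub> b' \<odot>\<^bsub>V\<^esub> v" if "v \<in> carrier V" for b b' :: bit and v
  proof -
    have "(b \<oplus>\<^bsub>F2\<^esub> b') \<odot>\<^bsub>V\<^esub> v = b \<odot>\<^bsub>V\<^esub> v \<oplus>\<^bsub>V\<^esub> b' \<odot>\<^bsub>V\<^esub> v"
      by (rule VS.smult_l_distr) (simp_all add: that)
    then show ?thesis by (simp only: ring.simps)
  qed
  have sr: "b \<odot>\<^bsub>V\<^esub> (v \<oplus>\<^bsub>V\<^esub> w) = b \<odot>\<^bsub>V\<^esub> v \<oplus>\<^bsub>V\<^esub> b \<odot>\<^bsub>V\<^esub> w" if "v \<in> carrier V" "w \<in> carrier V" for b v w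
    by (rule VS.smult_r_distr) (simp_all add: that)
  obtain g where g: "g \<in> hom T.Q (add_monoid V)"
    "\<And>s. s \<in> carrier (H1 M) \<times> carrier F2_add \<Longrightarrow> g (T.cls (frag_of s)) = (\<lambda>(a, b). b \<odot>\<^bsub>V\<^esub> g1 a) s"
  proof (rule T.presented_universal[OF a_comm_group])
    show "(\<lambda>(a, b). b \<odot>\<^bsub>V\<^esub> g1 a) \<in> carrier (H1 M) \<times> carrier F2_add \<rightarrow> carrier (add_monoid V)"
      using g1c sc by auto
    fix h r assume h: "h \<in> hom T.F (add_monoid V)"
      "\<And>s. s \<in> carrier (H1 M) \<times> carrier F2_add \<Longrightarrow> h (frag_of s) = (\<lambda>(a, b). b \<odot>\<^bsub>V\<^esub> g1 a) s"
      and r: "r \<in> tensor_relations (H1 M) F2_add"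
    interpret H: monoid "H1 M" by (rule monoid_H1)
    have hv: "h (frag_of (a, b)) = b \<odot>\<^bsub>V\<^esub> g1 a" if "a \<in> carrier (H1 M)" for a b
      using h(2)[of "(a, b)"] that by simp
    from r show "h r = \<one>\<^bsub>add_monoid V\<^esub>"
    proof (elim UnE CollectE exE conjE)
      fix a a' b assume r: "r = frag_of (a \<otimes>\<^bsub>H1 M\<^esub> a', b) - frag_of (a, b) - frag_of (a', b)"
        and c: "a \<in> carrier (H1 M)" "a' \<in> carrier (H1 M)"
      have "h (frag_of (a \<otimes>\<^bsub>H1 M\<^esub> a', b)) = h (frag_of (a, b)) \<otimes>\<^bsub>add_monoid V\<^esub> h (frag_of (a', b))"
        using c g1c by (simp add: hv g1m sr)
      then show ?thesis unfolding r
        by (intro hom_diff3_one[OF a_comm_group h(1)]) (use c in auto)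
    next
      fix a b b' assume r: "r = frag_of (a, b \<otimes>\<^bsub>F2_add\<^esub> b') - frag_of (a, b) - frag_of (a, b')"
        and c: "a \<in> carrier (H1 M)"
      have "h (frag_of (a, b \<otimes>\<^bsub>F2_add\<^esub> b')) = h (frag_of (a, b)) \<otimes>\<^bsub>add_monoid V\<^esub> h (frag_of (a, b'))"
        using g1c[OF c] by (simp only: hv[OF c] F2_add_simps sl monoid.simps)
      then show ?thesis unfolding r
        by (intro hom_diff3_one[OF a_comm_group h(1)]) (use c in auto)
    qed
  qed blast
  have g': "g \<in> hom (H1_tensor_group M) (add_monoid V)" using g(1) by (simp only: H1_tensor_group_eq)
  show ?thesis
  proof (rule that)
    show "linear_map F2 (H1_F2 M) V g"
      unfolding linear_map_F2_iff[OF F2_space_H1_F2 F2_space_axioms] H1_F2_simps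
      using hom_in_carrier[OF g'] hom_mult[OF g'] by simp
    show "g (H1_F2_vec M e) = \<rho> e" if "e \<in> E" for e
    proof -
      have e: "e \<in> ground M" using that ground by simp
      have "g (H1_tensor M (H1_class M (frag_of e)) 1) = 1 \<odot>\<^bsub>V\<^esub> g1 (H1_class M (frag_of e))"
        using g(2)[of "(H1_class M (frag_of e), 1)"] H1_class_closed[of "frag_of e" M] e
        unfolding H1_tensor_eq by simp
      also have "g1 (H1_class M (frag_of e)) = \<rho> e" using g1(2)[OF e] by (simp only: H1_class_eq)
      also have "1 \<odot>\<^bsub>V\<^esub> \<rho> e = \<rho> e" using \<rho>_closed that by (auto intro: smult_1)
      finally show ?thesis by (simp only: H1_F2_vec_def)
    qed
  qed
qed

text \<open>Every homology element is a subset sum. If two of them agree in \<open>V\<close>, their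
  symmetric difference is a relation in \<open>V\<close>, hence one in homology by
  \<open>relation_H1_F2_vec\<close>. Surjectivity is the spanning hypothesis.\<close>

lemma H1_F2_linear_iso:
  assumes "F2_span V \<rho> E = carrier V"
  defines "M \<equiv> family_matroid V E \<rho>"
  obtains g where "linear_iso (H1_F2 M) V g" "\<And>e. e \<in> E \<Longrightarrow> g (H1_F2_vec M e) = \<rho> e"
proof -
  have mat: "is_matroid M" unfolding M_def by (rule is_matroid_family_matroid)
  have ground: "ground M = E" by (simp add: M_def family_matroid_def)
  interpret H: F2_family "H1_F2 M" E "H1_F2_vec M"
    using F2_family_H1_F2_vec[OF mat] by (simp only: ground)
  obtain g where g: "linear_map F2 (H1_F2 M) V g" "\<And>e. e \<in> E \<Longrightarrow> g (H1_F2_vec M e) = \<rho> e"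
    using H1_F2_universal unfolding M_def by blast
  have sum: "g (finsum (H1_F2 M) (H1_F2_vec M) T) = finsum V \<rho> T" if T: "T \<subseteq> E" for T
  proof -
    have "g (finsum (H1_F2 M) (H1_F2_vec M) T) = finsum V (\<lambda>e. g (H1_F2_vec M e)) T"
      using T H.\<rho>_closed by (intro finsum_linear[OF F2_space_H1_F2 F2_space_axioms g(1) finite_subset_E[OF T]]) auto
    also have "\<dots> = finsum V \<rho> T" using T g(2) \<rho>_closed by (intro finsum_cong') auto
    finally show ?thesis .
  qed
  have carr: "carrier (H1_F2 M) = finsum (H1_F2 M) (H1_F2_vec M) ` Pow E"
    using F2_span_H1_F2_vec[OF mat] by (simp only: ground F2_span_def)
  have "bij_betw g (carrier (H1_F2 M)) (carrier V)"
    unfolding bij_betw_def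
  proof
    show "inj_on g (carrier (H1_F2 M))"
    proof (rule inj_onI)
      fix x y assume "x \<in> carrier (H1_F2 M)" "y \<in> carrier (H1_F2 M)" and eq: "g x = g y"
      then obtain A B where A: "A \<subseteq> E" "x = finsum (H1_F2 M) (H1_F2_vec M) A"
        and B: "B \<subseteq> E" "y = finsum (H1_F2 M) (H1_F2_vec M) B" unfolding carr by blast
      have "finsum V \<rho> A = finsum V \<rho> B" using eq sum A B by simp
      then have "finsum V \<rho> (sym_diff A B) = \<zero>\<^bsub>V\<^esub>" using finsum_eq_iff[OF A(1) B(1)] by simp
      then have "finsum (H1_F2 M) (H1_F2_vec M) (sym_diff A B) = \<zero>\<^bsub>H1_F2 M\<^esub>"
        unfolding M_def by (rule relation_H1_F2_vec[rotated]) (use A B in auto)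
      then show "x = y" using H.finsum_eq_iff[OF A(1) B(1)] A B by simp
    qed
    have "g ` carrier (H1_F2 M) = finsum V \<rho> ` Pow E"
      unfolding carr image_image by (rule image_cong) (auto simp: sum)
    then show "g ` carrier (H1_F2 M) = carrier V" using assms(1) by (simp only: F2_span_def)
  qed
  then show ?thesis using that g by (auto simp: linear_iso_def)
qed

end


lemma family_matroid_linear_iso:
  assumes "F2_family V E \<rho>" "linear_iso V W h" and \<rho>': "\<And>e. e \<in> E \<Longrightarrow> \<rho>' e = h (\<rho> e)"
  shows "F2_family W E \<rho>'" "family_matroid W E \<rho>' = family_matroid V E \<rho>"
    "F2_span V \<rho> E = carrier V \<Longrightarrow> F2_span W \<rho>' E = carrier W"
proof -
  interpret F2_family V E \<rho> by fact
  note h = linear_isoD[OF assms(2)]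
  interpret W: F2_space W by (rule h(2))
  show W: "F2_family W E \<rho>'"
    by unfold_locales (use finite_E \<rho>_closed h(4) \<rho>' in \<open>auto simp: Pi_iff\<close>)
  interpret W: F2_family W E \<rho>' by (rule W)
  \<comment> \<open>The identity of the ground set, regarded as lying over \<open>h\<close>,
    compares the two notions of independence.\<close>
  have "matroid_hom (family_matroid V E \<rho>) (family_matroid W E \<rho>') (\<lambda>e. e)"
    by (rule matroid_hom_family_matroid[OF assms(1) W h(3,5)]) (use \<rho>' in auto)
  then show "family_matroid W E \<rho>' = family_matroid V E \<rho>"
    by (auto simp: matroid_hom_def family_matroid_def)
  assume span: "F2_span V \<rho> E = carrier V"
  have "finsum W \<rho>' T = h (finsum V \<rho> T)" if T: "T \<subseteq> E" for T
  proof -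
    have "h (finsum V \<rho> T) = finsum W (\<lambda>e. h (\<rho> e)) T"
      using T \<rho>_closed finite_subset_E[OF T] by (intro finsum_linear[OF h(1-3)]) auto
    also have "\<dots> = finsum W \<rho>' T"
      using T \<rho>' W.\<rho>_closed by (intro W.finsum_cong') auto
    finally show ?thesis by (rule sym)
  qed
  then have "F2_span W \<rho>' E = h ` F2_span V \<rho> E"
    unfolding F2_span_def image_image by (intro image_cong) auto
  then show "F2_span W \<rho>' E = carrier W" using span h(6) by simp
qed

section \<open>Binary matroids of rank r and the maps induced on their homology\<close>

definition binary_matroids :: "nat \<Rightarrow> 'a matroid set" where
  "binary_matroids r = {M. is_matroid M \<and> binary M \<and> matroid_rank M = r}"

definition F2_spaces :: "nat \<Rightarrow> (bit, 'v) module set" where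
  "F2_spaces r = {V. F2_space V \<and> card (carrier V) = 2 ^ r}"

lemma F2_spaces_finite: "V \<in> F2_spaces r \<Longrightarrow> finite (carrier V)"
  unfolding F2_spaces_def using card_ge_0_finite by force

lemma family_matroid_in_binary_matroids:
  assumes "F2_family V E \<rho>" "F2_span V \<rho> E = carrier V" "V \<in> F2_spaces r"
  shows "family_matroid V E \<rho> \<in> binary_matroids r"
proof -
  interpret F2_family V E \<rho> by fact
  have mat: "is_matroid (family_matroid V E \<rho>)" by (rule is_matroid_family_matroid)
  have card: "card (carrier V) = 2 ^ r" using assms(3) by (simp add: F2_spaces_def)
  then have "(2 :: nat) ^ matroid_rank (family_matroid V E \<rho>) = 2 ^ r"
    using card_spanned_space[OF assms(2)] by simp
  then have rank: "matroid_rank (family_matroid V E \<rho>) = r" by simp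
  \<comment> \<open>The definition of \<open>binary\<close> admits only spaces carried by
    \<open>bit vec\<close>, so the representation is moved to coordinates.\<close>
  obtain h where h: "linear_iso V (module_vec TYPE(bit) r) h"
    using linear_iso_module_vec[OF F2_space_axioms card] .
  note fam = family_matroid_linear_iso[OF assms(1) h, of "\<lambda>e. h (\<rho> e)", OF refl]
  interpret W: F2_family "module_vec TYPE(bit) r" E "\<lambda>e. h (\<rho> e)" by (rule fam(1))
  have ground: "ground (family_matroid V E \<rho>) = E" by (simp add: family_matroid_def)
  have "representation F2 (module_vec TYPE(bit) r) (family_matroid V E \<rho>) (\<lambda>e. h (\<rho> e))"
    by (subst representation_iff[OF mat W.vectorspace_F2])
      (use fam(2,3) assms(2) W.\<rho>_closed in \<open>auto simp: ground\<close>)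
  then have "binary (family_matroid V E \<rho>)" unfolding binary_def by blast
  then show ?thesis using mat rank by (simp add: binary_matroids_def)
qed

text \<open>Any representation is isomorphic to homology by a map that matches the vectors, so
  homology itself represents \<open>M\<close>. The choice of a representation disappears here, which
  makes the later constructions natural.\<close>

lemma binary_matroids_H1_F2:
  assumes "M \<in> binary_matroids r"
  shows "is_matroid M" "H1_F2 M \<in> F2_spaces r" "F2_family (H1_F2 M) (ground M) (H1_F2_vec M)"
    "family_matroid (H1_F2 M) (ground M) (H1_F2_vec M) = M"
proof -
  show mat: "is_matroid M" using assms by (simp add: binary_matroids_def)
  show fam: "F2_family (H1_F2 M) (ground M) (H1_F2_vec M)" by (rule F2_family_H1_F2_vec[OF mat])
  interpret H: F2_family "H1_F2 M" "ground M" "H1_F2_vec M" by (rule fam)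
  obtain V :: "(bit, bit vec) module" and \<rho> where rep: "representation F2 V M \<rho>"
    using assms by (auto simp: binary_matroids_def binary_def)
  then have V: "vectorspace F2 V" "\<rho> \<in> ground M \<rightarrow> carrier V" unfolding representation_def by blast+
  have M: "M = family_matroid V (ground M) \<rho>" "F2_span V \<rho> (ground M) = carrier V"
    using rep representation_iff[OF mat V] by blast+
  interpret V: F2_space V using V(1) vectorspace_F2_iff by blast
  interpret V: F2_family V "ground M" \<rho>
    by unfold_locales (use V(2) mat in \<open>auto simp: is_matroid_def\<close>)
  obtain g where g: "linear_iso (H1_F2 M) V g" "\<And>e. e \<in> ground M \<Longrightarrow> g (H1_F2_vec M e) = \<rho> e"
    using V.H1_F2_linear_iso[OF M(2)] unfolding M(1)[symmetric] by blast
  show eq: "family_matroid (H1_F2 M) (ground M) (H1_F2_vec M) = M"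
    using family_matroid_linear_iso(2)[OF fam g(1), of \<rho>] g(2) M(1) by simp
  have "card (carrier (H1_F2 M)) = 2 ^ matroid_rank M"
    using H.card_spanned_space[OF F2_span_H1_F2_vec[OF mat]] by (simp only: eq)
  then show "H1_F2 M \<in> F2_spaces r"
    using assms by (simp add: F2_spaces_def binary_matroids_def F2_space_H1_F2)
qed

lemma circuit_image:
  assumes "matroid_hom M N f" "circuit M C"
  shows "circuit N (f ` C)"
proof -
  have f: "f \<in> ground M \<rightarrow> ground N" "inj_on f (ground M)" "\<And>S. S \<subseteq> ground M \<Longrightarrow> S \<in> indep M \<longleftrightarrow> f ` S \<in> indep N"
    using assms(1) by (auto simp: matroid_hom_def)
  have C: "C \<subseteq> ground M" "C \<notin> indep M" "\<And>S. S \<subset> C \<Longrightarrow> S \<in> indep M"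
    using assms(2) by (auto simp: circuit_def)
  have "S \<in> indep N" if S: "S \<subset> f ` C" for S
  proof -
    obtain S' where S': "S' \<subseteq> C" "S = f ` S'"
      using iffD1[OF subset_image_iff psubset_imp_subset[OF S]] by blast
    then have "S' \<noteq> C" using S by blast
    then have "S' \<in> indep M" using S'(1) C(3) by (simp add: psubset_eq)
    then show ?thesis using f(3)[OF order_trans[OF S'(1) C(1)]] S'(2) by simp
  qed
  moreover have "f ` C \<subseteq> ground N" using f(1) C(1) by (auto simp: Pi_iff)
  moreover have "f ` C \<notin> indep N" using C(2) f(3)[OF C(1)] by simp
  ultimately show ?thesis unfolding circuit_def by simp
qed

context
  fixes M N :: "'a matroid" and f :: "'a \<Rightarrow> 'a"
  assumes mat: "is_matroid M" and hom: "matroid_hom M N f"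
begin

lemma matroid_hom_keys: "e \<in> ground M \<Longrightarrow> Poly_Mapping.keys ((frag_of \<circ> f) e) \<subseteq> ground N"
  using hom by (auto simp: matroid_hom_def Pi_iff)

lemma matroid_hom_circuit_relation:
  assumes "x \<in> {\<Sum>e\<in>C. frag_of e | C. circuit M C}"
  shows "frag_extend (frag_of \<circ> f) x \<in> {\<Sum>e\<in>C. frag_of e | C. circuit N C}"
proof -
  obtain C where C: "circuit M C" "x = (\<Sum>e\<in>C. frag_of e)" using assms by blast
  then have "C \<subseteq> ground M" by (simp add: circuit_def)
  then have fin: "finite C" and inj: "inj_on f C"
    using mat hom by (auto simp: is_matroid_def matroid_hom_def intro: finite_subset inj_on_subset)
  have "frag_extend (frag_of \<circ> f) x = (\<Sum>e\<in>C. frag_of (f e))"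
    unfolding C(2) frag_extend_sum[OF fin] by (simp add: o_def)
  also have "\<dots> = (\<Sum>e\<in>f ` C. frag_of e)" using sum.reindex[OF inj, of frag_of] by (simp add: o_def)
  finally show ?thesis using circuit_image[OF hom C(1)] by blast
qed

lemma H1_map_H1_class:
  "Poly_Mapping.keys c \<subseteq> ground M \<Longrightarrow> H1_map N f (H1_class M c) = H1_class N (frag_extend (frag_of \<circ> f) c)"
  unfolding H1_map_def H1_class_def circuit_subgroup_def
  by (rule presented_induced_map[OF presented_group_circuits presented_group_circuits matroid_hom_keys matroid_hom_circuit_relation])

lemma H1_map_hom: "H1_map N f \<in> hom (H1 M) (H1 N)"
  unfolding H1_map_def[abs_def] H1_def circuit_subgroup_def
  by (rule presented_induced_hom[OF presented_group_circuits presented_group_circuits matroid_hom_keys matroid_hom_circuit_relation])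

lemma id_hom_F2_add: "id \<in> hom F2_add F2_add"
  by (simp add: hom_def)

lemma H1_F2_map_hom: "H1_F2_map N f \<in> hom (H1_tensor_group M) (H1_tensor_group N)"
  unfolding H1_F2_map_def F2_add_def[symmetric] H1_tensor_group_def
  by (rule tensor_map_hom[OF monoid_H1 monoid_F2_add monoid_H1 monoid_F2_add H1_map_hom id_hom_F2_add])

lemma H1_F2_map_vec:
  assumes e: "e \<in> ground M"
  shows "H1_F2_map N f (H1_F2_vec M e) = H1_F2_vec N (f e)"
proof -
  have "H1_class M (frag_of e) \<in> carrier (H1 M)" using e by (intro H1_class_closed) simp
  then have k: "Poly_Mapping.keys (frag_of (H1_class M (frag_of e), 1 :: bit)) \<subseteq> carrier (H1 M) \<times> carrier F2_add"
    by simp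
  have "H1_F2_map N f (H1_F2_vec M e) = H1_tensor N (H1_map N f (H1_class M (frag_of e))) 1"
    unfolding H1_F2_map_def F2_add_def[symmetric] H1_F2_vec_def H1_tensor_def
      tensor_map_class[OF monoid_H1 monoid_F2_add monoid_H1 monoid_F2_add H1_map_hom id_hom_F2_add k]
    by (simp only: frag_extend_of prod.case id_apply)
  also have "H1_map N f (H1_class M (frag_of e)) = H1_class N (frag_of (f e))"
    using H1_map_H1_class[of "frag_of e"] e by simp
  finally show ?thesis by (simp only: H1_F2_vec_def)
qed

lemma linear_map_H1_F2_map: "linear_map F2 (H1_F2 M) (H1_F2 N) (H1_F2_map N f)"
  unfolding linear_map_F2_iff[OF F2_space_H1_F2 F2_space_H1_F2] H1_F2_simps
  using hom_in_carrier[OF H1_F2_map_hom] hom_mult[OF H1_F2_map_hom] by simp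

end

text \<open>The vectors of the ground set span homology, so equations between linear maps, in
  particular functor laws and naturality, are checked on single elements.\<close>

lemma linear_map_H1_F2_eq:
  assumes mat: "is_matroid M" and W: "F2_space W"
    and g: "linear_map F2 (H1_F2 M) W g" and h: "linear_map F2 (H1_F2 M) W h"
    and eq: "\<And>e. e \<in> ground M \<Longrightarrow> g (H1_F2_vec M e) = h (H1_F2_vec M e)" and x: "x \<in> carrier (H1_F2 M)"
  shows "g x = h x"
proof -
  interpret H: F2_family "H1_F2 M" "ground M" "H1_F2_vec M" by (rule F2_family_H1_F2_vec[OF mat])
  interpret W: F2_space W by fact
  obtain T where T: "T \<subseteq> ground M" "x = finsum (H1_F2 M) (H1_F2_vec M) T"
    using x unfolding F2_span_H1_F2_vec[OF mat, symmetric] F2_span_def by blast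
  have lin: "k x = finsum W (\<lambda>e. k (H1_F2_vec M e)) T" if "linear_map F2 (H1_F2 M) W k" for k
    unfolding T(2) using T(1) H.\<rho>_closed H.finite_subset_E[OF T(1)]
    by (intro finsum_linear[OF H.F2_space_axioms W that]) auto
  have "h (H1_F2_vec M e) \<in> carrier W" if "e \<in> T" for e
    using h[unfolded linear_map_F2_iff[OF H.F2_space_axioms W]] H.\<rho>_closed that T(1) by (auto simp: Pi_iff)
  then have "finsum W (\<lambda>e. g (H1_F2_vec M e)) T = finsum W (\<lambda>e. h (H1_F2_vec M e)) T"
    using eq T(1) by (intro W.finsum_cong') auto
  then show ?thesis using lin[OF g] lin[OF h] by simp
qed

text \<open>A basis of the source is mapped to an independent set of the same size, which spans the target.\<close>

lemma linear_iso_H1_F2_map: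
  assumes M: "M \<in> binary_matroids r" and N: "N \<in> binary_matroids r" and hom: "matroid_hom M N f"
  shows "linear_iso (H1_F2 M) (H1_F2 N) (H1_F2_map N f)"
proof -
  note M' = binary_matroids_H1_F2[OF M] and N' = binary_matroids_H1_F2[OF N]
  interpret HM: F2_family "H1_F2 M" "ground M" "H1_F2_vec M" by (rule M'(3))
  interpret HN: F2_family "H1_F2 N" "ground N" "H1_F2_vec N" by (rule N'(3))
  let ?g = "H1_F2_map N f"
  note lin = linear_map_H1_F2_map[OF M'(1) hom]
  note g = lin[unfolded linear_map_F2_iff[OF HM.F2_space_axioms HN.F2_space_axioms]]
  have f: "f \<in> ground M \<rightarrow> ground N" "inj_on f (ground M)" "\<And>S. S \<subseteq> ground M \<Longrightarrow> S \<in> indep M \<longleftrightarrow> f ` S \<in> indep N"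
    using hom by (auto simp: matroid_hom_def)
  obtain S where S: "S \<subseteq> ground M" "F2_free (H1_F2 M) (H1_F2_vec M) S" "card S = matroid_rank M"
    using HM.maximal_free_subset M'(4) by metis
  have "S \<in> indep (family_matroid (H1_F2 M) (ground M) (H1_F2_vec M))" using S by (simp add: family_matroid_def)
  then have "S \<in> indep M" by (simp only: M'(4))
  then have "f ` S \<in> indep (family_matroid (H1_F2 N) (ground N) (H1_F2_vec N))" using f(3)[OF S(1)] by (simp only: N'(4))
  then have fS: "f ` S \<subseteq> ground N" "F2_free (H1_F2 N) (H1_F2_vec N) (f ` S)" by (auto simp: family_matroid_def)
  have "card (f ` S) = r"
    using card_image[OF inj_on_subset[OF f(2) S(1)]] S(3) M by (simp add: binary_matroids_def)
  then have "card (F2_span (H1_F2 N) (H1_F2_vec N) (f ` S)) = card (carrier (H1_F2 N))"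
    using HN.card_F2_span[OF fS] N'(2) by (simp add: F2_spaces_def)
  moreover have "F2_span (H1_F2 N) (H1_F2_vec N) (f ` S) \<subseteq> carrier (H1_F2 N)"
    using HN.finsum_family_closed fS(1) by (auto simp: F2_span_def)
  ultimately have full: "F2_span (H1_F2 N) (H1_F2_vec N) (f ` S) = carrier (H1_F2 N)"
    using F2_spaces_finite[OF N'(2)] card_subset_eq by blast
  have surj: "?g ` carrier (H1_F2 M) = carrier (H1_F2 N)"
  proof
    show "?g ` carrier (H1_F2 M) \<subseteq> carrier (H1_F2 N)" using g by auto
    show "carrier (H1_F2 N) \<subseteq> ?g ` carrier (H1_F2 M)"
    proof
      fix y assume "y \<in> carrier (H1_F2 N)"
      then obtain T where T: "T \<subseteq> f ` S" "y = finsum (H1_F2 N) (H1_F2_vec N) T"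
        unfolding full[symmetric] F2_span_def by blast
      obtain T' where T': "T' \<subseteq> S" "T = f ` T'" using T(1) by (auto simp: subset_image_iff)
      have T'M: "T' \<subseteq> ground M" using T'(1) S(1) by blast
      have "?g (finsum (H1_F2 M) (H1_F2_vec M) T') = finsum (H1_F2 N) (\<lambda>e. ?g (H1_F2_vec M e)) T'"
        using T'M HM.\<rho>_closed HM.finite_subset_E[OF T'M]
        by (intro finsum_linear[OF HM.F2_space_axioms HN.F2_space_axioms lin]) auto
      also have "\<dots> = finsum (H1_F2 N) (\<lambda>e. H1_F2_vec N (f e)) T'"
        using T'M f(1) HN.\<rho>_closed H1_F2_map_vec[OF M'(1) hom] by (intro HN.finsum_cong') (auto simp: Pi_iff subset_iff)
      also have "\<dots> = y"
        unfolding T(2) T'(2) using T'M f HN.\<rho>_closed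
        by (intro HN.finsum_reindex[symmetric]) (auto intro: inj_on_subset simp: Pi_iff subset_iff)
      finally show "y \<in> ?g ` carrier (H1_F2 M)" using HM.finsum_family_closed[OF T'M] by blast
    qed
  qed
  \<comment> \<open>A surjection between finite sets with \<open>2 ^ r\<close> elements each is
    injective.\<close>
  have "inj_on ?g (carrier (H1_F2 M))"
    using surj M'(2) N'(2) F2_spaces_finite[OF M'(2)] by (intro eq_card_imp_inj_on) (auto simp: F2_spaces_def)
  then show ?thesis using surj lin by (simp only: linear_iso_def bij_betw_def simp_thms)
qed


section \<open>Concrete categories, functors and transformations\<close>

text \<open>The assumption \<open>hom_cong\<close> allows a function to be changed off the
  underlying set, as the extensional representatives of morphisms require.\<close>

locale concrete_category =
  fixes obs :: "'o set" and und :: "'o \<Rightarrow> 'a set" and P :: "'o \<Rightarrow> 'o \<Rightarrow> ('a \<Rightarrow> 'a) \<Rightarrow> bool"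
  assumes hom_maps: "x \<in> obs \<Longrightarrow> y \<in> obs \<Longrightarrow> P x y f \<Longrightarrow> f \<in> und x \<rightarrow> und y"
    and hom_id: "x \<in> obs \<Longrightarrow> P x x (\<lambda>v. v)"
    and hom_comp: "x \<in> obs \<Longrightarrow> y \<in> obs \<Longrightarrow> z \<in> obs \<Longrightarrow> P x y f \<Longrightarrow> P y z g \<Longrightarrow> P x z (g \<circ> f)"
    and hom_cong: "x \<in> obs \<Longrightarrow> y \<in> obs \<Longrightarrow> P x y f \<Longrightarrow> (\<And>v. v \<in> und x \<Longrightarrow> f v = g v) \<Longrightarrow> P x y g"
begin

abbreviation "cat \<equiv> concrete_cat obs und P"

lemma Ob_cat [simp]: "Ob cat = obs"
  and Mor_cat [simp]: "(x, f, y) \<in> Mor cat \<longleftrightarrow> x \<in> obs \<and> y \<in> obs \<and> f \<in> extensional (und x) \<and> P x y f"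
  and Dom_cat [simp]: "Dom cat (x, f, y) = x"
  and Cod_cat [simp]: "Cod cat (x, f, y) = y"
  and Id_cat [simp]: "Id cat x = (x, restrict id (und x), x)"
  and Comp_cat [simp]: "Comp cat (y', g, z) (x, f, y) = (x, compose (und x) g f, z)"
  by (simp_all add: concrete_cat_def)

lemma hom_restrict: "x \<in> obs \<Longrightarrow> y \<in> obs \<Longrightarrow> P x y f \<Longrightarrow> P x y (restrict f (und x))"
  by (rule hom_cong) auto

lemma hom_compose: "x \<in> obs \<Longrightarrow> y \<in> obs \<Longrightarrow> z \<in> obs \<Longrightarrow> P x y f \<Longrightarrow> P y z g \<Longrightarrow> P x z (compose (und x) g f)"
  by (rule hom_cong[of x z "g \<circ> f"]) (auto simp: compose_def intro: hom_comp[of x y z])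

lemma small_category_cat: "small_category cat"
proof
  show "f \<in> Mor cat \<Longrightarrow> Dom cat f \<in> Ob cat" "f \<in> Mor cat \<Longrightarrow> Cod cat f \<in> Ob cat" for f
    by (cases f; simp)+
  show "Id cat x \<in> Mor cat" "Dom cat (Id cat x) = x" "Cod cat (Id cat x) = x" if "x \<in> Ob cat" for x
    using that hom_restrict[OF _ _ hom_id] by (auto simp: id_def)
  fix f g assume "f \<in> Mor cat" "g \<in> Mor cat" "Cod cat f = Dom cat g"
  then show "Comp cat g f \<in> Mor cat" "Dom cat (Comp cat g f) = Dom cat f" "Cod cat (Comp cat g f) = Cod cat g"
    by (cases f; cases g; auto intro: hom_compose)+
next
  fix f assume "f \<in> Mor cat"
  moreover obtain x u y where f: "f = (x, u, y)" by (cases f)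
  ultimately have "x \<in> obs" "y \<in> obs" "u \<in> extensional (und x)" "P x y u" "u \<in> und x \<rightarrow> und y"
    using hom_maps by auto
  then show "Comp cat f (Id cat (Dom cat f)) = f" "Comp cat (Id cat (Cod cat f)) f = f"
    unfolding f by (auto simp: compose_def fun_eq_iff extensional_def Pi_iff restrict_def)
next
  fix f g h assume "f \<in> Mor cat" "g \<in> Mor cat" "h \<in> Mor cat" "Cod cat f = Dom cat g" "Cod cat g = Dom cat h"
  moreover obtain x u y y' u' z z' u'' w where "f = (x, u, y)" "g = (y', u', z)" "h = (z', u'', w)"
    by (cases f; cases g; cases h)
  ultimately show "Comp cat h (Comp cat g f) = Comp cat (Comp cat h g) f"
    using hom_maps[of x y u] by (auto simp: compose_def fun_eq_iff Pi_iff restrict_def)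
qed

end

text \<open>In \<open>fm_id\<close> and \<open>fm_comp\<close> the argument is only pointwise equal
  to the identity or the composite, because the actual morphisms are built with
  \<open>restrict\<close> and \<open>compose\<close>.\<close>

locale concrete_functor =
  C: concrete_category obs und P + D: concrete_category obs' und' P'
  for obs :: "'o set" and und :: "'o \<Rightarrow> 'a set" and P and obs' :: "'p set" and und' :: "'p \<Rightarrow> 'b set" and P' +
  fixes Fo :: "'o \<Rightarrow> 'p" and fm :: "'o \<Rightarrow> 'o \<Rightarrow> ('a \<Rightarrow> 'a) \<Rightarrow> 'b \<Rightarrow> 'b"
  assumes Fo_obs: "x \<in> obs \<Longrightarrow> Fo x \<in> obs'"
    and fm_hom: "x \<in> obs \<Longrightarrow> y \<in> obs \<Longrightarrow> P x y f \<Longrightarrow> P' (Fo x) (Fo y) (fm x y f)"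
    and fm_id: "x \<in> obs \<Longrightarrow> v \<in> und' (Fo x) \<Longrightarrow> P x x f \<Longrightarrow> (\<And>u. u \<in> und x \<Longrightarrow> f u = u) \<Longrightarrow> fm x x f v = v"
    and fm_comp: "x \<in> obs \<Longrightarrow> y \<in> obs \<Longrightarrow> z \<in> obs \<Longrightarrow> P x y f \<Longrightarrow> P y z g \<Longrightarrow> P x z h \<Longrightarrow>
      (\<And>u. u \<in> und x \<Longrightarrow> h u = g (f u)) \<Longrightarrow> v \<in> und' (Fo x) \<Longrightarrow> fm x z h v = fm y z g (fm x y f v)"
begin

definition Fmor :: "'o \<times> ('a \<Rightarrow> 'a) \<times> 'o \<Rightarrow> 'p \<times> ('b \<Rightarrow> 'b) \<times> 'p" where
  "Fmor = (\<lambda>(x, f, y). (Fo x, restrict (fm x y f) (und' (Fo x)), Fo y))"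

lemma cat_functor_Fmor: "cat_functor C.cat D.cat Fo Fmor"
proof (intro cat_functor.intro cat_functor_axioms.intro C.small_category_cat D.small_category_cat)
  show "Fo x \<in> Ob D.cat" if "x \<in> Ob C.cat" for x using that Fo_obs by simp
  fix f assume "f \<in> Mor C.cat"
  moreover obtain x u y where f: "f = (x, u, y)" by (cases f)
  ultimately have "x \<in> obs" "y \<in> obs" "P x y u" by auto
  then show "Fmor f \<in> Mor D.cat" "Dom D.cat (Fmor f) = Fo (Dom C.cat f)" "Cod D.cat (Fmor f) = Fo (Cod C.cat f)"
    by (simp_all add: f Fmor_def Fo_obs D.hom_restrict fm_hom)
next
  fix x assume "x \<in> Ob C.cat"
  then have x: "x \<in> obs" by simp
  have "fm x x (restrict id (und x)) v = v" if "v \<in> und' (Fo x)" for v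
    by (rule fm_id[OF x that C.hom_restrict[OF x x]]) (use C.hom_id[OF x] in \<open>auto simp: id_def\<close>)
  then show "Fmor (Id C.cat x) = Id D.cat (Fo x)"
    by (auto simp: Fmor_def fun_eq_iff restrict_def)
next
  fix f g assume fg: "f \<in> Mor C.cat" "g \<in> Mor C.cat" "Cod C.cat f = Dom C.cat g"
  obtain x u y y' u' z where f: "f = (x, u, y)" "g = (y', u', z)" by (cases f; cases g)
  then have c: "x \<in> obs" "y \<in> obs" "z \<in> obs" "P x y u" "P y z u'" and y: "y' = y" using fg by auto
  have "fm x z (compose (und x) u' u) v = fm y z u' (fm x y u v)" if "v \<in> und' (Fo x)" for v
    by (rule fm_comp[OF c C.hom_compose[OF c] _ that]) (simp add: compose_def)
  moreover have "fm x y u v \<in> und' (Fo y)" if "v \<in> und' (Fo x)" for v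
    using D.hom_maps[OF Fo_obs[OF c(1)] Fo_obs[OF c(2)] fm_hom[OF c(1,2,4)]] that by auto
  ultimately show "Fmor (Comp C.cat g f) = Comp D.cat (Fmor g) (Fmor f)"
    by (auto simp: f y Fmor_def fun_eq_iff restrict_def compose_def)
qed

end

text \<open>The inner \<open>restrict\<close> makes the morphism part literally the composite of the
  two functions \<open>Fmor\<close>, so that unfolding identifies them.\<close>

lemma concrete_functor_compose:
  assumes "concrete_functor obs und P obs' und' P' Fo fm" "concrete_functor obs' und' P' obs'' und'' P'' Go gm"
  shows "concrete_functor obs und P obs'' und'' P'' (Go \<circ> Fo) (\<lambda>x y f. gm (Fo x) (Fo y) (restrict (fm x y f) (und' (Fo x))))"
proof -
  interpret F: concrete_functor obs und P obs' und' P' Fo fm by fact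
  interpret G: concrete_functor obs' und' P' obs'' und'' P'' Go gm by fact
  have hom: "P' (Fo x) (Fo y) (restrict (fm x y f) (und' (Fo x)))" if "x \<in> obs" "y \<in> obs" "P x y f" for x y f
    by (intro F.D.hom_restrict F.Fo_obs F.fm_hom that)
  show ?thesis
  proof
    show "(Go \<circ> Fo) x \<in> obs''" if "x \<in> obs" for x using that F.Fo_obs G.Fo_obs by simp
    fix x y f assume "x \<in> obs" "y \<in> obs" "P x y f"
    then show "P'' ((Go \<circ> Fo) x) ((Go \<circ> Fo) y) (gm (Fo x) (Fo y) (restrict (fm x y f) (und' (Fo x))))"
      using hom F.Fo_obs G.fm_hom by simp
  next
    fix x v f assume x: "x \<in> obs" "v \<in> und'' ((Go \<circ> Fo) x)" "P x x f" "\<And>u. u \<in> und x \<Longrightarrow> f u = u"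
    show "gm (Fo x) (Fo x) (restrict (fm x x f) (und' (Fo x))) v = v"
      using x F.fm_id[OF x(1) _ x(3,4)] by (intro G.fm_id F.Fo_obs hom) auto
  next
    fix x y z f g h v
    assume c: "x \<in> obs" "y \<in> obs" "z \<in> obs" "P x y f" "P y z g" "P x z h"
      "\<And>u. u \<in> und x \<Longrightarrow> h u = g (f u)" and v: "v \<in> und'' ((Go \<circ> Fo) x)"
    have "fm x y f u \<in> und' (Fo y)" if "u \<in> und' (Fo x)" for u
      using F.D.hom_maps[OF F.Fo_obs[OF c(1)] F.Fo_obs[OF c(2)] F.fm_hom[OF c(1,2,4)]] that by auto
    then show "gm (Fo x) (Fo z) (restrict (fm x z h) (und' (Fo x))) v =
        gm (Fo y) (Fo z) (restrict (fm y z g) (und' (Fo y))) (gm (Fo x) (Fo y) (restrict (fm x y f) (und' (Fo x))) v)"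
      using c v F.fm_comp[OF c] by (intro G.fm_comp F.Fo_obs hom) auto
  qed
qed

lemma concrete_functor_id:
  assumes "concrete_category obs und P"
  shows "concrete_functor obs und P obs und P id (\<lambda>x y f. f)"
proof -
  interpret concrete_category obs und P by fact
  show ?thesis by unfold_locales auto
qed

locale concrete_transformation =
  p: concrete_functor obs und P obs' und' P' Po pm + q: concrete_functor obs und P obs' und' P' Qo qm
  for obs :: "'o set" and und :: "'o \<Rightarrow> 'a set" and P and obs' :: "'p set" and und' :: "'p \<Rightarrow> 'b set" and P'
    and Po pm Qo qm +
  fixes a :: "'o \<Rightarrow> 'b \<Rightarrow> 'b"
  assumes a_hom: "x \<in> obs \<Longrightarrow> P' (Po x) (Qo x) (a x)"
    and a_natural: "x \<in> obs \<Longrightarrow> y \<in> obs \<Longrightarrow> P x y f \<Longrightarrow> v \<in> und' (Po x) \<Longrightarrow> a y (pm x y f v) = qm x y f (a x v)"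
begin

lemma natural_transformation:
  "natural_transformation p.C.cat p.D.cat Po p.Fmor Qo q.Fmor (\<lambda>x. (Po x, restrict (a x) (und' (Po x)), Qo x))"
proof (intro natural_transformation.intro natural_transformation_axioms.intro p.cat_functor_Fmor q.cat_functor_Fmor)
  fix x assume "x \<in> Ob p.C.cat"
  then show "(Po x, restrict (a x) (und' (Po x)), Qo x) \<in> Mor p.D.cat"
    "Dom p.D.cat (Po x, restrict (a x) (und' (Po x)), Qo x) = Po x"
    "Cod p.D.cat (Po x, restrict (a x) (und' (Po x)), Qo x) = Qo x"
    by (simp_all add: p.Fo_obs q.Fo_obs p.D.hom_restrict a_hom)
next
  fix f assume "f \<in> Mor p.C.cat"
  moreover obtain x u y where f: "f = (x, u, y)" by (cases f)
  ultimately have c: "x \<in> obs" "y \<in> obs" "P x y u" by auto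
  have "pm x y u v \<in> und' (Po y)" "a x v \<in> und' (Qo x)" if "v \<in> und' (Po x)" for v
    using p.D.hom_maps[OF p.Fo_obs[OF c(1)] p.Fo_obs[OF c(2)] p.fm_hom[OF c]]
      p.D.hom_maps[OF p.Fo_obs[OF c(1)] q.Fo_obs[OF c(1)] a_hom[OF c(1)]] that by auto
  then show "Comp p.D.cat (Po (Cod p.C.cat f), restrict (a (Cod p.C.cat f)) (und' (Po (Cod p.C.cat f))), Qo (Cod p.C.cat f)) (p.Fmor f) =
      Comp p.D.cat (q.Fmor f) (Po (Dom p.C.cat f), restrict (a (Dom p.C.cat f)) (und' (Po (Dom p.C.cat f))), Qo (Dom p.C.cat f))"
    using a_natural[OF c] by (auto simp: f p.Fmor_def q.Fmor_def fun_eq_iff restrict_def compose_def)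
qed

lemmas homotopic = natural_transformation.homotopic_classifying_maps[OF natural_transformation]

end


section \<open>The functors between matroids and vector spaces\<close>

lemma binary_matroid_cat_eq: "binary_matroid_cat r = concrete_cat (binary_matroids r) ground matroid_hom"
  by (simp add: binary_matroid_cat_def binary_matroids_def)

lemma Gl_cat_eq: "Gl_cat r = concrete_cat (F2_spaces r) carrier linear_iso"
  unfolding Gl_cat_def linear_iso_module_vec_iff F2_spaces_def by (rule refl)

lemma concrete_category_matroids: "concrete_category (binary_matroids r) ground matroid_hom"
proof
  show "matroid_hom M N f \<Longrightarrow> f \<in> ground M \<rightarrow> ground N" for M N :: "'a matroid" and f
    by (simp add: matroid_hom_def)
  show "matroid_hom M M (\<lambda>v. v)" for M :: "'a matroid"
    by (simp add: matroid_hom_def)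
next
  fix K M N :: "'a matroid" and f g assume fg: "matroid_hom K M f" "matroid_hom M N g"
  show "matroid_hom K N (g \<circ> f)"
    unfolding matroid_hom_def
  proof (intro conjI allI impI)
    show "g \<circ> f \<in> ground K \<rightarrow> ground N" using fg by (auto simp: matroid_hom_def)
    show "inj_on (g \<circ> f) (ground K)"
      using fg by (intro comp_inj_on) (auto simp: matroid_hom_def Pi_iff intro: inj_on_subset)
    fix S assume S: "S \<subseteq> ground K"
    then have "f ` S \<subseteq> ground M" using fg(1) by (auto simp: matroid_hom_def Pi_iff)
    then show "S \<in> indep K \<longleftrightarrow> (g \<circ> f) ` S \<in> indep N"
      using fg S unfolding matroid_hom_def by (simp add: image_comp)
  qed
next
  fix M N :: "'a matroid" and f g assume f: "matroid_hom M N f" and eq: "\<And>v. v \<in> ground M \<Longrightarrow> f v = g v"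
  have im: "g ` S = f ` S" if "S \<subseteq> ground M" for S
    using that eq by (intro image_cong) auto
  have "inj_on g (ground M) = inj_on f (ground M)" by (rule inj_on_cong) (simp add: eq)
  then show "matroid_hom M N g"
    using f im eq by (auto simp: matroid_hom_def Pi_iff)
qed

lemma concrete_category_spaces: "concrete_category (F2_spaces r) carrier linear_iso"
proof
  show "linear_iso V W f \<Longrightarrow> f \<in> carrier V \<rightarrow> carrier W" for V W :: "(bit, 'a) module" and f
    by (rule linear_isoD)
  show "V \<in> F2_spaces r \<Longrightarrow> linear_iso V V (\<lambda>v. v)" for V :: "(bit, 'a) module"
    by (rule linear_iso_id) (simp add: F2_spaces_def)
  show "linear_iso U V f \<Longrightarrow> linear_iso V W g \<Longrightarrow> linear_iso U W (g \<circ> f)" for U V W :: "(bit, 'a) module" and f g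
    by (rule linear_iso_compose)
  show "linear_iso V W f \<Longrightarrow> (\<And>v. v \<in> carrier V \<Longrightarrow> f v = g v) \<Longrightarrow> linear_iso V W g" for V W :: "(bit, 'a) module" and f g
    by (rule linear_iso_cong)
qed

text \<open>The functor laws are compared on ground elements, where an induced map sends the vector
  of \<open>e\<close> to that of its image.\<close>

lemma concrete_functor_H1_F2:
  "concrete_functor (binary_matroids r) ground matroid_hom (F2_spaces r) carrier linear_iso H1_F2 (\<lambda>M N. H1_F2_map N)"
proof (intro concrete_functor.intro concrete_functor_axioms.intro concrete_category_matroids concrete_category_spaces)
  show "M \<in> binary_matroids r \<Longrightarrow> H1_F2 M \<in> F2_spaces r" for M :: "'a matroid"
    by (rule binary_matroids_H1_F2)
  show "M \<in> binary_matroids r \<Longrightarrow> N \<in> binary_matroids r \<Longrightarrow> matroid_hom M N f \<Longrightarrow>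
      linear_iso (H1_F2 M) (H1_F2 N) (H1_F2_map N f)" for M N :: "'a matroid" and f
    by (rule linear_iso_H1_F2_map)
next
  fix M :: "'a matroid" and v f
  assume M: "M \<in> binary_matroids r" and v: "v \<in> carrier (H1_F2 M)" and f: "matroid_hom M M f" "\<And>u. u \<in> ground M \<Longrightarrow> f u = u"
  note mat = binary_matroids_H1_F2(1)[OF M]
  show "H1_F2_map M f v = v"
    by (rule linear_map_H1_F2_eq[OF mat F2_space_H1_F2 linear_map_H1_F2_map[OF mat f(1)]
          linear_isoD(3)[OF linear_iso_id[OF F2_space_H1_F2]] _ v])
      (simp add: H1_F2_map_vec[OF mat f(1)] f(2))
next
  fix K M N :: "'a matroid" and f g h v
  assume obs: "K \<in> binary_matroids r" "M \<in> binary_matroids r" "N \<in> binary_matroids r"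
    and hom: "matroid_hom K M f" "matroid_hom M N g" "matroid_hom K N h" "\<And>u. u \<in> ground K \<Longrightarrow> h u = g (f u)"
    and v: "v \<in> carrier (H1_F2 K)"
  note mK = binary_matroids_H1_F2(1)[OF obs(1)] and mM = binary_matroids_H1_F2(1)[OF obs(2)]
  have "linear_map F2 (H1_F2 K) (H1_F2 N) (H1_F2_map N g \<circ> H1_F2_map M f)"
    by (rule linear_isoD(3)[OF linear_iso_compose[OF linear_iso_H1_F2_map[OF obs(1,2) hom(1)] linear_iso_H1_F2_map[OF obs(2,3) hom(2)]]])
  from linear_map_H1_F2_eq[OF mK F2_space_H1_F2 linear_map_H1_F2_map[OF mK hom(3)] this _ v]
  show "H1_F2_map N h v = H1_F2_map N g (H1_F2_map M f v)"
    using hom(1) by (simp add: H1_F2_map_vec[OF mK hom(3)] H1_F2_map_vec[OF mK hom(1)] H1_F2_map_vec[OF mM hom(2)] hom(4) matroid_hom_def Pi_iff)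
qed

section \<open>The functor from spaces to matroids\<close>

text \<open>Ground sets are to be sets of natural numbers, hence vectors enter a matroid through a
  numbering; \<open>space_nth\<close> decodes it.\<close>

definition space_enum :: "(bit, 'v) module \<Rightarrow> 'v \<Rightarrow> nat" where
  "space_enum V = to_nat_on (carrier V)"

definition space_nth :: "(bit, 'v) module \<Rightarrow> nat \<Rightarrow> 'v" where
  "space_nth V = from_nat_into (carrier V)"

lemma space_nth_enum [simp]: "V \<in> F2_spaces r \<Longrightarrow> v \<in> carrier V \<Longrightarrow> space_nth V (space_enum V v) = v"
  unfolding space_nth_def space_enum_def using F2_spaces_finite countable_finite from_nat_into_to_nat_on by metis

lemma inj_on_space_enum: "V \<in> F2_spaces r \<Longrightarrow> inj_on (space_enum V) (carrier V)"
  by (rule inj_on_inverseI[where g = "space_nth V"]) simp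

definition space_matroid :: "(bit, 'v) module \<Rightarrow> nat matroid" where
  "space_matroid V = family_matroid V (space_enum V ` carrier V) (space_nth V)"

lemma ground_space_matroid [simp]: "ground (space_matroid V) = space_enum V ` carrier V"
  by (simp add: space_matroid_def family_matroid_def)

lemma F2_family_space:
  assumes "V \<in> F2_spaces r"
  shows "F2_family V (space_enum V ` carrier V) (space_nth V)"
    "F2_span V (space_nth V) (space_enum V ` carrier V) = carrier V"
proof -
  interpret F2_space V using assms by (simp add: F2_spaces_def)
  show "F2_family V (space_enum V ` carrier V) (space_nth V)"
    by unfold_locales (use F2_spaces_finite[OF assms] assms in auto)
  then interpret F2_family V "space_enum V ` carrier V" "space_nth V" .
  have "v \<in> F2_span V (space_nth V) (space_enum V ` carrier V)" if "v \<in> carrier V" for v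
    using in_F2_span_self[of "space_enum V v" "space_enum V ` carrier V"] that assms by simp
  then show "F2_span V (space_nth V) (space_enum V ` carrier V) = carrier V"
    using finsum_family_closed by (auto simp: F2_span_def)
qed

lemma space_matroid_in_binary_matroids: "V \<in> F2_spaces r \<Longrightarrow> space_matroid V \<in> binary_matroids r"
  unfolding space_matroid_def by (rule family_matroid_in_binary_matroids[OF F2_family_space])

lemma concrete_functor_space_matroid:
  "concrete_functor (F2_spaces r) carrier linear_iso (binary_matroids r) ground matroid_hom space_matroid
     (\<lambda>V W g n. space_enum W (g (space_nth V n)))"
proof (intro concrete_functor.intro concrete_functor_axioms.intro concrete_category_matroids concrete_category_spaces)
  show "V \<in> F2_spaces r \<Longrightarrow> space_matroid V \<in> binary_matroids r" for V :: "(bit, 'a) module"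
    by (rule space_matroid_in_binary_matroids)
next
  fix V W :: "(bit, 'a) module" and g assume V: "V \<in> F2_spaces r" and W: "W \<in> F2_spaces r" and g: "linear_iso V W g"
  note g' = linear_isoD[OF g]
  have inj: "inj_on (\<lambda>n. space_enum W (g (space_nth V n))) (space_enum V ` carrier V)"
  proof (rule inj_onI; clarify)
    fix v w assume vw: "v \<in> carrier V" "w \<in> carrier V"
      "space_enum W (g (space_nth V (space_enum V v))) = space_enum W (g (space_nth V (space_enum V w)))"
    then have "g v = g w" using inj_onD[OF inj_on_space_enum[OF W]] g'(4) V by (auto simp: Pi_iff)
    then show "space_enum V v = space_enum V w" using inj_onD[OF g'(5)] vw by auto
  qed
  show "matroid_hom (space_matroid V) (space_matroid W) (\<lambda>n. space_enum W (g (space_nth V n)))"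
    unfolding space_matroid_def
    by (rule matroid_hom_family_matroid[OF F2_family_space(1)[OF V] F2_family_space(1)[OF W] g'(3,5) _ inj])
      (use V W g'(4) in \<open>auto simp: Pi_iff\<close>)
next
  fix V :: "(bit, 'a) module" and n f
  assume "V \<in> F2_spaces r" "n \<in> ground (space_matroid V)" "\<And>u. u \<in> carrier V \<Longrightarrow> f u = u"
  then show "space_enum V (f (space_nth V n)) = n" by auto
next
  fix U V W :: "(bit, 'a) module" and f g h :: "'a \<Rightarrow> 'a" and n
  assume obs: "U \<in> F2_spaces r" "V \<in> F2_spaces r" and f: "linear_iso U V f"
    and h: "\<And>u. u \<in> carrier U \<Longrightarrow> h u = g (f u)" and n: "n \<in> ground (space_matroid U)"
  then show "space_enum W (h (space_nth U n)) = space_enum W (g (space_nth V (space_enum V (f (space_nth U n)))))"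
    using linear_isoD(4)[OF f] by (auto simp: Pi_iff)
qed

text \<open>The natural map from a matroid to the matroid of its homology is not injective on parallel elements,
  so the identity and the composite functor are linked through the disjoint union of both matroids:
  even numbers stand for the elements of the matroid, odd numbers for homology classes.\<close>

definition sum_ground :: "nat matroid \<Rightarrow> nat set" where
  "sum_ground M = (\<lambda>e. 2 * e) ` ground M \<union> (\<lambda>v. 2 * space_enum (H1_F2 M) v + 1) ` carrier (H1_F2 M)"

definition sum_vec :: "nat matroid \<Rightarrow> nat \<Rightarrow> nat H1_F2_elem" where
  "sum_vec M n = (if even n then H1_F2_vec M (n div 2) else space_nth (H1_F2 M) (n div 2))"

definition sum_matroid :: "nat matroid \<Rightarrow> nat matroid" where
  "sum_matroid M = family_matroid (H1_F2 M) (sum_ground M) (sum_vec M)"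

definition sum_matroid_map :: "nat matroid \<Rightarrow> nat matroid \<Rightarrow> (nat \<Rightarrow> nat) \<Rightarrow> nat \<Rightarrow> nat" where
  "sum_matroid_map M N f n =
     (if even n then 2 * f (n div 2)
      else 2 * space_enum (H1_F2 N) (H1_F2_map N f (space_nth (H1_F2 M) (n div 2))) + 1)"

lemma ground_sum_matroid [simp]: "ground (sum_matroid M) = sum_ground M"
  by (simp add: sum_matroid_def family_matroid_def)

lemma sum_vec_simps [simp]:
  "sum_vec M (2 * e) = H1_F2_vec M e" "sum_vec M (Suc (2 * n)) = space_nth (H1_F2 M) n"
  by (simp_all add: sum_vec_def)

lemma sum_matroid_map_simps [simp]:
  "sum_matroid_map M N f (2 * e) = 2 * f e"
  "sum_matroid_map M N f (Suc (2 * n)) = Suc (2 * space_enum (H1_F2 N) (H1_F2_map N f (space_nth (H1_F2 M) n)))"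
  by (simp_all add: sum_matroid_map_def)

text \<open>The odd half lists every homology class, so the family spans and the rank remains
  \<open>r\<close>.\<close>

lemma F2_family_sum:
  assumes "M \<in> binary_matroids r"
  shows "F2_family (H1_F2 M) (sum_ground M) (sum_vec M)"
    "F2_span (H1_F2 M) (sum_vec M) (sum_ground M) = carrier (H1_F2 M)"
proof -
  note M = binary_matroids_H1_F2[OF assms]
  interpret F2_family "H1_F2 M" "ground M" "H1_F2_vec M" by (rule M(3))
  show "F2_family (H1_F2 M) (sum_ground M) (sum_vec M)"
    by unfold_locales (use finite_E F2_spaces_finite[OF M(2)] \<rho>_closed M(2) in \<open>auto simp: sum_ground_def\<close>)
  then interpret S: F2_family "H1_F2 M" "sum_ground M" "sum_vec M" .
  have "v \<in> F2_span (H1_F2 M) (sum_vec M) (sum_ground M)" if "v \<in> carrier (H1_F2 M)" for v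
    using S.in_F2_span_self[of "Suc (2 * space_enum (H1_F2 M) v)" "sum_ground M"] that M(2) by (auto simp: sum_ground_def)
  then show "F2_span (H1_F2 M) (sum_vec M) (sum_ground M) = carrier (H1_F2 M)"
    using S.finsum_family_closed by (auto simp: F2_span_def)
qed

text \<open>Parity separates the two halves. On even numbers injectivity is that of
  \<open>f\<close>, on odd numbers that of the induced map on homology, which is bijective as both
  matroids have rank \<open>r\<close>.\<close>

lemma concrete_functor_sum_matroid:
  "concrete_functor (binary_matroids r) ground matroid_hom (binary_matroids r) ground matroid_hom
     sum_matroid sum_matroid_map"
proof (intro concrete_functor.intro concrete_functor_axioms.intro concrete_category_matroids)
  interpret F: concrete_functor "binary_matroids r :: nat matroid set" ground matroid_hom "F2_spaces r" carrier linear_iso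
      H1_F2 "\<lambda>M. H1_F2_map"
    by (rule concrete_functor_H1_F2)
  show "sum_matroid M \<in> binary_matroids r" if "M \<in> binary_matroids r" for M :: "nat matroid"
    unfolding sum_matroid_def
    by (rule family_matroid_in_binary_matroids[OF F2_family_sum[OF that] binary_matroids_H1_F2(2)[OF that]])
  {
    fix M N :: "nat matroid" and f assume M: "M \<in> binary_matroids r" and N: "N \<in> binary_matroids r" and f: "matroid_hom M N f"
    note g = linear_isoD[OF F.fm_hom[OF M N f]]
    have f': "f \<in> ground M \<rightarrow> ground N" "inj_on f (ground M)" using f by (auto simp: matroid_hom_def)
    note M' = binary_matroids_H1_F2[OF M] and N' = binary_matroids_H1_F2[OF N]
    have "inj_on (sum_matroid_map M N f) (sum_ground M)"
    proof (rule inj_onI)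
      fix x y assume xy: "x \<in> sum_ground M" "y \<in> sum_ground M" "sum_matroid_map M N f x = sum_matroid_map M N f y"
      have par: "even (sum_matroid_map M N f z) \<longleftrightarrow> even z" for z by (simp add: sum_matroid_map_def)
      have "even x \<longleftrightarrow> even y" using par[of x] par[of y] xy(3) by simp
      then consider e e' where "x = 2 * e" "y = 2 * e'" "e \<in> ground M" "e' \<in> ground M"
        | v w where "x = Suc (2 * space_enum (H1_F2 M) v)" "y = Suc (2 * space_enum (H1_F2 M) w)"
            "v \<in> carrier (H1_F2 M)" "w \<in> carrier (H1_F2 M)"
        using xy(1,2) by (auto simp: sum_ground_def)
      then show "x = y"
      proof cases
        case 1
        then show ?thesis using xy(3) inj_onD[OF f'(2), of e e'] by simp
      next
        case 2
        then have "H1_F2_map N f v = H1_F2_map N f w"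
          using xy(3) M'(2) inj_onD[OF inj_on_space_enum[OF N'(2)]] g(4) by (auto simp: Pi_iff)
        then show ?thesis using 2 inj_onD[OF g(5), of v w] by simp
      qed
    qed
    then show "matroid_hom (sum_matroid M) (sum_matroid N) (sum_matroid_map M N f)"
      unfolding sum_matroid_def
    proof (rule matroid_hom_family_matroid[OF F2_family_sum(1)[OF M] F2_family_sum(1)[OF N] g(3,5), rotated])
      show "sum_matroid_map M N f \<in> sum_ground M \<rightarrow> sum_ground N"
        using f'(1) g(4) M'(2) by (auto simp: sum_ground_def Pi_iff)
      show "sum_vec N (sum_matroid_map M N f e) = H1_F2_map N f (sum_vec M e)" if "e \<in> sum_ground M" for e
        using that g(4) M'(2) N'(2) by (auto simp: sum_ground_def Pi_iff H1_F2_map_vec[OF M'(1) f])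
    qed
  }
  fix M :: "nat matroid" assume M: "M \<in> binary_matroids r"
  note M' = binary_matroids_H1_F2[OF M]
  show "sum_matroid_map M M f n = n" if "n \<in> ground (sum_matroid M)" "matroid_hom M M f" "\<And>u. u \<in> ground M \<Longrightarrow> f u = u" for n f
    using that M'(2) F.fm_id[OF M _ that(2,3)] by (auto simp: sum_ground_def)
  fix N K :: "nat matroid" and f g h n
  assume N: "N \<in> binary_matroids r" and K: "K \<in> binary_matroids r"
    and hom: "matroid_hom M N f" "matroid_hom N K g" "matroid_hom M K h" and h: "\<And>u. u \<in> ground M \<Longrightarrow> h u = g (f u)"
    and n: "n \<in> ground (sum_matroid M)"
  have "H1_F2_map N f v \<in> carrier (H1_F2 N)" if "v \<in> carrier (H1_F2 M)" for v
    using linear_isoD(4)[OF F.fm_hom[OF M N hom(1)]] that by auto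
  then show "sum_matroid_map M K h n = sum_matroid_map N K g (sum_matroid_map M N f n)"
    using n h M'(2) binary_matroids_H1_F2(2)[OF N] F.fm_comp[OF M N K hom h] by (auto simp: sum_ground_def)
qed


lemma transformation_id_sum_matroid:
  "concrete_transformation (binary_matroids r) ground matroid_hom (binary_matroids r) ground matroid_hom
     id (\<lambda>M N f. f) sum_matroid sum_matroid_map (\<lambda>M e. 2 * e)"
proof (intro concrete_transformation.intro concrete_transformation_axioms.intro
    concrete_functor_id concrete_category_matroids concrete_functor_sum_matroid)
  fix M :: "nat matroid" assume M: "M \<in> binary_matroids r"
  note M' = binary_matroids_H1_F2[OF M]
  \<comment> \<open>With \<open>M\<close> rewritten as the matroid of its homology vectors, doubling
    lies over the identity of \<open>H1_F2 M\<close>.\<close>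
  have "matroid_hom (family_matroid (H1_F2 M) (ground M) (H1_F2_vec M)) (sum_matroid M) (\<lambda>e. 2 * e)"
    unfolding sum_matroid_def
    by (rule matroid_hom_family_matroid[OF M'(3) F2_family_sum(1)[OF M] linear_isoD(3,5)[OF linear_iso_id[OF F2_space_H1_F2]]])
      (auto simp: sum_ground_def inj_on_def)
  then show "matroid_hom (id M) (sum_matroid M) (\<lambda>e. 2 * e)" by (simp only: M'(4) id_apply)
qed simp

lemma concrete_functor_space_matroid_H1_F2:
  "concrete_functor (binary_matroids r) ground matroid_hom (binary_matroids r) ground matroid_hom
    (space_matroid \<circ> H1_F2)
    (\<lambda>M N f n. space_enum (H1_F2 N) (restrict (H1_F2_map N f) (carrier (H1_F2 M)) (space_nth (H1_F2 M) n)))"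
  using concrete_functor_compose[OF concrete_functor_H1_F2 concrete_functor_space_matroid] .

text \<open>The second leg of the zigzag also lies over the identity of homology: an odd number
  \<open>Suc (2 * n)\<close> carries the vector with number \<open>n\<close>.\<close>

lemma transformation_space_matroid_sum_matroid:
  "concrete_transformation (binary_matroids r) ground matroid_hom (binary_matroids r) ground matroid_hom
     (space_matroid \<circ> H1_F2)
     (\<lambda>M N f n. space_enum (H1_F2 N) (restrict (H1_F2_map N f) (carrier (H1_F2 M)) (space_nth (H1_F2 M) n)))
     sum_matroid sum_matroid_map (\<lambda>M n. Suc (2 * n))"
proof (intro concrete_transformation.intro concrete_transformation_axioms.intro
    concrete_functor_space_matroid_H1_F2 concrete_functor_sum_matroid)
  fix M :: "nat matroid" assume M: "M \<in> binary_matroids r"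
  note M' = binary_matroids_H1_F2[OF M]
  show "matroid_hom ((space_matroid \<circ> H1_F2) M) (sum_matroid M) (\<lambda>n. Suc (2 * n))"
    unfolding sum_matroid_def space_matroid_def o_apply
    by (rule matroid_hom_family_matroid[OF F2_family_space(1)[OF M'(2)] F2_family_sum(1)[OF M]
          linear_isoD(3,5)[OF linear_iso_id[OF F2_space_H1_F2]]])
      (auto simp: sum_ground_def inj_on_def)
  fix N :: "nat matroid" and f n assume "n \<in> ground ((space_matroid \<circ> H1_F2) M)"
  then show "Suc (2 * space_enum (H1_F2 N) (restrict (H1_F2_map N f) (carrier (H1_F2 M)) (space_nth (H1_F2 M) n))) =
      sum_matroid_map M N f (Suc (2 * n))"
    using M'(2) by auto
qed

text \<open>Selected by its values on the spanning vectors, which determine a linear map on the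
  carrier; this makes the choice natural.\<close>

definition homology_iso :: "(bit, 'v) module \<Rightarrow> nat H1_F2_elem \<Rightarrow> 'v" where
  "homology_iso V = (SOME g. linear_iso (H1_F2 (space_matroid V)) V g \<and>
     (\<forall>v\<in>carrier V. g (H1_F2_vec (space_matroid V) (space_enum V v)) = v))"

lemma homology_iso:
  assumes "V \<in> F2_spaces r"
  shows "linear_iso (H1_F2 (space_matroid V)) V (homology_iso V)"
    "v \<in> carrier V \<Longrightarrow> homology_iso V (H1_F2_vec (space_matroid V) (space_enum V v)) = v"
proof -
  interpret F2_family V "space_enum V ` carrier V" "space_nth V" by (rule F2_family_space(1)[OF assms])
  obtain g where g: "linear_iso (H1_F2 (space_matroid V)) V g"
    "\<And>n. n \<in> space_enum V ` carrier V \<Longrightarrow> g (H1_F2_vec (space_matroid V) n) = space_nth V n"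
    using H1_F2_linear_iso[OF F2_family_space(2)[OF assms]] unfolding space_matroid_def by blast
  have "\<exists>g. linear_iso (H1_F2 (space_matroid V)) V g \<and>
     (\<forall>v\<in>carrier V. g (H1_F2_vec (space_matroid V) (space_enum V v)) = v)"
    using g assms by auto
  from someI_ex[OF this, folded homology_iso_def]
  show "linear_iso (H1_F2 (space_matroid V)) V (homology_iso V)"
    "v \<in> carrier V \<Longrightarrow> homology_iso V (H1_F2_vec (space_matroid V) (space_enum V v)) = v" by auto
qed

lemma concrete_functor_H1_F2_space_matroid:
  "concrete_functor (F2_spaces r) carrier linear_iso (F2_spaces r) carrier linear_iso
    (H1_F2 \<circ> space_matroid)
    (\<lambda>V W g. H1_F2_map (space_matroid W) (restrict (\<lambda>n. space_enum W (g (space_nth V n))) (ground (space_matroid V))))"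
  using concrete_functor_compose[OF concrete_functor_space_matroid concrete_functor_H1_F2] .

text \<open>Both composites are linear and send the homology vector of \<open>v\<close> to
  \<open>g v\<close>, and such vectors span.\<close>

lemma transformation_homology_iso:
  "concrete_transformation (F2_spaces r) carrier linear_iso (F2_spaces r) carrier linear_iso
    (H1_F2 \<circ> space_matroid)
    (\<lambda>V W g. H1_F2_map (space_matroid W) (restrict (\<lambda>n. space_enum W (g (space_nth V n))) (ground (space_matroid V))))
    id (\<lambda>V W g. g) homology_iso"
proof (intro concrete_transformation.intro concrete_transformation_axioms.intro
    concrete_functor_H1_F2_space_matroid concrete_functor_id concrete_category_spaces)
  show "linear_iso ((H1_F2 \<circ> space_matroid) V) (id V) (homology_iso V)"
    if "V \<in> F2_spaces r" for V :: "(bit, nat H1_F2_elem) module"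
    using homology_iso(1)[OF that] by simp
next
  fix V W :: "(bit, nat H1_F2_elem) module" and g x
  assume V: "V \<in> F2_spaces r" and W: "W \<in> F2_spaces r" and g: "linear_iso V W g"
    and x: "x \<in> carrier ((H1_F2 \<circ> space_matroid) V)"
  let ?f = "restrict (\<lambda>n. space_enum W (g (space_nth V n))) (ground (space_matroid V))"
  interpret G: concrete_functor "F2_spaces r" carrier linear_iso "binary_matroids r" ground matroid_hom space_matroid
      "\<lambda>V W (g :: nat H1_F2_elem \<Rightarrow> _) n. space_enum W (g (space_nth V n))"
    by (rule concrete_functor_space_matroid)
  note V' = space_matroid_in_binary_matroids[OF V] and W' = space_matroid_in_binary_matroids[OF W]
  note mat = binary_matroids_H1_F2(1)[OF V']
  have f: "matroid_hom (space_matroid V) (space_matroid W) ?f"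
    by (rule G.D.hom_restrict[OF V' W' G.fm_hom[OF V W g]])
  have l1: "linear_map F2 (H1_F2 (space_matroid V)) W (homology_iso W \<circ> H1_F2_map (space_matroid W) ?f)"
    by (rule linear_isoD(3)[OF linear_iso_compose[OF linear_iso_H1_F2_map[OF V' W' f] homology_iso(1)[OF W]]])
  have l2: "linear_map F2 (H1_F2 (space_matroid V)) W (g \<circ> homology_iso V)"
    by (rule linear_isoD(3)[OF linear_iso_compose[OF homology_iso(1)[OF V] g]])
  have "(homology_iso W \<circ> H1_F2_map (space_matroid W) ?f) x = (g \<circ> homology_iso V) x"
  proof (rule linear_map_H1_F2_eq[OF mat linear_isoD(2)[OF g] l1 l2])
    show "x \<in> carrier (H1_F2 (space_matroid V))" using x by simp
    fix n assume n: "n \<in> ground (space_matroid V)"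
    then obtain v where v: "v \<in> carrier V" "n = space_enum V v" by auto
    have gv: "g v \<in> carrier W" using linear_isoD(4)[OF g] v by auto
    have "homology_iso W (H1_F2_map (space_matroid W) ?f (H1_F2_vec (space_matroid V) n)) =
        homology_iso W (H1_F2_vec (space_matroid W) (space_enum W (g v)))"
      unfolding H1_F2_map_vec[OF mat f n] by (simp only: v(2) restrict_apply'[OF n[unfolded v(2)]] space_nth_enum[OF V v(1)])
    also have "\<dots> = g v" by (rule homology_iso(2)[OF W gv])
    finally show "(homology_iso W \<circ> H1_F2_map (space_matroid W) ?f) (H1_F2_vec (space_matroid V) n) =
        (g \<circ> homology_iso V) (H1_F2_vec (space_matroid V) n)"
      by (simp only: o_apply v(2) homology_iso(2)[OF V v(1)])
  qed
  then show "homology_iso W (H1_F2_map (space_matroid W) ?f x) = g (homology_iso V x)" by simp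
qed

section \<open>From transformations to the homotopy equivalence\<close>

text \<open>Composites and identities are passed as functors of their own that have the right values
  on morphisms, since the concrete locales produce them as different terms.\<close>

lemma homotopy_equivalence_mapI:
  assumes F: "cat_functor C D Fo Fm" and G: "cat_functor D C Go Gm"
    and GF: "cat_functor C C GFo GFm" "\<And>f. f \<in> Mor C \<Longrightarrow> GFm f = Gm (Fm f)"
    and FG: "cat_functor D D FGo FGm" "\<And>f. f \<in> Mor D \<Longrightarrow> FGm f = Fm (Gm f)"
    and I: "cat_functor C C Io Ie" "\<And>f. f \<in> Mor C \<Longrightarrow> Ie f = f"
    and J: "cat_functor D D Jo Jm" "\<And>f. f \<in> Mor D \<Longrightarrow> Jm f = f"
    and hC: "homotopic_with (\<lambda>_. True) (classifying_space C) (classifying_space C) (classifying_map C GFm) (classifying_map C Ie)"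
    and hD: "homotopic_with (\<lambda>_. True) (classifying_space D) (classifying_space D) (classifying_map D FGm) (classifying_map D Jm)"
  shows "homotopy_equivalence_map (classifying_space C) (classifying_space D) (classifying_map D Fm)"
    and "(classifying_space C) homotopy_equivalent_space (classifying_space D)"
proof -
  have C: "small_category C" and D: "small_category D" using F by (auto simp: cat_functor_def)
  have id: "classifying_map E K c = c"
    if "cat_functor E E Ko K" "\<And>f. f \<in> Mor E \<Longrightarrow> K f = f" "c \<in> topspace (classifying_space E)"
    for E :: "('x, 'y) cat" and Ko K c
  proof -
    have E: "small_category E" using that(1) by (simp add: cat_functor_def)
    \<comment> \<open>With the identity functor as both factors, \<open>K\<close> can be viewed as
      the composite.\<close>
    have "classifying_map E id (classifying_map E id c) = classifying_map E K c"
      by (rule classifying_map_compose[OF cat_functor_id[OF E] cat_functor_id[OF E] that(1)]) (use that in auto)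
    then show ?thesis by (simp add: classifying_map_id[OF E that(3)])
  qed
  have 1: "homotopic_with (\<lambda>_. True) (classifying_space C) (classifying_space C) (classifying_map C Gm \<circ> classifying_map D Fm) id"
    by (rule homotopic_with_eq[OF hC]) (auto simp: classifying_map_compose[OF F G GF] id[OF I])
  have 2: "homotopic_with (\<lambda>_. True) (classifying_space D) (classifying_space D) (classifying_map D Fm \<circ> classifying_map C Gm) id"
    by (rule homotopic_with_eq[OF hD]) (auto simp: classifying_map_compose[OF G F FG] id[OF J])
  note c = continuous_map_classifying_map[OF F] continuous_map_classifying_map[OF G]
  show "homotopy_equivalence_map (classifying_space C) (classifying_space D) (classifying_map D Fm)"
    unfolding homotopy_equivalence_map_def using 1 2 c by blast
  show "(classifying_space C) homotopy_equivalent_space (classifying_space D)"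
    unfolding homotopy_equivalent_space_def using 1 2 c by blast
qed

theorem homotopy_equivalence_H1_F2:
  fixes r :: nat
  defines "M \<equiv> (binary_matroid_cat r :: (nat matroid, _) cat)"
    and "L \<equiv> (Gl_cat r :: ((bit, nat H1_F2_elem) module, _) cat)"
  shows "cat_functor M L H1_F2 H1_F2_mor"
    and "homotopy_equivalence_map (classifying_space M) (classifying_space L) (classifying_map L H1_F2_mor)"
proof -
  interpret F: concrete_functor "binary_matroids r :: nat matroid set" ground matroid_hom "F2_spaces r" carrier linear_iso
      H1_F2 "\<lambda>M. H1_F2_map"
    by (rule concrete_functor_H1_F2)
  interpret G: concrete_functor "F2_spaces r :: (bit, nat H1_F2_elem) module set" carrier linear_iso
      "binary_matroids r" ground matroid_hom space_matroid "\<lambda>V W g n. space_enum W (g (space_nth V n))"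
    by (rule concrete_functor_space_matroid)
  interpret S: concrete_transformation "binary_matroids r" ground matroid_hom "binary_matroids r" ground matroid_hom
      id "\<lambda>M N f. f" sum_matroid sum_matroid_map "\<lambda>M e. 2 * e"
    by (rule transformation_id_sum_matroid)
  interpret T: concrete_transformation "binary_matroids r" ground matroid_hom "binary_matroids r" ground matroid_hom
     "space_matroid \<circ> H1_F2"
     "\<lambda>M N f n. space_enum (H1_F2 N) (restrict (H1_F2_map N f) (carrier (H1_F2 M)) (space_nth (H1_F2 M) n))"
     sum_matroid sum_matroid_map "\<lambda>M n. Suc (2 * n)"
    by (rule transformation_space_matroid_sum_matroid)
  interpret U: concrete_transformation "F2_spaces r :: (bit, nat H1_F2_elem) module set" carrier linear_iso "F2_spaces r" carrier linear_iso
    "H1_F2 \<circ> space_matroid"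
    "\<lambda>V W g. H1_F2_map (space_matroid W) (restrict (\<lambda>n. space_enum W (g (space_nth V n))) (ground (space_matroid V)))"
    id "\<lambda>V W g. g" homology_iso
    by (rule transformation_homology_iso)
  have M: "M = F.C.cat" and L: "L = F.D.cat"
    by (simp_all only: M_def L_def binary_matroid_cat_eq Gl_cat_eq)
  have mor: "H1_F2_mor = F.Fmor" unfolding H1_F2_mor_def F.Fmor_def by (rule refl)
  show "cat_functor M L H1_F2 H1_F2_mor" unfolding M L mor by (rule F.cat_functor_Fmor)
  show "homotopy_equivalence_map (classifying_space M) (classifying_space L) (classifying_map L H1_F2_mor)"
    unfolding M L mor
  proof (rule homotopy_equivalence_mapI[OF F.cat_functor_Fmor G.cat_functor_Fmor T.p.cat_functor_Fmor _
        U.p.cat_functor_Fmor _ S.p.cat_functor_Fmor _ U.q.cat_functor_Fmor])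
    show "T.p.Fmor f = G.Fmor (F.Fmor f)" for f
      by (cases f) (simp only: T.p.Fmor_def G.Fmor_def F.Fmor_def prod.case o_apply ground_space_matroid)
    show "U.p.Fmor f = F.Fmor (G.Fmor f)" for f
      by (cases f) (simp only: U.p.Fmor_def G.Fmor_def F.Fmor_def prod.case o_apply)
    show "S.p.Fmor f = f" if "f \<in> Mor F.C.cat" for f
      using that by (cases f) (simp add: S.p.Fmor_def extensional_restrict)
    show "U.q.Fmor f = f" if "f \<in> Mor F.D.cat" for f
      using that by (cases f) (simp add: U.q.Fmor_def extensional_restrict)
    \<comment> \<open>Both transformations end at the disjoint union, hence the second homotopy is
      reversed.\<close>
    show "homotopic_with (\<lambda>_. True) (classifying_space F.C.cat) (classifying_space F.C.cat)
        (classifying_map F.C.cat T.p.Fmor) (classifying_map F.C.cat S.p.Fmor)"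
      by (rule homotopic_with_trans[OF T.homotopic homotopic_with_symD[OF S.homotopic]])
    show "homotopic_with (\<lambda>_. True) (classifying_space F.D.cat) (classifying_space F.D.cat)
        (classifying_map F.D.cat U.p.Fmor) (classifying_map F.D.cat U.q.Fmor)"
      by (rule U.homotopic)
  qed
qed


section \<open>The general linear group\<close>

definition mat_of_linear :: "nat \<Rightarrow> (bit vec \<Rightarrow> bit vec) \<Rightarrow> bit mat" where
  "mat_of_linear r h = mat r r (\<lambda>(i, j). h (unit_vec r j) $ i)"

lemma mat_of_linear_carrier [simp]: "mat_of_linear r h \<in> carrier_mat r r"
  by (simp add: mat_of_linear_def)

text \<open>A vector over two scalars is the sum of the unit vectors in its support, so additivity
  determines \<open>h\<close>. The induction adds one unit vector at a time.\<close>

lemma mat_of_linear_mult_vec: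
  assumes maps: "h \<in> carrier_vec r \<rightarrow> carrier_vec r"
    and add: "\<And>v w. v \<in> carrier_vec r \<Longrightarrow> w \<in> carrier_vec r \<Longrightarrow> h (v + w) = h v + h w"
    and w: "w \<in> carrier_vec r"
  shows "mat_of_linear r h *\<^sub>v w = h w"
proof -
  let ?A = "mat_of_linear r h" and ?v = "\<lambda>S. vec r (\<lambda>i. if i \<in> S then 1 else 0 :: bit)"
  have unit: "?A *\<^sub>v unit_vec r j = h (unit_vec r j)" if "j < r" for j
  proof (rule eq_vecI)
    have hc: "h (unit_vec r j) \<in> carrier_vec r" using maps by auto
    then show "dim_vec (?A *\<^sub>v unit_vec r j) = dim_vec (h (unit_vec r j))" by (simp add: mat_of_linear_def)
    fix i assume "i < dim_vec (h (unit_vec r j))"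
    then have i: "i < r" using hc by simp
    then show "(?A *\<^sub>v unit_vec r j) $ i = h (unit_vec r j) $ i"
      using that by (simp add: mat_of_linear_def)
  qed
  have zero: "h (0\<^sub>v r) = 0\<^sub>v r"
  proof -
    have c: "h (0\<^sub>v r) \<in> carrier_vec r" using maps by auto
    have "h (0\<^sub>v r) + h (0\<^sub>v r) = h (0\<^sub>v r)" using add[of "0\<^sub>v r" "0\<^sub>v r"] by simp
    moreover have "h (0\<^sub>v r) + h (0\<^sub>v r) = 0\<^sub>v r" by (rule eq_vecI) (use c in \<open>auto simp: bit_double\<close>)
    ultimately show ?thesis by simp
  qed
  have claim: "?A *\<^sub>v ?v S = h (?v S)" if "finite S" "S \<subseteq> {..<r}" for S
    using that
  proof (induction S)
    case empty
    have "?v {} = 0\<^sub>v r" by (rule eq_vecI) auto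
    moreover have "?A *\<^sub>v 0\<^sub>v r = 0\<^sub>v r" by (rule eq_vecI) (auto simp: mat_of_linear_def)
    ultimately show ?case using zero by simp
  next
    case (insert j S)
    have eq: "?v (insert j S) = ?v S + unit_vec r j"
      by (rule eq_vecI) (use insert in auto)
    have "?A *\<^sub>v (?v S + unit_vec r j) = ?A *\<^sub>v ?v S + ?A *\<^sub>v unit_vec r j"
      by (rule mult_add_distrib_mat_vec[OF mat_of_linear_carrier]) auto
    also have "\<dots> = h (?v S) + h (unit_vec r j)" using insert unit[of j] by simp
    also have "\<dots> = h (?v S + unit_vec r j)" by (rule add[symmetric]) auto
    finally show ?case by (simp only: eq)
  qed
  have "w = ?v {i. i < r \<and> w $ i = 1}" by (rule eq_vecI) (use w in auto)
  then show ?thesis using claim[of "{i. i < r \<and> w $ i = 1}"] by auto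
qed

lemma mat_of_linear_mult:
  assumes A: "A \<in> carrier_mat r r" and h: "\<And>v. v \<in> carrier_vec r \<Longrightarrow> h v = A *\<^sub>v v"
  shows "mat_of_linear r h = A"
proof (rule eq_matI)
  fix i j assume "i < dim_row A" "j < dim_col A"
  then have ij: "i < r" "j < r" using A by auto
  then have "h (unit_vec r j) $ i = A $$ (i, j)" using A by (simp add: h)
  then show "mat_of_linear r h $$ (i, j) = A $$ (i, j)" using ij by (simp add: mat_of_linear_def)
qed (use A in \<open>auto simp: mat_of_linear_def\<close>)

lemma linear_iso_vecD:
  assumes "linear_iso (module_vec TYPE(bit) r) (module_vec TYPE(bit) r) h"
  shows "h \<in> carrier_vec r \<rightarrow> carrier_vec r"
    "\<And>v w. v \<in> carrier_vec r \<Longrightarrow> w \<in> carrier_vec r \<Longrightarrow> h (v + w) = h v + h w"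
    "\<And>w. w \<in> carrier_vec r \<Longrightarrow> mat_of_linear r h *\<^sub>v w = h w"
proof -
  show 1: "h \<in> carrier_vec r \<rightarrow> carrier_vec r" 
    using linear_isoD(4)[OF assms] by (simp add: module_vec_simps)
  show 2: "h (v + w) = h v + h w" if "v \<in> carrier_vec r" "w \<in> carrier_vec r" for v w
    using linear_isoD(7)[OF assms, of v w] that by (simp add: module_vec_simps)
  show "mat_of_linear r h *\<^sub>v w = h w" if "w \<in> carrier_vec r" for w
    by (rule mat_of_linear_mult_vec[OF 1 2 that])
qed

lemma mat_of_linear_compose:
  assumes "linear_iso (module_vec TYPE(bit) r) (module_vec TYPE(bit) r) h"
    "linear_iso (module_vec TYPE(bit) r) (module_vec TYPE(bit) r) k"
    "\<And>v. v \<in> carrier_vec r \<Longrightarrow> l v = k (h v)"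
  shows "mat_of_linear r l = mat_of_linear r k * mat_of_linear r h"
proof (rule mat_of_linear_mult)
  fix v :: "bit vec" assume v: "v \<in> carrier_vec r"
  have hv: "h v \<in> carrier_vec r" using linear_iso_vecD(1)[OF assms(1)] v by auto
  have "(mat_of_linear r k * mat_of_linear r h) *\<^sub>v v = mat_of_linear r k *\<^sub>v (mat_of_linear r h *\<^sub>v v)"
    by (rule assoc_mult_mat_vec[OF mat_of_linear_carrier mat_of_linear_carrier v])
  then show "l v = (mat_of_linear r k * mat_of_linear r h) *\<^sub>v v"
    using linear_iso_vecD(3)[OF assms(1) v] linear_iso_vecD(3)[OF assms(2) hv] assms(3)[OF v] by simp
qed (rule mult_carrier_mat[OF mat_of_linear_carrier mat_of_linear_carrier])

lemma mat_of_linear_id: "(\<And>v. v \<in> carrier_vec r \<Longrightarrow> h v = v) \<Longrightarrow> mat_of_linear r h = 1\<^sub>m r"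
  by (rule mat_of_linear_mult) auto

lemma GL_F2_simps:
  "carrier (GL_F2 r) = {A \<in> carrier_mat r r. \<exists>B\<in>carrier_mat r r. B * A = 1\<^sub>m r \<and> A * B = 1\<^sub>m r}"
  "A \<otimes>\<^bsub>GL_F2 r\<^esub> B = A * B" "\<one>\<^bsub>GL_F2 r\<^esub> = 1\<^sub>m r"
  by (simp_all add: GL_F2_def units_of_def Units_def ring_mat_def)

lemma group_GL_F2: "group (GL_F2 r)"
  unfolding GL_F2_def using ring.axioms ring_mat[of r "()", where 'a = bit]
  by (intro monoid.units_group) (auto simp: ring_def)

lemma small_category_group_cat: "group G \<Longrightarrow> small_category (group_cat G)"
proof -
  assume "group G"
  then interpret group G .
  show ?thesis by unfold_locales (auto simp: group_cat_def m_assoc)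
qed

text \<open>The inverse isomorphism supplies the inverse matrix.\<close>

lemma mat_of_linear_in_GL:
  assumes "linear_iso (module_vec TYPE(bit) r) (module_vec TYPE(bit) r) h"
  shows "mat_of_linear r h \<in> carrier (GL_F2 r)"
proof -
  let ?k = "inv_into (carrier_vec r) h"
  have k: "linear_iso (module_vec TYPE(bit) r) (module_vec TYPE(bit) r) ?k"
    using linear_iso_inv[OF assms] by (simp add: module_vec_simps)
  note h = linear_isoD[OF assms, unfolded module_vec_simps]
  have "mat_of_linear r ?k * mat_of_linear r h = 1\<^sub>m r"
    using mat_of_linear_compose[OF assms k, of "\<lambda>v. v"] mat_of_linear_id[of r "\<lambda>v. v"] h(5) by simp
  moreover have "mat_of_linear r h * mat_of_linear r ?k = 1\<^sub>m r"
    using mat_of_linear_compose[OF k assms, of "\<lambda>v. v"] mat_of_linear_id[of r "\<lambda>v. v"] h(6) f_inv_into_f[of _ h "carrier_vec r"] by simp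
  ultimately show ?thesis unfolding GL_F2_simps by auto
qed

lemma linear_iso_mult_mat_vec:
  assumes "A \<in> carrier (GL_F2 r)"
  shows "linear_iso (module_vec TYPE(bit) r) (module_vec TYPE(bit) r) (\<lambda>v. A *\<^sub>v v)"
proof -
  obtain B where A: "A \<in> carrier_mat r r" and B: "B \<in> carrier_mat r r" "B * A = 1\<^sub>m r" "A * B = 1\<^sub>m r"
    using assms by (auto simp: GL_F2_simps)
  have inv: "B *\<^sub>v (A *\<^sub>v v) = v" "A *\<^sub>v (B *\<^sub>v v) = v" if "v \<in> carrier_vec r" for v
    using assoc_mult_mat_vec[OF B(1) A that] assoc_mult_mat_vec[OF A B(1) that] B(2,3) that by simp_all
  show ?thesis
  proof (rule linear_isoI[OF F2_space_module_vec F2_space_module_vec], unfold module_vec_simps)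
    show "bij_betw (\<lambda>v. A *\<^sub>v v) (carrier_vec r) (carrier_vec r)"
      by (rule bij_betw_byWitness[where f' = "\<lambda>v. B *\<^sub>v v"]) (use inv A B(1) in auto)
  qed (rule mult_add_distrib_mat_vec[OF A])
qed

section \<open>Coordinates and the equivalence with the general linear group\<close>

definition coordinates :: "nat \<Rightarrow> (bit, 'v) module \<Rightarrow> 'v \<Rightarrow> bit vec" where
  "coordinates r V = (SOME f. linear_iso V (module_vec TYPE(bit) r) f)"

definition from_coordinates :: "nat \<Rightarrow> (bit, 'v) module \<Rightarrow> bit vec \<Rightarrow> 'v" where
  "from_coordinates r V = inv_into (carrier V) (coordinates r V)"

lemma coordinates:
  assumes "V \<in> F2_spaces r"
  shows "linear_iso V (module_vec TYPE(bit) r) (coordinates r V)"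
proof -
  have "F2_space V" "card (carrier V) = 2 ^ r" using assms by (simp_all add: F2_spaces_def)
  then obtain f where "linear_iso V (module_vec TYPE(bit) r) f" by (rule linear_iso_module_vec)
  then show ?thesis unfolding coordinates_def by (rule someI[of "linear_iso V (module_vec TYPE(bit) r)"])
qed

lemma from_coordinates: "V \<in> F2_spaces r \<Longrightarrow> linear_iso (module_vec TYPE(bit) r) V (from_coordinates r V)"
  unfolding from_coordinates_def by (rule linear_iso_inv[OF coordinates])

lemma from_coordinates_coordinates [simp]:
  "V \<in> F2_spaces r \<Longrightarrow> v \<in> carrier V \<Longrightarrow> from_coordinates r V (coordinates r V v) = v"
  unfolding from_coordinates_def by (rule inv_into_f_f[OF linear_isoD(5)[OF coordinates]])

lemma coordinates_from_coordinates [simp]: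
  "V \<in> F2_spaces r \<Longrightarrow> w \<in> carrier_vec r \<Longrightarrow> coordinates r V (from_coordinates r V w) = w"
  unfolding from_coordinates_def using linear_isoD(6)[OF coordinates, of V r]
  by (intro f_inv_into_f) (simp add: module_vec_simps)

lemma coordinates_closed: "V \<in> F2_spaces r \<Longrightarrow> v \<in> carrier V \<Longrightarrow> coordinates r V v \<in> carrier_vec r"
  using linear_isoD(4)[OF coordinates, of V r] by (auto simp: module_vec_simps)

lemma from_coordinates_closed: "V \<in> F2_spaces r \<Longrightarrow> w \<in> carrier_vec r \<Longrightarrow> from_coordinates r V w \<in> carrier V"
  using linear_isoD(4)[OF from_coordinates, of V r] by (auto simp: module_vec_simps)

definition matrix_of_mor :: "nat \<Rightarrow> (bit, 'v) module \<times> ('v \<Rightarrow> 'v) \<times> (bit, 'v) module \<Rightarrow> bit mat" where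
  "matrix_of_mor r = (\<lambda>(V, f, W). mat_of_linear r (coordinates r W \<circ> f \<circ> from_coordinates r V))"

definition mor_of_matrix :: "nat \<Rightarrow> (bit, 'v) module \<Rightarrow> bit mat \<Rightarrow> (bit, 'v) module \<times> ('v \<Rightarrow> 'v) \<times> (bit, 'v) module" where
  "mor_of_matrix r V A = (V, restrict (\<lambda>v. from_coordinates r V (A *\<^sub>v coordinates r V v)) (carrier V), V)"

lemma linear_iso_in_coordinates:
  assumes "V \<in> F2_spaces r" "W \<in> F2_spaces r" "linear_iso V W f"
  shows "linear_iso (module_vec TYPE(bit) r) (module_vec TYPE(bit) r) (coordinates r W \<circ> f \<circ> from_coordinates r V)"
  using linear_iso_compose[OF from_coordinates[OF assms(1)] linear_iso_compose[OF assms(3) coordinates[OF assms(2)]]]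
  by (simp add: o_assoc)

context
  fixes r :: nat
begin

interpretation L: concrete_category "F2_spaces r" carrier linear_iso by (rule concrete_category_spaces)

text \<open>In the matrix of a composite the two coordinate changes on the middle space
  cancel.\<close>

lemma cat_functor_matrix_of_mor:
  "cat_functor (concrete_cat (F2_spaces r) carrier linear_iso) (group_cat (GL_F2 r)) (\<lambda>_. ()) (matrix_of_mor r)"
proof (intro cat_functor.intro cat_functor_axioms.intro L.small_category_cat small_category_group_cat group_GL_F2)
  fix f assume "f \<in> Mor L.cat"
  moreover obtain V u W where f: "f = (V, u, W)" by (cases f)
  ultimately show "matrix_of_mor r f \<in> Mor (group_cat (GL_F2 r))"
    using mat_of_linear_in_GL[OF linear_iso_in_coordinates] by (auto simp: matrix_of_mor_def group_cat_def)
next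
  fix V assume "V \<in> Ob L.cat"
  then have V: "V \<in> F2_spaces r" by simp
  have "mat_of_linear r (coordinates r V \<circ> restrict id (carrier V) \<circ> from_coordinates r V) = 1\<^sub>m r"
    by (rule mat_of_linear_id) (simp add: V from_coordinates_closed)
  then show "matrix_of_mor r (Id L.cat V) = Id (group_cat (GL_F2 r)) ()"
    by (simp add: matrix_of_mor_def group_cat_def GL_F2_simps)
next
  fix f g assume fg: "f \<in> Mor L.cat" "g \<in> Mor L.cat" "Cod L.cat f = Dom L.cat g"
  obtain U u V V' v W where eq: "f = (U, u, V)" "g = (V', v, W)" by (cases f; cases g)
  then have c: "U \<in> F2_spaces r" "V \<in> F2_spaces r" "W \<in> F2_spaces r" "linear_iso U V u" "linear_iso V W v" "V' = V"
    using fg by auto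
  have "mat_of_linear r (coordinates r W \<circ> compose (carrier U) v u \<circ> from_coordinates r U) =
     mat_of_linear r (coordinates r W \<circ> v \<circ> from_coordinates r V) * mat_of_linear r (coordinates r V \<circ> u \<circ> from_coordinates r U)"
  proof (rule mat_of_linear_compose[OF linear_iso_in_coordinates[OF c(1,2,4)] linear_iso_in_coordinates[OF c(2,3,5)]])
    fix w :: "bit vec" assume "w \<in> carrier_vec r"
    then have x: "from_coordinates r U w \<in> carrier U" by (rule from_coordinates_closed[OF c(1)])
    then have "u (from_coordinates r U w) \<in> carrier V" using linear_isoD(4)[OF c(4)] by auto
    then show "(coordinates r W \<circ> compose (carrier U) v u \<circ> from_coordinates r U) w =
        (coordinates r W \<circ> v \<circ> from_coordinates r V) ((coordinates r V \<circ> u \<circ> from_coordinates r U) w)"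
      using x c(2) by (simp add: compose_def)
  qed
  then show "matrix_of_mor r (Comp L.cat g f) = Comp (group_cat (GL_F2 r)) (matrix_of_mor r g) (matrix_of_mor r f)"
    by (simp add: eq c(6) matrix_of_mor_def group_cat_def GL_F2_simps)
qed (simp_all add: group_cat_def)

context
  fixes V\<^sub>0 :: "(bit, 'v) module"
  assumes V\<^sub>0: "V\<^sub>0 \<in> F2_spaces r"
begin

lemma linear_iso_of_matrix:
  assumes "A \<in> carrier (GL_F2 r)"
  shows "linear_iso V\<^sub>0 V\<^sub>0 (\<lambda>v. from_coordinates r V\<^sub>0 (A *\<^sub>v coordinates r V\<^sub>0 v))"
  using linear_iso_compose[OF coordinates[OF V\<^sub>0] linear_iso_compose[OF linear_iso_mult_mat_vec[OF assms] from_coordinates[OF V\<^sub>0]]]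
  by (simp add: o_def)

lemma cat_functor_mor_of_matrix:
  "cat_functor (group_cat (GL_F2 r)) (concrete_cat (F2_spaces r) carrier linear_iso) (\<lambda>_. V\<^sub>0) (mor_of_matrix r V\<^sub>0)"
proof (intro cat_functor.intro cat_functor_axioms.intro L.small_category_cat small_category_group_cat group_GL_F2)
  fix A assume "A \<in> Mor (group_cat (GL_F2 r))"
  then have A: "A \<in> carrier (GL_F2 r)" by (simp add: group_cat_def)
  show "mor_of_matrix r V\<^sub>0 A \<in> Mor L.cat"
    using L.hom_restrict[OF V\<^sub>0 V\<^sub>0 linear_iso_of_matrix[OF A]] V\<^sub>0 by (simp add: mor_of_matrix_def)
next
  show "mor_of_matrix r V\<^sub>0 (Id (group_cat (GL_F2 r)) x) = Id L.cat V\<^sub>0" for x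
    using V\<^sub>0 by (auto simp: mor_of_matrix_def group_cat_def GL_F2_simps fun_eq_iff restrict_def coordinates_closed)
next
  fix A B assume "A \<in> Mor (group_cat (GL_F2 r))" "B \<in> Mor (group_cat (GL_F2 r))"
  then have AB: "A \<in> carrier_mat r r" "B \<in> carrier_mat r r" by (auto simp: group_cat_def GL_F2_simps)
  have "from_coordinates r V\<^sub>0 ((B * A) *\<^sub>v coordinates r V\<^sub>0 v) =
     from_coordinates r V\<^sub>0 (B *\<^sub>v coordinates r V\<^sub>0 (from_coordinates r V\<^sub>0 (A *\<^sub>v coordinates r V\<^sub>0 v)))"
     "from_coordinates r V\<^sub>0 (A *\<^sub>v coordinates r V\<^sub>0 v) \<in> carrier V\<^sub>0" if v: "v \<in> carrier V\<^sub>0" for v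
  proof -
    have Av: "A *\<^sub>v coordinates r V\<^sub>0 v \<in> carrier_vec r" using AB(1) coordinates_closed[OF V\<^sub>0 v] by simp
    show "from_coordinates r V\<^sub>0 (A *\<^sub>v coordinates r V\<^sub>0 v) \<in> carrier V\<^sub>0" by (rule from_coordinates_closed[OF V\<^sub>0 Av])
    show "from_coordinates r V\<^sub>0 ((B * A) *\<^sub>v coordinates r V\<^sub>0 v) =
      from_coordinates r V\<^sub>0 (B *\<^sub>v coordinates r V\<^sub>0 (from_coordinates r V\<^sub>0 (A *\<^sub>v coordinates r V\<^sub>0 v)))"
      by (simp only: coordinates_from_coordinates[OF V\<^sub>0 Av] assoc_mult_mat_vec[OF AB(2,1) coordinates_closed[OF V\<^sub>0 v]])
  qed
  then show "mor_of_matrix r V\<^sub>0 (Comp (group_cat (GL_F2 r)) B A) = Comp L.cat (mor_of_matrix r V\<^sub>0 B) (mor_of_matrix r V\<^sub>0 A)"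
    by (auto simp: mor_of_matrix_def group_cat_def GL_F2_simps fun_eq_iff restrict_def compose_def)
qed (simp_all add: mor_of_matrix_def V\<^sub>0)

text \<open>The component at \<open>V\<close> matches vectors of \<open>V\<close> and
  \<open>V\<^sub>0\<close> with equal coordinates. It is natural because the matrix of a morphism
  describes that morphism in coordinates.\<close>

lemma natural_transformation_to_basepoint:
  "natural_transformation (concrete_cat (F2_spaces r) carrier linear_iso) (concrete_cat (F2_spaces r) carrier linear_iso)
     id id ((\<lambda>_. V\<^sub>0) \<circ> (\<lambda>_. ())) (mor_of_matrix r V\<^sub>0 \<circ> matrix_of_mor r)
     (\<lambda>V. (V, restrict (\<lambda>v. from_coordinates r V\<^sub>0 (coordinates r V v)) (carrier V), V\<^sub>0))"
proof (intro natural_transformation.intro natural_transformation_axioms.intro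
    cat_functor_id[OF L.small_category_cat] cat_functor_compose[OF cat_functor_matrix_of_mor cat_functor_mor_of_matrix])
  fix V :: "(bit, 'v) module" assume "V \<in> Ob L.cat"
  then have V: "V \<in> F2_spaces r" by simp
  have "linear_iso V V\<^sub>0 (\<lambda>v. from_coordinates r V\<^sub>0 (coordinates r V v))"
    using linear_iso_compose[OF coordinates[OF V] from_coordinates[OF V\<^sub>0]] by (simp add: o_def)
  then show "(V, restrict (\<lambda>v. from_coordinates r V\<^sub>0 (coordinates r V v)) (carrier V), V\<^sub>0) \<in> Mor L.cat"
    using L.hom_restrict[OF V V\<^sub>0] V V\<^sub>0 by simp
next
  fix f :: "(bit, 'v) module \<times> ('v \<Rightarrow> 'v) \<times> (bit, 'v) module" assume "f \<in> Mor L.cat"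
  moreover obtain V u W where f: "f = (V, u, W)" by (cases f)
  ultimately have c: "V \<in> F2_spaces r" "W \<in> F2_spaces r" "linear_iso V W u" by auto
  let ?h = "coordinates r W \<circ> u \<circ> from_coordinates r V"
  have "from_coordinates r V\<^sub>0 (coordinates r W (u v)) =
      from_coordinates r V\<^sub>0 (mat_of_linear r ?h *\<^sub>v coordinates r V\<^sub>0 (from_coordinates r V\<^sub>0 (coordinates r V v)))"
      "u v \<in> carrier W" "from_coordinates r V\<^sub>0 (coordinates r V v) \<in> carrier V\<^sub>0"
    if v: "v \<in> carrier V" for v
  proof -
    note cv = coordinates_closed[OF c(1) v]
    show "from_coordinates r V\<^sub>0 (coordinates r V v) \<in> carrier V\<^sub>0" by (rule from_coordinates_closed[OF V\<^sub>0 cv])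
    show "u v \<in> carrier W" using linear_isoD(4)[OF c(3)] v by auto
    show "from_coordinates r V\<^sub>0 (coordinates r W (u v)) =
      from_coordinates r V\<^sub>0 (mat_of_linear r ?h *\<^sub>v coordinates r V\<^sub>0 (from_coordinates r V\<^sub>0 (coordinates r V v)))"
      by (simp add: V\<^sub>0 cv linear_iso_vecD(3)[OF linear_iso_in_coordinates[OF c] cv] c(1) v)
  qed
  then show "Comp L.cat (Cod L.cat f, restrict (\<lambda>v. from_coordinates r V\<^sub>0 (coordinates r (Cod L.cat f) v)) (carrier (Cod L.cat f)), V\<^sub>0) (id f) =
      Comp L.cat ((mor_of_matrix r V\<^sub>0 \<circ> matrix_of_mor r) f)
        (Dom L.cat f, restrict (\<lambda>v. from_coordinates r V\<^sub>0 (coordinates r (Dom L.cat f) v)) (carrier (Dom L.cat f)), V\<^sub>0)"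
    by (auto simp: f mor_of_matrix_def matrix_of_mor_def fun_eq_iff restrict_def compose_def)
qed simp_all

text \<open>The same coordinates of \<open>V\<^sub>0\<close> are used in both directions, so this
  composite is strictly the identity and contributes a constant homotopy.\<close>

lemma matrix_of_mor_of_matrix:
  assumes "A \<in> carrier (GL_F2 r)"
  shows "matrix_of_mor r (mor_of_matrix r V\<^sub>0 A) = A"
proof -
  have A: "A \<in> carrier_mat r r" using assms by (simp add: GL_F2_simps)
  show ?thesis
    unfolding matrix_of_mor_def mor_of_matrix_def prod.case
    by (rule mat_of_linear_mult[OF A]) (use A V\<^sub>0 in \<open>simp add: from_coordinates_closed\<close>)
qed

lemma homotopy_equivalent_group_cat_GL_F2:
  "classifying_space (Gl_cat r :: ((bit, 'v) module, _) cat) homotopy_equivalent_space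
   classifying_space (group_cat (GL_F2 r))"
  unfolding Gl_cat_eq
proof (rule homotopy_equivalence_mapI(2)[OF cat_functor_matrix_of_mor cat_functor_mor_of_matrix
      cat_functor_compose[OF cat_functor_matrix_of_mor cat_functor_mor_of_matrix] _
      cat_functor_compose[OF cat_functor_mor_of_matrix cat_functor_matrix_of_mor] _
      cat_functor_id[OF L.small_category_cat] _
      cat_functor_id[OF small_category_group_cat[OF group_GL_F2]]])
  show "homotopic_with (\<lambda>_. True) (classifying_space L.cat) (classifying_space L.cat)
      (classifying_map L.cat (mor_of_matrix r V\<^sub>0 \<circ> matrix_of_mor r)) (classifying_map L.cat id)"
    by (rule homotopic_with_symD[OF natural_transformation.homotopic_classifying_maps[OF natural_transformation_to_basepoint]])
  have PQ: "cat_functor (group_cat (GL_F2 r)) (group_cat (GL_F2 r)) ((\<lambda>_. ()) \<circ> (\<lambda>_. V\<^sub>0)) (matrix_of_mor r \<circ> mor_of_matrix r V\<^sub>0)"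
    by (rule cat_functor_compose[OF cat_functor_mor_of_matrix cat_functor_matrix_of_mor])
  note I = cat_functor_id[OF small_category_group_cat[OF group_GL_F2]]
  show "homotopic_with (\<lambda>_. True) (classifying_space (group_cat (GL_F2 r))) (classifying_space (group_cat (GL_F2 r)))
      (classifying_map (group_cat (GL_F2 r)) (matrix_of_mor r \<circ> mor_of_matrix r V\<^sub>0)) (classifying_map (group_cat (GL_F2 r)) id)"
  proof (rule homotopic_with_equal[OF TrueI TrueI continuous_map_classifying_map[OF PQ]])
    fix c assume c: "c \<in> topspace (classifying_space (group_cat (GL_F2 r)))"
    have "classifying_map (group_cat (GL_F2 r)) id (classifying_map (group_cat (GL_F2 r)) id c) =
        classifying_map (group_cat (GL_F2 r)) (matrix_of_mor r \<circ> mor_of_matrix r V\<^sub>0) c"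
      by (rule classifying_map_compose[OF I I PQ _ c]) (simp add: group_cat_def matrix_of_mor_of_matrix)
    then show "classifying_map (group_cat (GL_F2 r)) (matrix_of_mor r \<circ> mor_of_matrix r V\<^sub>0) c =
        classifying_map (group_cat (GL_F2 r)) id c"
      by (simp only: classifying_map_id[OF small_category_group_cat[OF group_GL_F2] c])
  qed
qed simp_all

end

end

text \<open>The base space has to be carried by the type of homology elements. The homology of the
  matroid of all vectors of the standard space provides one.\<close>

lemma F2_spaces_nonempty: "(H1_F2 (space_matroid (module_vec TYPE(bit) r))) \<in> F2_spaces r"
  by (intro binary_matroids_H1_F2(2) space_matroid_in_binary_matroids)
    (simp add: F2_spaces_def F2_space_module_vec module_vec_simps card_carrier_vec_bit)

theorem theorem2p5:
  fixes r :: nat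
  shows "let M = (binary_matroid_cat r :: (nat matroid, _) cat);
             L = (Gl_cat r :: ((bit, nat H1_F2_elem) module, _) cat)
         in cat_functor M L H1_F2 H1_F2_mor
          \<and> homotopy_equivalence_map (classifying_space M) (classifying_space L)
               (classifying_map L H1_F2_mor)
          \<and> classifying_space L homotopy_equivalent_space classifying_space (group_cat (GL_F2 r))"
  unfolding Let_def
  by (intro conjI homotopy_equivalence_H1_F2 homotopy_equivalent_group_cat_GL_F2[OF F2_spaces_nonempty])


end
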